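(* Let $f$ be a full branch piecewise $\mathcal C^r$ ($r\ge 2$) expanding map of $[0,1]$ with $f'>\lambda>1$ (as in the context). Consider $\mathcal L_1$ as an operator acting on $W^{1,1}([0,1])$. Then $$\sigma_{\mathrm{ess}}(\mathcal L_1)\subset\{z\in\mathbb C:|z|\le\lambda^{-1}\}.$$ Moreover $$\sigma(\mathcal L_1)\setminus\{1\}\subset\{z\in\mathbb C:|z|\le\tau\},\qquad \tau=\lambda^{-1}+\int_0^1\left|\left(\frac1{f'(y)}\right)'\right|dy .$$
   Context: A full branch piecewise $\mathcal C^r$ expanding map $f:[0,1]\to[0,1]$: there is a partition $0=p_1<\dots<p_{N+1}=1$ such that for each $i$ the restriction of $f$ to $(p_i,p_{i+1})$ extends to a $\mathcal C^r$ map of $[p_i,p_{i+1}]$ onto $[0,1]$, and $f'>\lambda>1$. All derivatives of $f$ (including $(1/f')'$) are taken only at the smoothness points of $f$, i.e. branch by branch. The transfer operator is $\mathcal L_1h(x)=\sum_{y\in f^{-1}(x)}\frac{h(y)}{f'(y)}$, the sum being over the $N$ inverse branches. *)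

theory Defs
  imports "HOL-Analysis.Analysis"
begin

section \<open>Full branch piecewise $C^r$ expanding maps\<close>

text \<open>
  The function \<open>D k\<close> is the \<open>k\<close>-th derivative; at the end points of an interval \<open>S\<close> the
  derivatives are one-sided.
\<close>
definition C_k_on :: "nat \<Rightarrow> (real \<Rightarrow> real) \<Rightarrow> real set \<Rightarrow> bool" where
  "C_k_on r F S \<longleftrightarrow>
    (\<exists>D :: nat \<Rightarrow> real \<Rightarrow> real.
       (\<forall>x\<in>S. D 0 x = F x) \<and>
       (\<forall>k<r. \<forall>x\<in>S. (D k has_real_derivative D (Suc k) x) (at x within S)) \<and>
       (\<forall>k\<le>r. continuous_on S (D k)))"

text \<open>
  The break points are \<open>p 1 < \<dots> < p (N + 1)\<close>.  At the break points nothing is assumed about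
  \<open>f\<close> apart from \<open>f x \<in> {0..1}\<close>.
\<close>
definition full_branch_expanding ::
    "nat \<Rightarrow> nat \<Rightarrow> (nat \<Rightarrow> real) \<Rightarrow> real \<Rightarrow> (real \<Rightarrow> real) \<Rightarrow> bool" where
  "full_branch_expanding r N p lam f \<longleftrightarrow>
     (\<forall>x\<in>{0..1}. f x \<in> {0..1}) \<and>
     p 1 = 0 \<and> p (N + 1) = 1 \<and> (\<forall>i\<in>{1..N}. p i < p (i + 1)) \<and>
     (\<forall>i\<in>{1..N}. \<exists>F. (\<forall>x\<in>{p i<..<p (i + 1)}. F x = f x) \<and>
        C_k_on r F {p i..p (i + 1)} \<and> F ` {p i..p (i + 1)} = {0..1}) \<and>
     lam > 1 \<and>
     (\<forall>i\<in>{1..N}. \<forall>x\<in>{p i<..<p (i + 1)}. deriv f x > lam)"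

text \<open>
  The transfer operator, with the sum running over the preimages of \<open>x\<close> at smoothness points.
  For \<open>0 < x < 1\<close> there is exactly one such preimage in each of the \<open>N\<close> branches.  For
  \<open>x \<in> {0, 1}\<close> there is none and the sum is \<open>0\<close>; this null set is irrelevant, since functions
  are considered only up to equality almost everywhere (see below).
\<close>
definition transfer_operator ::
    "nat \<Rightarrow> (nat \<Rightarrow> real) \<Rightarrow> (real \<Rightarrow> real) \<Rightarrow> (real \<Rightarrow> complex) \<Rightarrow> (real \<Rightarrow> complex)" where
  "transfer_operator N p f h =
     (\<lambda>x. \<Sum>y\<in>{y \<in> {0..1} - p ` {1..N + 1}. f y = x}. h y / of_real (deriv f y))"

section \<open>The Sobolev space $W^{1,1}([0,1])$\<close>

definition test_function :: "(real \<Rightarrow> real) \<Rightarrow> bool" where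
  "test_function \<phi> \<longleftrightarrow> (\<forall>n. C_k_on n \<phi> UNIV) \<and>
     (\<exists>a b. 0 < a \<and> b < 1 \<and> (\<forall>x. x \<notin> {a..b} \<longrightarrow> \<phi> x = 0))"

definition weak_derivative :: "(real \<Rightarrow> complex) \<Rightarrow> (real \<Rightarrow> complex) \<Rightarrow> bool" where
  "weak_derivative h g \<longleftrightarrow>
     integrable (lebesgue_on {0..1}) g \<and>
     (\<forall>\<phi>. test_function \<phi> \<longrightarrow>
        (LINT x|lebesgue_on {0..1}. h x * of_real (deriv \<phi> x)) =
        - (LINT x|lebesgue_on {0..1}. g x * of_real (\<phi> x)))"

text \<open>
  Elements of $W^{1,1}$ are represented by functions, whose values outside \<open>{0..1}\<close> are
  irrelevant.  Two functions represent the same element iff they agree almost everywhere on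
  \<open>{0..1}\<close>, that is, iff their difference has norm \<open>0\<close>.  The choice of the weak derivative,
  unique up to a null set, does not influence the norm.
\<close>
definition W11 :: "(real \<Rightarrow> complex) set" where
  "W11 = {h. integrable (lebesgue_on {0..1}) h \<and> (\<exists>g. weak_derivative h g)}"

definition W11_norm :: "(real \<Rightarrow> complex) \<Rightarrow> real" where
  "W11_norm h = (LINT x|lebesgue_on {0..1}. norm (h x)) +
     (LINT x|lebesgue_on {0..1}. norm ((SOME g. weak_derivative h g) x))"

section \<open>Spectrum and essential spectrum\<close>

text \<open>
  A complex normed space is given by a linear space \<open>V\<close> of complex functions and a seminorm
  \<open>nrm\<close> on \<open>V\<close>, and consists of the classes of functions in \<open>V\<close> modulo functions of seminorm
  \<open>0\<close>.  Accordingly \<open>u\<close> and \<open>v\<close> are equal as elements of the space iff \<open>nrm (u - v) = 0\<close>.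
  A map which is bounded and linear in the following sense respects this equality.
\<close>
definition bounded_operator ::
    "('a \<Rightarrow> complex) set \<Rightarrow> (('a \<Rightarrow> complex) \<Rightarrow> real) \<Rightarrow>
     (('a \<Rightarrow> complex) \<Rightarrow> ('a \<Rightarrow> complex)) \<Rightarrow> bool" where
  "bounded_operator V nrm T \<longleftrightarrow>
     (\<forall>h\<in>V. T h \<in> V) \<and>
     (\<forall>h\<in>V. \<forall>k\<in>V. \<forall>a b.
        nrm (\<lambda>x. T (\<lambda>y. a * h y + b * k y) x - (a * T h x + b * T k x)) = 0) \<and>
     (\<exists>C. \<forall>h\<in>V. nrm (T h) \<le> C * nrm h)"

definition shifted ::
    "complex \<Rightarrow> (('a \<Rightarrow> complex) \<Rightarrow> ('a \<Rightarrow> complex)) \<Rightarrow> (('a \<Rightarrow> complex) \<Rightarrow> ('a \<Rightarrow> complex))" where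
  "shifted z T h = (\<lambda>x. z * h x - T h x)"

text \<open>The set of all \<open>z\<close> such that \<open>z - T\<close> is not invertible as a bounded operator.\<close>
definition spectrum ::
    "('a \<Rightarrow> complex) set \<Rightarrow> (('a \<Rightarrow> complex) \<Rightarrow> real) \<Rightarrow>
     (('a \<Rightarrow> complex) \<Rightarrow> ('a \<Rightarrow> complex)) \<Rightarrow> complex set" where
  "spectrum V nrm T = {z. \<not> (bounded_operator V nrm (shifted z T) \<and>
     (\<exists>R. bounded_operator V nrm R \<and>
        (\<forall>h\<in>V. nrm (\<lambda>x. R (shifted z T h) x - h x) = 0) \<and>
        (\<forall>h\<in>V. nrm (\<lambda>x. shifted z T (R h) x - h x) = 0)))}"

definition closed_range ::
    "('a \<Rightarrow> complex) set \<Rightarrow> (('a \<Rightarrow> complex) \<Rightarrow> real) \<Rightarrow>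
     (('a \<Rightarrow> complex) \<Rightarrow> ('a \<Rightarrow> complex)) \<Rightarrow> bool" where
  "closed_range V nrm T \<longleftrightarrow>
     (\<forall>u g. (\<forall>n::nat. u n \<in> V) \<and> g \<in> V \<and>
        (\<lambda>n. nrm (\<lambda>x. T (u n) x - g x)) \<longlonglongrightarrow> 0 \<longrightarrow>
        (\<exists>h\<in>V. nrm (\<lambda>x. T h x - g x) = 0))"

text \<open>The union of the kernels of all powers of \<open>T\<close> has finite dimension.\<close>
definition finite_generalized_kernel ::
    "('a \<Rightarrow> complex) set \<Rightarrow> (('a \<Rightarrow> complex) \<Rightarrow> real) \<Rightarrow>
     (('a \<Rightarrow> complex) \<Rightarrow> ('a \<Rightarrow> complex)) \<Rightarrow> bool" where
  "finite_generalized_kernel V nrm T \<longleftrightarrow>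
     (\<exists>B. finite B \<and> B \<subseteq> V \<and>
        (\<forall>h\<in>V. (\<exists>n. nrm ((T ^^ n) h) = 0) \<longrightarrow>
           (\<exists>c. nrm (\<lambda>x. h x - (\<Sum>b\<in>B. c b * b x)) = 0)))"

text \<open>
  The essential spectrum in the sense of Browder.  Its complement in the spectrum consists of
  the isolated eigenvalues of finite algebraic multiplicity.
\<close>
definition essential_spectrum ::
    "('a \<Rightarrow> complex) set \<Rightarrow> (('a \<Rightarrow> complex) \<Rightarrow> real) \<Rightarrow>
     (('a \<Rightarrow> complex) \<Rightarrow> ('a \<Rightarrow> complex)) \<Rightarrow> complex set" where
  "essential_spectrum V nrm T = {z \<in> spectrum V nrm T.
     z islimpt spectrum V nrm T \<or>
     \<not> closed_range V nrm (shifted z T) \<or>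
     \<not> finite_generalized_kernel V nrm (shifted z T)}"

end

theory Submission
  imports Defs "HOL-Library.Function_Algebras"
begin

text \<open>
  Write \<open>L\<close> for the transfer operator, \<open>D\<close> for the weak derivative and \<open>u\<close> for \<open>1 / f'\<close>.  The change of
  variables \<open>x = f y\<close> on each branch shows that \<open>L\<close> preserves the integral and does not increase the
  \<open>L\<^sup>1\<close> norm (\<open>transfer_integral\<close>, \<open>transfer_norm\<close>).  Testing against \<open>\<phi> \<circ> f\<close> gives the product rule
  \<open>D (L h) = L (u D h + u' h)\<close> (\<open>weak_derivative_transfer\<close>).  Its first term contracts \<open>D h\<close> by the factor
  \<open>1 / lam\<close>, and its second term no longer contains a derivative of \<open>h\<close>.

  Every class in \<open>W11\<close> is the sum of its mean and the mean zero primitive of its weak derivative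
  (\<open>weak_derivative_representation\<close>).  Hence the modulus of the mean plus the \<open>L\<^sup>1\<close> norm of \<open>D h\<close> is
  an equivalent norm, complete because \<open>L\<^sup>1\<close> is, and a function of mean zero is bounded by the
  \<open>L\<^sup>1\<close> norm of its derivative.  In this norm the second term of the product rule can be reduced by
  operators of finite rank in two ways.  Subtracting the mean of \<open>h\<close> times \<open>L 1\<close> replaces \<open>h\<close> by its
  deviation from the mean and leaves an operator of norm at most \<open>\<tau>\<close>, which is \<open>1 / lam\<close> plus
  the \<open>L\<^sup>1\<close> norm of \<open>u'\<close> (\<open>transfer_minus_mean\<close>).  Replacing \<open>h\<close> by its values at \<open>n\<close>
  equidistant points leaves an error of at most \<open>1 / n\<close> times the \<open>L\<^sup>1\<close> norm of \<open>D h\<close>, so \<open>L\<close> is within \<open>1 / lam + C / n\<close> of an operator of finite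
  rank, where \<open>C\<close> bounds the modulus of \<open>u'\<close> (\<open>transfer_ess_bounded\<close>).

  The rest is perturbation theory.  Let \<open>T = Q + F\<close> where \<open>Q\<close> has norm at most \<open>c\<close> and \<open>F\<close> has finite rank, and
  let \<open>c < |z|\<close>.  Then \<open>z - Q\<close> is invertible by the Neumann series, and the equation
  \<open>(z - T) h = g\<close> reduces to a finite linear system.  So the range of \<open>z - T\<close> is closed, and \<open>z\<close> is in
  the spectrum only as an eigenvalue (\<open>ess_bounded_closed_range\<close>, \<open>not_invertible_eigenvector\<close>).
  If spectral values accumulated at \<open>z\<close>, or if the generalized kernel of \<open>z - T\<close> had infinite
  dimension, there would be an infinite sequence of vectors on which \<open>T\<close> is triangular with diagonal
  entries of modulus at least some \<open>R > c\<close>.  This is impossible (\<open>no_triangular_chain\<close>): by Riesz's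
  lemma \<open>T\<^sup>n\<close> would spread a bounded sequence to mutual distances of order \<open>R\<^sup>n\<close>, while up to
  subsequences it shrinks distances to order \<open>c'\<^sup>n\<close> for any \<open>c' > c\<close>.  With \<open>c\<close> close to \<open>1 / lam\<close> this
  bounds the essential spectrum.  Finally, an eigenfunction for an eigenvalue \<open>z \<noteq> 1\<close> has mean zero
  because \<open>L\<close> preserves the integral, and on functions of mean zero \<open>L\<close> has norm at most \<open>\<tau>\<close>, so
  \<open>|z| \<le> \<tau>\<close>.
\<close>

section \<open>Linear systems\<close>

text \<open>
  Gaussian elimination: an equation with a nonzero coefficient expresses one unknown by the others,
  and removing both leaves a system that is still underdetermined.
\<close>
lemma underdetermined_system:
  fixes A :: "'i \<Rightarrow> 'j \<Rightarrow> complex"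
  assumes "finite I" "finite J" "card I < card J"
  shows "\<exists>x. (\<exists>j\<in>J. x j \<noteq> 0) \<and> (\<forall>i\<in>I. (\<Sum>j\<in>J. A i j * x j) = 0)"
  using assms
proof (induction I arbitrary: J A rule: finite_induct)
  case empty
  then have "J \<noteq> {}" by auto
  then show ?case by (intro exI[of _ "\<lambda>_. 1"]) auto
next
  case (insert i0 I J A)
  show ?case
  proof (cases "\<forall>j\<in>J. A i0 j = 0")
    case True
    have "card I < card J" using insert by simp
    from insert.IH[OF \<open>finite J\<close> this, of A] obtain x
      where "\<exists>j\<in>J. x j \<noteq> 0" "\<forall>i\<in>I. (\<Sum>j\<in>J. A i j * x j) = 0" by blast
    then show ?thesis using True by (intro exI[of _ x]) auto
  next
    case False
    then obtain j0 where j0: "j0 \<in> J" "A i0 j0 \<noteq> 0" by blast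
    define J' where "J' = J - {j0}"
    have J': "finite J'" "card I < card J'" "J = insert j0 J'" "j0 \<notin> J'"
      using insert j0 by (auto simp: J'_def)
    \<comment> \<open>the rows after elimination of the unknown \<open>j0\<close>\<close>
    define A' where "A' i j = A i j - A i j0 / A i0 j0 * A i0 j" for i j
    from insert.IH[OF J'(1,2), of A'] obtain x
      where x: "\<exists>j\<in>J'. x j \<noteq> 0" "\<forall>i\<in>I. (\<Sum>j\<in>J'. A' i j * x j) = 0" by blast
    define s where "s = (\<Sum>j\<in>J'. A i0 j * x j)"
    define y where "y = x(j0 := - s / A i0 j0)"
    have y: "(\<Sum>j\<in>J. A i j * y j) = - A i j0 * s / A i0 j0 + (\<Sum>j\<in>J'. A i j * x j)" for i
    proof -
      have "(\<Sum>j\<in>J'. A i j * y j) = (\<Sum>j\<in>J'. A i j * x j)"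
        by (rule sum.cong) (use J' in \<open>auto simp: y_def\<close>)
      then show ?thesis using J' by (simp add: y_def)
    qed
    have "(\<Sum>j\<in>J. A i j * y j) = 0" if "i \<in> I" for i
    proof -
      have "0 = (\<Sum>j\<in>J'. A' i j * x j)" using x(2) that by simp
      also have "\<dots> = (\<Sum>j\<in>J'. A i j * x j) - A i j0 / A i0 j0 * s"
        by (simp add: A'_def s_def algebra_simps sum_subtractf sum_distrib_left)
      finally show ?thesis using y[of i] by (simp add: algebra_simps)
    qed
    moreover have "(\<Sum>j\<in>J. A i0 j * y j) = 0" using y[of i0] j0 by (simp add: s_def)
    moreover have "\<exists>j\<in>J. y j \<noteq> 0" using x(1) J' by (auto simp: y_def)
    ultimately show ?thesis by (intro exI[of _ y]) auto
  qed
qed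

text \<open>
  Adjoining the right hand side as one more column makes the system underdetermined, and
  injectivity forces the extra unknown of a nontrivial solution to be nonzero.
\<close>
lemma injective_system_solvable:
  fixes A :: "'i \<Rightarrow> 'i \<Rightarrow> complex"
  assumes I: "finite I"
    and inj: "\<And>x. (\<And>i. i \<in> I \<Longrightarrow> (\<Sum>j\<in>I. A i j * x j) = 0) \<Longrightarrow> \<forall>j\<in>I. x j = 0"
  shows "\<exists>x. \<forall>i\<in>I. (\<Sum>j\<in>I. A i j * x j) = b i"
proof -
  define J where "J = insert None (Some ` I)"
  define A' where "A' i j = (case j of None \<Rightarrow> - b i | Some j \<Rightarrow> A i j)" for i j
  have J: "finite J" "card I < card J" using I by (simp_all add: J_def card_image)
  obtain x where x: "\<exists>j\<in>J. x j \<noteq> 0" "\<forall>i\<in>I. (\<Sum>j\<in>J. A' i j * x j) = 0"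
    using underdetermined_system[OF I J] by blast
  have eq: "(\<Sum>j\<in>I. A i j * x (Some j)) = b i * x None" if "i \<in> I" for i
  proof -
    have "0 = (\<Sum>j\<in>J. A' i j * x j)" using x that by simp
    also have "\<dots> = - b i * x None + (\<Sum>j\<in>I. A i j * x (Some j))"
      using I by (simp add: J_def A'_def sum.reindex)
    finally show ?thesis by (simp add: algebra_simps)
  qed
  have "x None \<noteq> 0"
  proof
    assume 0: "x None = 0"
    then have "\<forall>j\<in>I. x (Some j) = 0" using eq by (intro inj) simp
    then show False using x(1) 0 by (auto simp: J_def)
  qed
  then have "\<forall>i\<in>I. (\<Sum>j\<in>I. A i j * (x (Some j) / x None)) = b i"
    using eq by (simp flip: sum_divide_distrib)
  then show ?thesis by (intro exI[of _ "\<lambda>j. x (Some j) / x None"]) simp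
qed

section \<open>Operators on seminormed spaces\<close>

text \<open>
  A space of functions modulo null sets is treated through representatives: the vectors form a
  subspace \<open>V\<close> with a seminorm, and the normed space meant is the quotient by the vectors of
  seminorm zero.
\<close>
locale seminormed_space = vector_space scale
  for scale :: "complex \<Rightarrow> 'v::ab_group_add \<Rightarrow> 'v" (infixr "\<odot>" 75) +
  fixes V :: "'v set" and nrm :: "'v \<Rightarrow> real"
  assumes subspace_V: "subspace V"
    and nrm_triangle: "\<And>x y. x \<in> V \<Longrightarrow> y \<in> V \<Longrightarrow> nrm (x + y) \<le> nrm x + nrm y"
    and nrm_scale: "\<And>c x. x \<in> V \<Longrightarrow> nrm (c \<odot> x) = norm c * nrm x"
begin

lemma V_intros [simp, intro]:
  "0 \<in> V" "x \<in> V \<Longrightarrow> y \<in> V \<Longrightarrow> x + y \<in> V" "x \<in> V \<Longrightarrow> y \<in> V \<Longrightarrow> x - y \<in> V"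
  "x \<in> V \<Longrightarrow> c \<odot> x \<in> V" "x \<in> V \<Longrightarrow> - x \<in> V"
  using subspace_V by (auto intro: subspace_0 subspace_add subspace_diff subspace_scale subspace_neg)

lemma sum_in_V: "(\<And>i. i \<in> I \<Longrightarrow> e i \<in> V) \<Longrightarrow> (\<Sum>i\<in>I. e i) \<in> V"
  using subspace_V by (rule subspace_sum)

lemma nrm_zero [simp]: "nrm 0 = 0"
  using nrm_scale[of 0 0] by simp

lemma nrm_minus: "x \<in> V \<Longrightarrow> nrm (- x) = nrm x"
  using nrm_scale[of x "- 1"] by simp

lemma nrm_nonneg [simp]: "x \<in> V \<Longrightarrow> 0 \<le> nrm x"
  using nrm_triangle[of x "- x"] nrm_minus[of x] by simp

lemma nrm_diff_commute: "x \<in> V \<Longrightarrow> y \<in> V \<Longrightarrow> nrm (x - y) = nrm (y - x)"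
  using nrm_minus[of "x - y"] by simp

lemma nrm_diff: "x \<in> V \<Longrightarrow> y \<in> V \<Longrightarrow> nrm (x - y) \<le> nrm x + nrm y"
  using nrm_triangle[of x "- y"] nrm_minus[of y] by simp

lemma nrm_diff_triangle: "x \<in> V \<Longrightarrow> y \<in> V \<Longrightarrow> w \<in> V \<Longrightarrow> nrm (x - w) \<le> nrm (x - y) + nrm (y - w)"
  using nrm_triangle[of "x - y" "y - w"] by simp

lemma nrm_le_diff: "x \<in> V \<Longrightarrow> y \<in> V \<Longrightarrow> nrm x \<le> nrm (x - y) + nrm y"
  using nrm_triangle[of "x - y" y] by simp

lemma nrm_sum: "(\<And>i. i \<in> I \<Longrightarrow> e i \<in> V) \<Longrightarrow> nrm (\<Sum>i\<in>I. e i) \<le> (\<Sum>i\<in>I. nrm (e i))"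
proof (induction I rule: infinite_finite_induct)
  case (insert a I)
  have "nrm (e a + (\<Sum>i\<in>I. e i)) \<le> nrm (e a) + nrm (\<Sum>i\<in>I. e i)"
    using insert by (intro nrm_triangle sum_in_V) auto
  then show ?case using insert by force
qed auto

text \<open>
  Equality of the classes of two vectors in the quotient.  Operators are linear only up to this
  relation.
\<close>
definition eqv :: "'v \<Rightarrow> 'v \<Rightarrow> bool" (infix "\<doteq>" 50) where
  "x \<doteq> y \<longleftrightarrow> x \<in> V \<and> y \<in> V \<and> nrm (x - y) = 0"

lemma eqvD [dest]: "x \<doteq> y \<Longrightarrow> x \<in> V" "x \<doteq> y \<Longrightarrow> y \<in> V"
  by (auto simp: eqv_def)

lemma eqv_refl [simp]: "x \<doteq> x \<longleftrightarrow> x \<in> V" by (simp add: eqv_def)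
lemma eqv_sym: "x \<doteq> y \<Longrightarrow> y \<doteq> x"
  by (auto simp: eqv_def nrm_diff_commute)
lemma eqv_trans [trans]: "x \<doteq> y \<Longrightarrow> y \<doteq> w \<Longrightarrow> x \<doteq> w"
  unfolding eqv_def using nrm_diff_triangle[of x y w] nrm_nonneg[of "x - w"] by fastforce
lemma eqv_add: "x \<doteq> y \<Longrightarrow> x' \<doteq> y' \<Longrightarrow> x + x' \<doteq> y + y'"
  unfolding eqv_def using nrm_triangle[of "x - y" "x' - y'"] nrm_nonneg[of "x + x' - (y + y')"]
  by (auto simp: add_diff_add simp del: nrm_nonneg intro: antisym)
lemma eqv_scale: "x \<doteq> y \<Longrightarrow> c \<odot> x \<doteq> c \<odot> y"
  unfolding eqv_def using nrm_scale[of "x - y" c] by (auto simp: scale_right_diff_distrib)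
lemma eqv_diff: "x \<doteq> y \<Longrightarrow> x' \<doteq> y' \<Longrightarrow> x - x' \<doteq> y - y'"
  using eqv_add[of x y "(-1) \<odot> x'" "(-1) \<odot> y'"] eqv_scale[of x' y' "-1"] by simp
lemma eqv_sum: "(\<And>i. i \<in> I \<Longrightarrow> x i \<doteq> y i) \<Longrightarrow> (\<Sum>i\<in>I. x i) \<doteq> (\<Sum>i\<in>I. y i)"
  by (induction I rule: infinite_finite_induct) (auto intro: eqv_add)
lemma eqv_nrm: "x \<doteq> y \<Longrightarrow> nrm x = nrm y"
  unfolding eqv_def using nrm_le_diff[of x y] nrm_le_diff[of y x] nrm_diff_commute[of x y] by auto
lemma eqv_zero: "x \<doteq> 0 \<longleftrightarrow> x \<in> V \<and> nrm x = 0" by (auto simp: eqv_def)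
lemma eqv_diff_zero: "x \<in> V \<Longrightarrow> y \<in> V \<Longrightarrow> x - y \<doteq> 0 \<longleftrightarrow> x \<doteq> y" by (auto simp: eqv_def)

abbreviation (input) shift :: "complex \<Rightarrow> ('v \<Rightarrow> 'v) \<Rightarrow> 'v \<Rightarrow> 'v" where
  "shift z T h \<equiv> z \<odot> h - T h"

definition bounded_op :: "('v \<Rightarrow> 'v) \<Rightarrow> bool" where
  "bounded_op T \<longleftrightarrow> (\<forall>h\<in>V. T h \<in> V) \<and> (\<forall>h\<in>V. \<forall>k\<in>V. \<forall>a b. T (a \<odot> h + b \<odot> k) \<doteq> a \<odot> T h + b \<odot> T k) \<and>
     (\<exists>C. \<forall>h\<in>V. nrm (T h) \<le> C * nrm h)"

lemma op_in [simp]: "bounded_op T \<Longrightarrow> h \<in> V \<Longrightarrow> T h \<in> V" by (simp add: bounded_op_def)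
lemma op_lin: "bounded_op T \<Longrightarrow> h \<in> V \<Longrightarrow> k \<in> V \<Longrightarrow> T (a \<odot> h + b \<odot> k) \<doteq> a \<odot> T h + b \<odot> T k" by (simp add: bounded_op_def)
lemma op_add: "bounded_op T \<Longrightarrow> h \<in> V \<Longrightarrow> k \<in> V \<Longrightarrow> T (h + k) \<doteq> T h + T k"
  using op_lin[of T h k 1 1] by simp
lemma op_scale: "bounded_op T \<Longrightarrow> h \<in> V \<Longrightarrow> T (c \<odot> h) \<doteq> c \<odot> T h"
  using op_lin[of T h 0 c 0] by simp
lemma op_diff: "bounded_op T \<Longrightarrow> h \<in> V \<Longrightarrow> k \<in> V \<Longrightarrow> T (h - k) \<doteq> T h - T k"
  using op_lin[of T h k 1 "-1"] by simp
lemma op_lin_diff: "bounded_op T \<Longrightarrow> h \<in> V \<Longrightarrow> k \<in> V \<Longrightarrow> T (a \<odot> h - b \<odot> k) \<doteq> a \<odot> T h - b \<odot> T k"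
  using op_lin[of T h k a "- b"] by (simp only: scale_minus_left add_uminus_conv_diff)
lemma op_bound:
  assumes "bounded_op T" obtains C where "C > 0" "\<And>h. h \<in> V \<Longrightarrow> nrm (T h) \<le> C * nrm h"
proof -
  obtain C where C: "\<forall>h\<in>V. nrm (T h) \<le> C * nrm h" using assms by (auto simp: bounded_op_def)
  have "nrm (T h) \<le> (\<bar>C\<bar> + 1) * nrm h" if "h \<in> V" for h
    by (rule order_trans[OF C[rule_format, OF that]], rule mult_right_mono) (use that in auto)
  then show thesis using that[of "\<bar>C\<bar> + 1"] by auto
qed
lemma op_null: assumes "bounded_op T" "x \<doteq> 0" shows "T x \<doteq> 0"
proof -
  obtain C where C: "C > 0" "\<And>h. h \<in> V \<Longrightarrow> nrm (T h) \<le> C * nrm h" using op_bound[OF assms(1)] by blast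
  from C(2)[of x] assms have "nrm (T x) \<le> 0" by (auto simp: eqv_zero)
  then show ?thesis using assms nrm_nonneg[of "T x"] by (auto simp: eqv_zero intro: antisym)
qed
lemma op_sum: "bounded_op T \<Longrightarrow> (\<And>i. i \<in> I \<Longrightarrow> x i \<in> V) \<Longrightarrow> T (\<Sum>i\<in>I. x i) \<doteq> (\<Sum>i\<in>I. T (x i))"
proof (induction I rule: infinite_finite_induct)
  case (insert a I)
  have "T (x a + (\<Sum>i\<in>I. x i)) \<doteq> T (x a) + T (\<Sum>i\<in>I. x i)" using insert by (intro op_add sum_in_V) auto
  also have "\<dots> \<doteq> T (x a) + (\<Sum>i\<in>I. T (x i))" using insert by (intro eqv_add) auto
  finally show ?case using insert by simp
qed (auto simp: op_null[of T])

lemma opI: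
  assumes "\<And>h. h \<in> V \<Longrightarrow> T h \<in> V"
    "\<And>h k a b. h \<in> V \<Longrightarrow> k \<in> V \<Longrightarrow> T (a \<odot> h + b \<odot> k) \<doteq> a \<odot> T h + b \<odot> T k"
    "\<And>h. h \<in> V \<Longrightarrow> nrm (T h) \<le> C * nrm h"
  shows "bounded_op T"
  using assms unfolding bounded_op_def by blast

lemma op_linear_combination:
  assumes "bounded_op S" "bounded_op T" shows "bounded_op (\<lambda>h. a \<odot> S h + b \<odot> T h)"
proof -
  obtain C where C: "C > 0" "\<And>h. h \<in> V \<Longrightarrow> nrm (S h) \<le> C * nrm h" using op_bound assms by blast
  obtain D where D: "D > 0" "\<And>h. h \<in> V \<Longrightarrow> nrm (T h) \<le> D * nrm h" using op_bound assms by blast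
  show ?thesis
  proof (rule opI)
    fix h k s t assume hk: "h \<in> V" "k \<in> V"
    have "a \<odot> S (s \<odot> h + t \<odot> k) + b \<odot> T (s \<odot> h + t \<odot> k)
        \<doteq> a \<odot> (s \<odot> S h + t \<odot> S k) + b \<odot> (s \<odot> T h + t \<odot> T k)"
      using assms hk by (intro eqv_add eqv_scale op_lin)
    also have "\<dots> = s \<odot> (a \<odot> S h + b \<odot> T h) + t \<odot> (a \<odot> S k + b \<odot> T k)"
      by (simp add: algebra_simps)
    finally show "a \<odot> S (s \<odot> h + t \<odot> k) + b \<odot> T (s \<odot> h + t \<odot> k)
        \<doteq> s \<odot> (a \<odot> S h + b \<odot> T h) + t \<odot> (a \<odot> S k + b \<odot> T k)" .
  next
    fix h assume h: "h \<in> V"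
    have "nrm (a \<odot> S h + b \<odot> T h) \<le> norm a * nrm (S h) + norm b * nrm (T h)"
      using nrm_triangle[of "a \<odot> S h" "b \<odot> T h"] nrm_scale assms h by simp
    also have "\<dots> \<le> norm a * (C * nrm h) + norm b * (D * nrm h)"
      using C D h by (intro add_mono mult_left_mono) auto
    finally show "nrm (a \<odot> S h + b \<odot> T h) \<le> (norm a * C + norm b * D) * nrm h"
      by (simp add: algebra_simps)
  qed (use assms in auto)
qed

lemma op_ident: "bounded_op (\<lambda>h. h)" by (rule opI[where C = 1]) auto

lemma op_shift: assumes "bounded_op T" shows "bounded_op (shift z T)"
proof -
  have "shift z T = (\<lambda>h. z \<odot> h + (- 1) \<odot> T h)" by (auto simp: fun_eq_iff)
  then show ?thesis using op_linear_combination[OF op_ident assms] by (simp only:)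
qed

definition functional :: "('v \<Rightarrow> complex) \<Rightarrow> bool" where
  "functional l \<longleftrightarrow> (\<forall>h\<in>V. \<forall>k\<in>V. \<forall>a b. l (a \<odot> h + b \<odot> k) = a * l h + b * l k) \<and>
     (\<exists>C. \<forall>h\<in>V. norm (l h) \<le> C * nrm h)"

lemma functional_lin: "functional l \<Longrightarrow> h \<in> V \<Longrightarrow> k \<in> V \<Longrightarrow> l (a \<odot> h + b \<odot> k) = a * l h + b * l k"
  by (simp add: functional_def)
lemma functional_add: "functional l \<Longrightarrow> h \<in> V \<Longrightarrow> k \<in> V \<Longrightarrow> l (h + k) = l h + l k"
  using functional_lin[of l h k 1 1] by simp
lemma functional_scale: "functional l \<Longrightarrow> h \<in> V \<Longrightarrow> l (c \<odot> h) = c * l h"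
  using functional_lin[of l h 0 c 0] functional_lin[of l 0 0 0 0] by simp
lemma functional_diff: "functional l \<Longrightarrow> h \<in> V \<Longrightarrow> k \<in> V \<Longrightarrow> l (h - k) = l h - l k"
  using functional_lin[of l h k 1 "-1"] by simp
lemma functional_zero: "functional l \<Longrightarrow> l 0 = 0"
  using functional_lin[of l 0 0 0 0] by simp
lemma functional_sum: "functional l \<Longrightarrow> (\<And>i. i \<in> I \<Longrightarrow> x i \<in> V) \<Longrightarrow> l (\<Sum>i\<in>I. x i) = (\<Sum>i\<in>I. l (x i))"
  by (induction I rule: infinite_finite_induct) (auto simp: functional_zero functional_add sum_in_V)
lemma functional_bound:
  assumes "functional l" obtains C where "C > 0" "\<And>h. h \<in> V \<Longrightarrow> norm (l h) \<le> C * nrm h"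
proof -
  obtain C where C: "\<forall>h\<in>V. norm (l h) \<le> C * nrm h" using assms by (auto simp: functional_def)
  have "norm (l h) \<le> (\<bar>C\<bar> + 1) * nrm h" if "h \<in> V" for h
    by (rule order_trans[OF C[rule_format, OF that]], rule mult_right_mono) (use that in auto)
  then show thesis using that[of "\<bar>C\<bar> + 1"] by auto
qed
lemma functional_cong: assumes "functional l" "x \<doteq> y" shows "l x = l y"
proof -
  obtain C where C: "C > 0" "\<And>h. h \<in> V \<Longrightarrow> norm (l h) \<le> C * nrm h" using functional_bound[OF assms(1)] by blast
  from C(2)[of "x - y"] assms have "norm (l (x - y)) \<le> 0" by (auto simp: eqv_def)
  then show ?thesis using functional_diff[OF assms(1), of x y] assms by auto
qed

lemma op_rank_one: assumes "functional l" "e \<in> V" shows "bounded_op (\<lambda>h. l h \<odot> e)"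
proof -
  obtain C where C: "C > 0" "\<And>h. h \<in> V \<Longrightarrow> norm (l h) \<le> C * nrm h" using functional_bound[OF assms(1)] by blast
  show ?thesis
  proof (rule opI)
    fix h assume h: "h \<in> V"
    have "nrm (l h \<odot> e) \<le> (C * nrm h) * nrm e"
      using C h assms by (auto simp: nrm_scale intro!: mult_right_mono)
    then show "nrm (l h \<odot> e) \<le> (C * nrm e) * nrm h" by (simp add: algebra_simps)
  next
    fix h k a b assume hk: "h \<in> V" "k \<in> V"
    have "l (a \<odot> h + b \<odot> k) \<odot> e = a \<odot> (l h \<odot> e) + b \<odot> (l k \<odot> e)"
      using functional_lin[OF assms(1) hk] by (simp add: algebra_simps)
    then show "l (a \<odot> h + b \<odot> k) \<odot> e \<doteq> a \<odot> (l h \<odot> e) + b \<odot> (l k \<odot> e)"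
      using assms by simp
  qed (use assms in auto)
qed

lemma op_finite_rank:
  assumes "\<And>i. i < (m::nat) \<Longrightarrow> functional (l i) \<and> e i \<in> V"
  shows "bounded_op (\<lambda>h. \<Sum>i<m. l i h \<odot> e i)"
  using assms
proof (induction m)
  case 0
  have "bounded_op (\<lambda>h. 0)" by (rule opI[where C = 0]) auto
  then show ?case by (simp only: lessThan_0 sum.empty)
next
  case (Suc m)
  have "bounded_op (\<lambda>h. 1 \<odot> (\<Sum>i<m. l i h \<odot> e i) + 1 \<odot> (l m h \<odot> e m))"
    by (rule op_linear_combination[OF Suc.IH op_rank_one]) (use Suc.prems in auto)
  then show ?case by (simp only: scale_one sum.lessThan_Suc)
qed

text \<open>
  The distance of \<open>T\<close> from the operators of finite rank is at most \<open>c\<close>, and some operator of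
  finite rank realizes this bound.
\<close>
definition ess_bounded :: "real \<Rightarrow> ('v \<Rightarrow> 'v) \<Rightarrow> bool" where
  "ess_bounded c T \<longleftrightarrow> (\<exists>(m::nat) l e. (\<forall>i<m. functional (l i) \<and> e i \<in> V) \<and>
     (\<forall>h\<in>V. nrm (T h - (\<Sum>i<m. l i h \<odot> e i)) \<le> c * nrm h))"

lemma ess_boundedE:
  assumes "bounded_op T" "ess_bounded c T"
  obtains m l e Q where "\<And>i. i < (m::nat) \<Longrightarrow> functional (l i)" "\<And>i. i < m \<Longrightarrow> e i \<in> V"
    "bounded_op Q" "\<And>h. h \<in> V \<Longrightarrow> nrm (Q h) \<le> c * nrm h" "\<And>h. T h = Q h + (\<Sum>i<m. l i h \<odot> e i)"
proof -
  obtain m l e where *: "\<forall>i<(m::nat). functional (l i) \<and> e i \<in> V"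
     "\<forall>h\<in>V. nrm (T h - (\<Sum>i<m. l i h \<odot> e i)) \<le> c * nrm h" using assms(2) unfolding ess_bounded_def by blast
  define Q where "Q = (\<lambda>h. 1 \<odot> T h + (- 1) \<odot> (\<Sum>i<m. l i h \<odot> e i))"
  have "bounded_op Q" unfolding Q_def using *(1) by (intro op_linear_combination[where S=T and T="\<lambda>h. \<Sum>i<m. l i h \<odot> e i"] assms(1) op_finite_rank) simp_all
  moreover have "nrm (Q h) \<le> c * nrm h" if "h \<in> V" for h
    using bspec[OF *(2) that] by (simp add: Q_def)
  moreover have "T h = Q h + (\<Sum>i<m. l i h \<odot> e i)" for h by (simp add: Q_def)
  ultimately show thesis using that *(1) by blast
qed

definition invertible :: "('v \<Rightarrow> 'v) \<Rightarrow> bool" where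
  "invertible S \<longleftrightarrow> bounded_op S \<and> (\<exists>R. bounded_op R \<and> (\<forall>h\<in>V. R (S h) \<doteq> h) \<and> (\<forall>h\<in>V. S (R h) \<doteq> h))"

text \<open>
  The solution operator may choose any representative; injectivity makes the choice linear in the
  quotient.
\<close>
lemma invertibleI:
  assumes S: "bounded_op S"
    and inj: "\<And>h. h \<in> V \<Longrightarrow> S h \<doteq> 0 \<Longrightarrow> h \<doteq> 0"
    and sur: "\<And>g. g \<in> V \<Longrightarrow> \<exists>h\<in>V. S h \<doteq> g \<and> nrm h \<le> C * nrm g"
  shows "invertible S"
proof -
  obtain R where R: "\<And>g. g \<in> V \<Longrightarrow> R g \<in> V" "\<And>g. g \<in> V \<Longrightarrow> S (R g) \<doteq> g"
    "\<And>g. g \<in> V \<Longrightarrow> nrm (R g) \<le> C * nrm g" using sur by metis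
  have inj': "x \<doteq> y" if "x \<in> V" "y \<in> V" "S x \<doteq> S y" for x y
  proof -
    have "S (x - y) \<doteq> S x - S y" using op_diff S that by blast
    also have "\<dots> \<doteq> 0" using that S by (simp add: eqv_diff_zero)
    finally have "x - y \<doteq> 0" using that inj by simp
    then show ?thesis using that by (simp add: eqv_diff_zero)
  qed
  have "bounded_op R"
  proof (rule opI[OF R(1) _ R(3)])
    fix h k a b assume hk: "h \<in> V" "k \<in> V"
    have "S (R (a \<odot> h + b \<odot> k)) \<doteq> a \<odot> h + b \<odot> k" using hk R by auto
    also have "\<dots> \<doteq> a \<odot> S (R h) + b \<odot> S (R k)" by (intro eqv_add eqv_scale; rule eqv_sym[OF R(2)]) (use hk in auto)
    also have "\<dots> \<doteq> S (a \<odot> R h + b \<odot> R k)" by (rule eqv_sym[OF op_lin[OF S]]) (use R(1) hk in auto)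
    finally show "R (a \<odot> h + b \<odot> k) \<doteq> a \<odot> R h + b \<odot> R k" by (rule inj'[rotated 2]) (use R(1) hk in auto)
  qed
  moreover have "R (S h) \<doteq> h" if "h \<in> V" for h
    using inj'[of "R (S h)" h] R S that by simp
  ultimately show ?thesis
    using S R(2) unfolding invertible_def by blast
qed

lemma resolvent_lower_bound:
  assumes "bounded_op Q" "\<And>h. h \<in> V \<Longrightarrow> nrm (Q h) \<le> c * nrm h" "h \<in> V"
  shows "(norm z - c) * nrm h \<le> nrm (shift z Q h)"
proof -
  have "norm z * nrm h \<le> nrm (z \<odot> h - Q h) + nrm (Q h)"
    using nrm_le_diff[of "z \<odot> h" "Q h"] assms nrm_scale[of h z] by simp
  then show ?thesis using assms(2)[OF assms(3)] by (simp add: left_diff_distrib)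
qed

end

context seminormed_space begin

lemma op_lipschitz:
  assumes "bounded_op T" obtains C where "C > 0"
    "\<And>x y. x \<in> V \<Longrightarrow> y \<in> V \<Longrightarrow> nrm (T x - T y) \<le> C * nrm (x - y)"
proof -
  obtain C where C: "C > 0" "\<And>h. h \<in> V \<Longrightarrow> nrm (T h) \<le> C * nrm h" using op_bound[OF assms] by blast
  have "nrm (T x - T y) \<le> C * nrm (x - y)" if "x \<in> V" "y \<in> V" for x y
    using C(2)[of "x - y"] eqv_nrm[OF op_diff[OF assms that]] that by simp
  then show thesis using that C by blast
qed

lemma funpow_in: "bounded_op T \<Longrightarrow> h \<in> V \<Longrightarrow> (T ^^ n) h \<in> V"
  by (induction n) auto

lemma eqv_limitI:
  assumes "x \<in> V" "y \<in> V" "(\<lambda>n. a n) \<longlonglongrightarrow> 0" "\<And>n. nrm (x - y) \<le> a n"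
  shows "x \<doteq> y"
proof -
  have "nrm (x - y) \<le> 0" using assms by (intro LIMSEQ_le_const[of a]) auto
  then show ?thesis using assms nrm_nonneg[of "x - y"] by (simp add: eqv_def del: nrm_nonneg)
qed

section \<open>Closed subspaces\<close>

text \<open>
  Constant sequences show that a closed subspace contains with a vector its whole class.
\<close>
definition closed_sub :: "'v set \<Rightarrow> bool" where
  "closed_sub W \<longleftrightarrow> subspace W \<and> W \<subseteq> V \<and>
     (\<forall>u g. (\<forall>n::nat. u n \<in> W) \<and> g \<in> V \<and> (\<lambda>n. nrm (u n - g)) \<longlonglongrightarrow> 0 \<longrightarrow> g \<in> W)"

lemma closed_subD: "closed_sub W \<Longrightarrow> subspace W" "closed_sub W \<Longrightarrow> W \<subseteq> V"
  by (auto simp: closed_sub_def)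

lemma closed_sub_limit:
  "closed_sub W \<Longrightarrow> (\<And>n. u n \<in> W) \<Longrightarrow> g \<in> V \<Longrightarrow> (\<lambda>n::nat. nrm (u n - g)) \<longlonglongrightarrow> 0 \<Longrightarrow> g \<in> W"
  unfolding closed_sub_def by blast

lemma closed_sub_eqv: "closed_sub W \<Longrightarrow> x \<in> W \<Longrightarrow> x \<doteq> y \<Longrightarrow> y \<in> W"
  by (rule closed_sub_limit[of W "\<lambda>_. x"]) (auto simp: eqv_def)

text \<open>
  Otherwise vectors of \<open>W\<close> would converge to \<open>e\<close>.
\<close>
lemma closed_sub_distance:
  assumes W: "closed_sub W" and e: "e \<in> V" "e \<notin> W"
  obtains d where "d > 0" "\<And>w. w \<in> W \<Longrightarrow> d \<le> nrm (w - e)"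
proof (rule ccontr)
  assume neg: "\<not> thesis"
  have "\<exists>w\<in>W. nrm (w - e) < inverse (real (Suc n))" for n
  proof (rule ccontr)
    assume "\<not> ?thesis"
    then have "\<And>w. w \<in> W \<Longrightarrow> inverse (real (Suc n)) \<le> nrm (w - e)" by (auto simp: not_less)
    with that[of "inverse (real (Suc n))"] neg show False by simp
  qed
  then obtain u where u: "\<And>n. u n \<in> W" "\<And>n. nrm (u n - e) < inverse (real (Suc n))" by metis
  have "(\<lambda>n. nrm (u n - e)) \<longlonglongrightarrow> 0"
  proof (rule tendsto_sandwich[OF _ _ tendsto_const LIMSEQ_inverse_real_of_nat])
    show "\<forall>\<^sub>F n in sequentially. 0 \<le> nrm (u n - e)" 
      using u(1) closed_subD(2)[OF W] e by (intro always_eventually allI nrm_nonneg V_intros) auto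
    show "\<forall>\<^sub>F n in sequentially. nrm (u n - e) \<le> inverse (real (Suc n))"
      using u(2) by (intro always_eventually allI less_imp_le)
  qed
  then show False using closed_sub_limit[of W u e, OF W u(1) e(1)] e(2) by blast
qed

text \<open>
  The sum of \<open>W\<close> and the span of \<open>B\<close>.
\<close>
definition adjoin :: "'v set \<Rightarrow> 'v set \<Rightarrow> 'v set" where
  "adjoin W B = {h. \<exists>s\<in>span B. h - s \<in> W}"

lemma adjoin_base: "subspace W \<Longrightarrow> w \<in> W \<Longrightarrow> w \<in> adjoin W B"
  unfolding adjoin_def using span_zero by force

lemma adjoin_gen: "subspace W \<Longrightarrow> b \<in> B \<Longrightarrow> b \<in> adjoin W B"
  unfolding adjoin_def using span_base[of b B] subspace_0[of W] by force

lemma adjoin_mono: "B \<subseteq> B' \<Longrightarrow> adjoin W B \<subseteq> adjoin W B'"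
  unfolding adjoin_def using span_mono by blast

lemma adjoin_empty: "adjoin W {} = W" by (simp add: adjoin_def)

lemma adjoin_insert: "adjoin W (insert b B) = {h. \<exists>k. h - k \<odot> b \<in> adjoin W B}"
proof (intro set_eqI iffI)
  fix h assume "h \<in> adjoin W (insert b B)"
  then obtain s k where "h - s \<in> W" "s - k \<odot> b \<in> span B" by (auto simp: adjoin_def span_insert)
  then show "h \<in> {h. \<exists>k. h - k \<odot> b \<in> adjoin W B}"
    by (auto simp: adjoin_def intro!: exI[of _ k] bexI[of _ "s - k \<odot> b"])
next
  fix h assume "h \<in> {h. \<exists>k. h - k \<odot> b \<in> adjoin W B}"
  then obtain k s where "h - k \<odot> b - s \<in> W" "s \<in> span B" by (auto simp: adjoin_def)
  then have "s + k \<odot> b \<in> span (insert b B)" "h - (s + k \<odot> b) \<in> W"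
    by (auto simp: span_insert algebra_simps intro!: exI[of _ k])
  then show "h \<in> adjoin W (insert b B)" unfolding adjoin_def by blast
qed

text \<open>
  If \<open>e\<close> has distance \<open>d > 0\<close> from \<open>W\<close>, the coefficient of \<open>e\<close> is a continuous function of the
  vector, so that along a convergent sequence the coefficients converge and the remaining parts
  converge as well.
\<close>
lemma closed_sub_line:
  assumes W: "closed_sub W" and e: "e \<in> V"
  shows "closed_sub {h. \<exists>k. h - k \<odot> e \<in> W}" (is "closed_sub ?X")
proof (cases "e \<in> W")
  case True
  have "?X = W"
  proof (intro set_eqI iffI)
    fix h assume "h \<in> ?X"
    then obtain k where "h - k \<odot> e \<in> W" by blast
    from subspace_add[OF closed_subD(1)[OF W] this subspace_scale[OF closed_subD(1)[OF W] True, of k]]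
    show "h \<in> W" by simp
  next
    fix h assume "h \<in> W"
    then show "h \<in> ?X" by (auto intro!: exI[of _ 0])
  qed
  then show ?thesis using W by simp
next
  case False
  note sub = closed_subD(1)[OF W]
  obtain d where d: "d > 0" "\<And>w. w \<in> W \<Longrightarrow> d \<le> nrm (w - e)"
    using closed_sub_distance[OF W e False] by blast
  have lower: "d * norm k \<le> nrm (w + k \<odot> e)" if "w \<in> W" for w k
  proof (cases "k = 0")
    case True then show ?thesis using that closed_subD(2)[OF W] by auto
  next
    case False
    have w: "w \<in> V" "inverse k \<odot> w \<in> V" using that closed_subD(2)[OF W] by auto
    have "d \<le> nrm (- (inverse k \<odot> w) - e)"
      by (intro d(2) subspace_neg[OF sub] subspace_scale[OF sub] that)
    also have "\<dots> = nrm (inverse k \<odot> w + e)"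
      using nrm_minus[of "inverse k \<odot> w + e"] w e by simp
    finally have "d * norm k \<le> norm k * nrm (inverse k \<odot> w + e)"
      by (subst mult.commute) (rule mult_left_mono, auto)
    also have "\<dots> = nrm (k \<odot> (inverse k \<odot> w + e))" using w e by (intro nrm_scale[symmetric]) auto
    also have "k \<odot> (inverse k \<odot> w + e) = w + k \<odot> e" using False by (simp add: scale_right_distrib)
    finally show ?thesis .
  qed
  have XV: "?X \<subseteq> V"
  proof
    fix h assume "h \<in> ?X"
    then obtain k where "h - k \<odot> e \<in> V" using closed_subD(2)[OF W] by blast
    from V_intros(2)[OF this V_intros(4)[OF e, of k]] show "h \<in> V" by simp
  qed
  moreover have "subspace ?X"
  proof (rule subspaceI)
    show "0 \<in> ?X" using subspace_0[OF sub] by (auto intro!: exI[of _ 0])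
  next
    fix x y assume "x \<in> ?X" "y \<in> ?X"
    then obtain k l where "x - k \<odot> e \<in> W" "y - l \<odot> e \<in> W" by blast
    from subspace_add[OF sub this] show "x + y \<in> ?X"
      by (auto intro!: exI[of _ "k + l"] simp: algebra_simps)
  next
    fix c x assume "x \<in> ?X"
    then obtain k where "x - k \<odot> e \<in> W" by blast
    from subspace_scale[OF sub this, of c] show "c \<odot> x \<in> ?X"
      by (auto intro!: exI[of _ "c * k"] simp: algebra_simps)
  qed
  moreover have "g \<in> ?X" if u: "\<And>n::nat. u n \<in> ?X" and g: "g \<in> V" and lim: "(\<lambda>n. nrm (u n - g)) \<longlonglongrightarrow> 0" for u g
  proof -
    have uV: "u n \<in> V" for n using u XV by blast
    have "\<forall>n. \<exists>k. u n - k \<odot> e \<in> W" using u by blast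
    then obtain t where t: "\<And>n. u n - t n \<odot> e \<in> W" by metis
    have tdist: "d * norm (t n - t m) \<le> nrm (u n - g) + nrm (u m - g)" for n m
    proof -
      have "(u n - t n \<odot> e) - (u m - t m \<odot> e) + (t n - t m) \<odot> e = u n - u m" by (simp add: algebra_simps)
      with lower[OF subspace_diff[OF sub t[of n] t[of m]], of "t n - t m"]
      have "d * norm (t n - t m) \<le> nrm (u n - u m)" by (simp only:)
      also have "\<dots> \<le> nrm (u n - g) + nrm (u m - g)"
        using nrm_diff_triangle[OF uV[of n] g uV[of m]] nrm_diff_commute[OF uV[of m] g] by simp
      finally show ?thesis .
    qed
    have "Cauchy t"
    proof (rule metric_CauchyI)
      fix r :: real assume r: "0 < r"
      then have "0 < d * r / 2" using d by simp
      then obtain M where M: "\<And>n. n \<ge> M \<Longrightarrow> \<bar>nrm (u n - g)\<bar> < d * r / 2"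
        using LIMSEQ_D[OF lim] by fastforce
      have "dist (t m) (t n) < r" if "m \<ge> M" "n \<ge> M" for m n
      proof -
        have "d * dist (t m) (t n) < d * r"
          using tdist[of m n] M[OF that(1)] M[OF that(2)] by (simp add: dist_norm)
        then show ?thesis using d by simp
      qed
      then show "\<exists>M. \<forall>m\<ge>M. \<forall>n\<ge>M. dist (t m) (t n) < r" by blast
    qed
    then obtain k where k: "t \<longlonglongrightarrow> k" using Cauchy_convergent convergent_def by blast
    have "g - k \<odot> e \<in> W"
    proof (rule closed_sub_limit[of W "\<lambda>n. u n - t n \<odot> e", OF W t])
      show "g - k \<odot> e \<in> V" using g e by auto
      show "(\<lambda>n. nrm (u n - t n \<odot> e - (g - k \<odot> e))) \<longlonglongrightarrow> 0"
      proof (rule tendsto_sandwich[OF always_eventually always_eventually tendsto_const])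
        show "\<forall>n. 0 \<le> nrm (u n - t n \<odot> e - (g - k \<odot> e))" using uV g e by auto
        show "\<forall>n. nrm (u n - t n \<odot> e - (g - k \<odot> e)) \<le> nrm (u n - g) + norm (t n - k) * nrm e"
        proof
          fix n
          have "u n - t n \<odot> e - (g - k \<odot> e) = (u n - g) - (t n - k) \<odot> e" by (simp add: algebra_simps)
          moreover have "nrm ((u n - g) - (t n - k) \<odot> e) \<le> nrm (u n - g) + norm (t n - k) * nrm e"
            using nrm_diff[of "u n - g" "(t n - k) \<odot> e"] nrm_scale[OF e, of "t n - k"] uV g e by simp
          ultimately show "nrm (u n - t n \<odot> e - (g - k \<odot> e)) \<le> nrm (u n - g) + norm (t n - k) * nrm e"
            by (simp only:)
        qed
        have "(\<lambda>n. nrm (u n - g) + norm (t n - k) * nrm e) \<longlonglongrightarrow> 0 + 0 * nrm e"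
          using k by (intro tendsto_intros lim) (simp add: LIM_zero tendsto_norm_zero)
        then show "(\<lambda>n. nrm (u n - g) + norm (t n - k) * nrm e) \<longlonglongrightarrow> 0" by simp
      qed
    qed
    then show ?thesis by blast
  qed
  ultimately show ?thesis unfolding closed_sub_def by blast
qed

lemma closed_sub_adjoin:
  assumes "closed_sub W" "finite B" "B \<subseteq> V"
  shows "closed_sub (adjoin W B)"
  using assms(2,3)
proof (induction B rule: finite_induct)
  case empty then show ?case using assms by (simp add: adjoin_empty)
next
  case (insert b B)
  then show ?case unfolding adjoin_insert by (intro closed_sub_line) auto
qed

lemma subspace_vimage:
  assumes T: "bounded_op T" and W: "closed_sub W"
  shows "subspace {h \<in> V. T h \<in> W}"
proof (rule subspaceI)
  note sub = closed_subD(1)[OF W]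
  show "0 \<in> {h \<in> V. T h \<in> W}"
    using closed_sub_eqv[OF W subspace_0[OF sub] eqv_sym[OF op_null[OF T, of 0]]] by simp
  show "x + y \<in> {h \<in> V. T h \<in> W}" if "x \<in> {h \<in> V. T h \<in> W}" "y \<in> {h \<in> V. T h \<in> W}" for x y
    using closed_sub_eqv[OF W subspace_add[OF sub, of "T x" "T y"] eqv_sym[OF op_add[OF T, of x y]]] that by simp
  show "c \<odot> x \<in> {h \<in> V. T h \<in> W}" if "x \<in> {h \<in> V. T h \<in> W}" for c x
    using closed_sub_eqv[OF W subspace_scale[OF sub, of "T x" c] eqv_sym[OF op_scale[OF T, of x c]]] that by simp
qed

lemma subspace_image:
  assumes T: "bounded_op T" and W: "subspace W" "W \<subseteq> V"
  shows "subspace {g. \<exists>h\<in>W. T h \<doteq> g}"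
proof (rule subspaceI)
  show "0 \<in> {g. \<exists>h\<in>W. T h \<doteq> g}" using subspace_0[OF W(1)] op_null[OF T, of 0] by auto
next
  fix x y assume "x \<in> {g. \<exists>h\<in>W. T h \<doteq> g}" "y \<in> {g. \<exists>h\<in>W. T h \<doteq> g}"
  then obtain h k where hk: "h \<in> W" "k \<in> W" "T h \<doteq> x" "T k \<doteq> y" by blast
  have "T (h + k) \<doteq> T h + T k" using hk W by (intro op_add[OF T]) auto
  also have "\<dots> \<doteq> x + y" using hk by (intro eqv_add)
  finally show "x + y \<in> {g. \<exists>h\<in>W. T h \<doteq> g}" using subspace_add[OF W(1) hk(1,2)] by blast
next
  fix c x assume "x \<in> {g. \<exists>h\<in>W. T h \<doteq> g}"
  then obtain h where h: "h \<in> W" "T h \<doteq> x" by blast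
  have "T (c \<odot> h) \<doteq> c \<odot> T h" using h W by (intro op_scale[OF T]) auto
  also have "\<dots> \<doteq> c \<odot> x" using h by (intro eqv_scale)
  finally show "c \<odot> x \<in> {g. \<exists>h\<in>W. T h \<doteq> g}" using subspace_scale[OF W(1) h(1)] by blast
qed

lemma adjoin_least:
  assumes "subspace X" "W \<subseteq> X" "B \<subseteq> X"
  shows "adjoin W B \<subseteq> X"
proof
  fix h assume "h \<in> adjoin W B"
  then obtain s where s: "s \<in> span B" "h - s \<in> W" by (auto simp: adjoin_def)
  then have "s \<in> X" using span_minimal[OF assms(3,1)] by blast
  then have "(h - s) + s \<in> X" using s assms by (intro subspace_add) auto
  then show "h \<in> X" by simp
qed

definition null :: "'v set" where "null = {h. h \<doteq> 0}"

lemma closed_sub_null: "closed_sub null"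
  unfolding closed_sub_def
proof (intro conjI allI impI)
  show "subspace null"
  proof (rule subspaceI)
    show "0 \<in> null" by (simp add: null_def)
    show "x + y \<in> null" if "x \<in> null" "y \<in> null" for x y
      using eqv_add[of x 0 y 0] that by (simp add: null_def)
    show "c \<odot> x \<in> null" if "x \<in> null" for c x
      using eqv_scale[of x 0 c] that by (simp add: null_def)
  qed
  show "null \<subseteq> V" by (auto simp: null_def)
next
  fix u g assume *: "(\<forall>n::nat. u n \<in> null) \<and> g \<in> V \<and> (\<lambda>n. nrm (u n - g)) \<longlonglongrightarrow> 0"
  have "nrm (g - 0) \<le> nrm (u n - g)" for n
    using nrm_le_diff[of g "u n"] * nrm_diff_commute[of g "u n"] by (auto simp: null_def eqv_zero)
  then have "g \<doteq> 0" using * by (intro eqv_limitI) auto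
  then show "g \<in> null" by (simp add: null_def)
qed

text \<open>
  A functional that does not vanish on the intersection of the earlier kernels costs one
  dimension, which is spanned by any vector of that intersection where it is nonzero.
\<close>
lemma kernels_complement:
  assumes "\<And>i. i < (m::nat) \<Longrightarrow> functional (l i)"
  shows "\<exists>B. finite B \<and> B \<subseteq> V \<and> V \<subseteq> adjoin {h \<in> V. \<forall>i<m. l i h = 0} B"
  using assms
proof (induction m)
  case 0
  show ?case by (rule exI[of _ "{}"]) (auto simp: adjoin_empty)
next
  case (Suc m)
  then obtain B where B: "finite B" "B \<subseteq> V" "V \<subseteq> adjoin {h \<in> V. \<forall>i<m. l i h = 0} B" by auto
  let ?W = "{h \<in> V. \<forall>i<Suc m. l i h = 0}"
  show ?case
  proof (cases "\<forall>h\<in>V. (\<forall>i<m. l i h = 0) \<longrightarrow> l m h = 0")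
    case True
    then have "?W = {h \<in> V. \<forall>i<m. l i h = 0}" by (auto simp: less_Suc_eq)
    then show ?thesis using B by auto
  next
    case False
    then obtain v where v: "v \<in> V" "\<forall>i<m. l i v = 0" "l m v \<noteq> 0" by blast
    have "V \<subseteq> adjoin ?W (insert v B)"
    proof
      fix h assume "h \<in> V"
      then obtain s where s: "s \<in> span B" "h - s \<in> V" "\<forall>i<m. l i (h - s) = 0" using B by (auto simp: adjoin_def)
      define k where "k = l m (h - s) / l m v"
      have "l i (h - s - k \<odot> v) = 0" if "i < Suc m" for i
        using functional_diff[of "l i" "h - s" "k \<odot> v"] functional_scale[of "l i" v k] Suc.prems[OF that] s v that
        by (auto simp: k_def less_Suc_eq)
      then have "h - s - k \<odot> v \<in> ?W" using s v by auto
      moreover have "s + k \<odot> v \<in> span (insert v B)" using s(1) by (auto simp: span_insert intro!: exI[of _ k])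
      ultimately show "h \<in> adjoin ?W (insert v B)"
        unfolding adjoin_def mem_Collect_eq by (intro bexI[of _ "s + k \<odot> v"]) (simp_all add: diff_diff_eq)
    qed
    then show ?thesis using B v by (intro exI[of _ "insert v B"]) auto
  qed
qed

end

section \<open>Perturbations of finite rank\<close>

text \<open>
  Completeness is stated as convergence of absolutely convergent series, the form needed for
  Neumann series.
\<close>
locale complete_seminormed_space = seminormed_space scale V nrm
  for scale :: "complex \<Rightarrow> 'v::ab_group_add \<Rightarrow> 'v" (infixr "\<odot>" 75)
    and V :: "'v set" and nrm :: "'v \<Rightarrow> real" +
  assumes complete: "(\<And>n::nat. u n \<in> V) \<Longrightarrow> summable (\<lambda>n. nrm (u n)) \<Longrightarrow>
    \<exists>h\<in>V. (\<lambda>n. nrm (h - (\<Sum>k<n. u k))) \<longlonglongrightarrow> 0"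
begin

text \<open>
  The sum of \<open>Q\<^sup>n g / z\<^sup>n\<^sup>+\<^sup>1\<close> over all \<open>n\<close> solves the equation: applied to the first \<open>n\<close> terms,
  \<open>z - Q\<close> gives \<open>g - Q\<^sup>n g / z\<^sup>n\<close>.
\<close>
lemma neumann:
  assumes Q: "bounded_op Q" "\<And>h. h \<in> V \<Longrightarrow> nrm (Q h) \<le> c * nrm h" and c: "0 \<le> c" "c < norm z" and g: "g \<in> V"
  shows "\<exists>h\<in>V. shift z Q h \<doteq> g"
proof -
  have z: "z \<noteq> 0" "norm z > 0" using c by auto
  define u where "u n = inverse z ^ Suc n \<odot> (Q ^^ n) g" for n
  have QV: "(Q ^^ n) g \<in> V" for n using Q g by (intro funpow_in)
  then have uV: "u n \<in> V" for n by (simp add: u_def)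
  have Qn: "nrm ((Q ^^ n) g) \<le> c ^ n * nrm g" for n
  proof (induction n)
    case (Suc n)
    have "nrm ((Q ^^ Suc n) g) \<le> c * nrm ((Q ^^ n) g)" using Q(2)[OF QV[of n]] by simp
    also have "\<dots> \<le> c * (c ^ n * nrm g)" using Suc c by (intro mult_left_mono)
    finally show ?case by (simp add: mult_ac)
  qed simp
  have nu: "nrm (u n) = inverse (norm z) ^ Suc n * nrm ((Q ^^ n) g)" for n
    using nrm_scale[OF QV[of n]] by (simp only: u_def norm_power norm_inverse)
  have su: "summable (\<lambda>n. nrm (u n))"
  proof (rule summable_comparison_test')
    show "summable (\<lambda>n. (c / norm z) ^ n * (nrm g / norm z))"
      using c z by (intro summable_mult2 summable_geometric) simp
    show "norm (nrm (u n)) \<le> (c / norm z) ^ n * (nrm g / norm z)" if "0 \<le> n" for n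
    proof -
      have "nrm (u n) \<le> inverse (norm z) ^ Suc n * (c ^ n * nrm g)"
        unfolding nu using Qn by (intro mult_left_mono) auto
      also have "\<dots> = (c / norm z) ^ n * (nrm g / norm z)" by (simp add: field_simps)
      finally show ?thesis using uV[of n] by simp
    qed
  qed
  obtain h where h: "h \<in> V" "(\<lambda>n. nrm (h - (\<Sum>k<n. u k))) \<longlonglongrightarrow> 0"
    using complete[of u, OF uV su] by blast
  define S where "S = shift z Q"
  have S: "bounded_op S" unfolding S_def by (rule op_shift[OF Q(1)])
  have sV: "(\<Sum>k<n. u k) \<in> V" for n using uV by (intro sum_in_V)
  have Ss: "S (\<Sum>k<n. u k) \<doteq> g - inverse z ^ n \<odot> (Q ^^ n) g" for n
  proof (induction n)
    case 0
    show ?case using op_null[OF S, of 0] by simp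
  next
    case (Suc n)
    have "Q (u n) \<doteq> inverse z ^ Suc n \<odot> Q ((Q ^^ n) g)" unfolding u_def by (rule op_scale[OF Q(1) QV])
    then have "S (u n) \<doteq> z \<odot> u n - inverse z ^ Suc n \<odot> Q ((Q ^^ n) g)"
      unfolding S_def by (rule eqv_diff[rotated]) (use uV in simp)
    also have "z \<odot> u n = inverse z ^ n \<odot> (Q ^^ n) g" using z by (simp add: u_def)
    finally have 1: "S (u n) \<doteq> inverse z ^ n \<odot> (Q ^^ n) g - inverse z ^ Suc n \<odot> (Q ^^ Suc n) g" by simp
    have "S (\<Sum>k<Suc n. u k) \<doteq> S (\<Sum>k<n. u k) + S (u n)"
      unfolding sum.lessThan_Suc by (rule op_add[OF S sV uV])
    also have "\<dots> \<doteq> (g - inverse z ^ n \<odot> (Q ^^ n) g) + (inverse z ^ n \<odot> (Q ^^ n) g - inverse z ^ Suc n \<odot> (Q ^^ Suc n) g)"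
      by (rule eqv_add[OF Suc 1])
    finally show ?case by simp
  qed
  obtain C where C: "C > 0" "\<And>x y. x \<in> V \<Longrightarrow> y \<in> V \<Longrightarrow> nrm (S x - S y) \<le> C * nrm (x - y)"
    using op_lipschitz[OF S] by blast
  have "S h \<doteq> g"
  proof (rule eqv_limitI)
    show "S h \<in> V" "g \<in> V" using S h g by auto
    show "(\<lambda>n. C * nrm (h - (\<Sum>k<n. u k)) + norm z * nrm (u n)) \<longlonglongrightarrow> 0"
      using tendsto_add[OF tendsto_mult[OF tendsto_const[of C] h(2)] tendsto_mult[OF tendsto_const[of "norm z"] summable_LIMSEQ_zero[OF su]]] by simp
    fix n
    let ?s = "\<Sum>k<n. u k"
    have "nrm (S ?s - g) = nrm ((g - inverse z ^ n \<odot> (Q ^^ n) g) - g)"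
      by (rule eqv_nrm[OF eqv_diff[OF Ss]]) (use g in simp)
    also have "\<dots> = nrm (inverse z ^ n \<odot> (Q ^^ n) g)" using nrm_minus QV by simp
    also have "inverse z ^ n \<odot> (Q ^^ n) g = z \<odot> u n" using z by (simp add: u_def)
    also have "nrm \<dots> = norm z * nrm (u n)" using uV by (rule nrm_scale)
    finally show "nrm (S h - g) \<le> C * nrm (h - ?s) + norm z * nrm (u n)"
      using nrm_diff_triangle[of "S h" "S ?s" g] C(2)[OF h(1) sV, of n] S h sV g by simp
  qed
  then show ?thesis using h by (auto simp: S_def)
qed

end

context complete_seminormed_space begin

text \<open>
  Here \<open>T = Q + F\<close> where \<open>F\<close> has finite rank and \<open>z - Q\<close> is invertible, so that the equation
  \<open>(z - T) h = g\<close> only involves the finitely many unknown numbers \<open>l i h\<close>.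
\<close>
context
  fixes T Q :: "'v \<Rightarrow> 'v" and m :: nat and l :: "nat \<Rightarrow> 'v \<Rightarrow> complex" and e :: "nat \<Rightarrow> 'v"
    and c :: real and z :: complex
  assumes l: "\<And>i. i < m \<Longrightarrow> functional (l i)" and e: "\<And>i. i < m \<Longrightarrow> e i \<in> V"
    and T: "bounded_op T" and Q: "bounded_op Q" and Qc: "\<And>h. h \<in> V \<Longrightarrow> nrm (Q h) \<le> c * nrm h"
    and TQ: "\<And>h. T h = Q h + (\<Sum>i<m. l i h \<odot> e i)"
    and c: "0 \<le> c" "c < norm z"
begin

lemma shift_perturbed: "shift z T h = shift z Q h - (\<Sum>i<m. l i h \<odot> e i)"
  by (simp add: TQ)

lemma resolvent_exists:
  obtains R where "\<And>g. g \<in> V \<Longrightarrow> R g \<in> V" "\<And>g. g \<in> V \<Longrightarrow> shift z Q (R g) \<doteq> g"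
    "\<And>g. g \<in> V \<Longrightarrow> nrm (R g) \<le> inverse (norm z - c) * nrm g"
proof -
  have "\<exists>h. h \<in> V \<and> shift z Q h \<doteq> g \<and> nrm h \<le> inverse (norm z - c) * nrm g" if g: "g \<in> V" for g
  proof -
    obtain h where h: "h \<in> V" "shift z Q h \<doteq> g" using neumann[OF Q Qc c g] by blast
    have "(norm z - c) * nrm h \<le> nrm g"
      using resolvent_lower_bound[OF Q Qc h(1), of z] eqv_nrm[OF h(2)] by simp
    then have "nrm h \<le> inverse (norm z - c) * nrm g" using c by (simp add: field_simps)
    then show ?thesis using h by blast
  qed
  then show thesis using that by metis
qed

text \<open>
  With \<open>R\<close> the inverse of \<open>z - Q\<close>, a solution of \<open>(z - T) h = g\<close> has the form
  \<open>R g + (\<Sum>j. x j R (e j))\<close>, and it is one as soon as \<open>x i = l i h\<close> for all \<open>i\<close>.  This is a square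
  linear system for \<open>x\<close>; a solution of the homogeneous system is a vector in the kernel of
  \<open>z - T\<close>.  The columns of the inverse matrix bound \<open>x\<close> by the norm of \<open>g\<close>.
\<close>
lemma finite_rank_invertible:
  assumes inj: "\<And>h. h \<in> V \<Longrightarrow> shift z T h \<doteq> 0 \<Longrightarrow> h \<doteq> 0"
  shows "invertible (shift z T)"
proof -
  obtain R where R: "\<And>g. g \<in> V \<Longrightarrow> R g \<in> V" "\<And>g. g \<in> V \<Longrightarrow> shift z Q (R g) \<doteq> g"
    "\<And>g. g \<in> V \<Longrightarrow> nrm (R g) \<le> inverse (norm z - c) * nrm g" using resolvent_exists by metis
  define K where "K = inverse (norm z - c)"
  define e' where "e' i = R (e i)" for i
  define comb where "comb x = (\<Sum>j<m. x j \<odot> e' j)" for x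
  have e': "e' i \<in> V" "shift z Q (e' i) \<doteq> e i" if "i < m" for i using R e that by (auto simp: e'_def)
  have comb: "comb x \<in> V" for x using e' by (auto simp: comb_def intro!: sum_in_V)
  have S: "bounded_op (shift z Q)" by (rule op_shift[OF Q])
  have S_comb: "shift z Q (comb x) \<doteq> (\<Sum>j<m. x j \<odot> e j)" for x
  proof -
    have "shift z Q (comb x) \<doteq> (\<Sum>j<m. shift z Q (x j \<odot> e' j))"
      unfolding comb_def by (rule op_sum[OF S]) (use e' in auto)
    also have "\<dots> \<doteq> (\<Sum>j<m. x j \<odot> e j)"
    proof (rule eqv_sum)
      fix j assume "j \<in> {..<m}"
      then have "shift z Q (x j \<odot> e' j) \<doteq> x j \<odot> shift z Q (e' j)" "x j \<odot> shift z Q (e' j) \<doteq> x j \<odot> e j"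
        using op_scale[OF S e'(1)] eqv_scale[OF e'(2)] by auto
      then show "shift z Q (x j \<odot> e' j) \<doteq> x j \<odot> e j" by (rule eqv_trans)
    qed
    finally show ?thesis .
  qed
  have l_comb: "l i (comb x) = (\<Sum>j<m. x j * l i (e' j))" if "i < m" for i x
    using functional_sum[OF l[OF that], of "{..<m}" "\<lambda>j. x j \<odot> e' j"] functional_scale[OF l[OF that]] e'
    by (simp add: comb_def)
  have solves: "shift z T (g' + comb x) \<doteq> g"
    if g': "g' \<in> V" "shift z Q g' \<doteq> g" and x: "\<And>i. i < m \<Longrightarrow> x i = l i g' + l i (comb x)" for g g' x
  proof -
    have "shift z T (g' + comb x) = shift z Q (g' + comb x) - (\<Sum>i<m. x i \<odot> e i)"
      using functional_add[OF l g'(1) comb] x by (simp add: shift_perturbed)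
    also have "\<dots> \<doteq> (g + (\<Sum>j<m. x j \<odot> e j)) - (\<Sum>i<m. x i \<odot> e i)"
    proof (rule eqv_diff)
      show "shift z Q (g' + comb x) \<doteq> g + (\<Sum>j<m. x j \<odot> e j)"
      using eqv_trans[OF op_add[OF S g'(1) comb] eqv_add[OF g'(2) S_comb]] .
      show "(\<Sum>i<m. x i \<odot> e i) \<doteq> (\<Sum>i<m. x i \<odot> e i)" unfolding eqv_refl by (rule sum_in_V) (use e in auto)
    qed
    also have "(g + (\<Sum>j<m. x j \<odot> e j)) - (\<Sum>i<m. x i \<odot> e i) = g" by simp
    finally show ?thesis .
  qed
  define A where "A i j = (if i = j then 1 else 0) - l i (e' j)" for i j
  have A: "(\<Sum>j<m. A i j * x j) = x i - l i (comb x)" if "i < m" for i x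
  proof -
    have "(\<Sum>j<m. A i j * x j) = (\<Sum>j<m. if i = j then x j else 0) - (\<Sum>j<m. x j * l i (e' j))"
      unfolding sum_subtractf[symmetric] by (rule sum.cong) (auto simp: A_def algebra_simps)
    then show ?thesis using that by (simp add: l_comb)
  qed
  have A_inj: "\<forall>j\<in>{..<m}. x j = 0" if x: "\<And>i. i \<in> {..<m} \<Longrightarrow> (\<Sum>j<m. A i j * x j) = 0" for x
  proof -
    have x': "x i = l i (comb x)" if "i < m" for i using x A that by simp
    have "shift z T (0 + comb x) \<doteq> 0"
    proof (rule solves)
      show "shift z Q 0 \<doteq> 0" using op_null[OF S, of 0] by simp
      show "x i = l i 0 + l i (comb x)" if "i < m" for i using x'[OF that] functional_zero[OF l[OF that]] by simp
    qed simp
    then have "comb x \<doteq> 0" using inj comb by simp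
    then have "l i (comb x) = 0" if "i < m" for i using functional_cong[OF l[OF that]] functional_zero[OF l[OF that]] by simp
    then show ?thesis using x' by auto
  qed
  have "\<exists>x. \<forall>i\<in>{..<m}. (\<Sum>j<m. A i j * x j) = (if i = k then 1 else 0)" for k
    by (rule injective_system_solvable) (use A_inj in auto)
  \<comment> \<open>the columns \<open>B k\<close> of the inverse matrix\<close>
  then obtain B where B: "\<And>k i. i < m \<Longrightarrow> (\<Sum>j<m. A i j * B k j) = (if i = k then 1 else 0)"
    by (metis lessThan_iff)
  have "\<exists>D. D > 0 \<and> (\<forall>h\<in>V. norm (l i h) \<le> D * nrm h)" if "i < m" for i
    using functional_bound[OF l[OF that]] by metis
  then obtain D where D: "\<And>i. i < m \<Longrightarrow> D i > 0" "\<And>i h. i < m \<Longrightarrow> h \<in> V \<Longrightarrow> norm (l i h) \<le> D i * nrm h" by metis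
  define C where "C = K + (\<Sum>j<m. (\<Sum>k<m. D k * K * norm (B k j)) * nrm (e' j))"
  show ?thesis
  proof (rule invertibleI[OF op_shift[OF T] inj])
    fix g assume g: "g \<in> V"
    define x where "x j = (\<Sum>k<m. l k (R g) * B k j)" for j
    have "(\<Sum>j<m. A i j * x j) = l i (R g)" if "i < m" for i
    proof -
      have "(\<Sum>j<m. A i j * x j) = (\<Sum>k<m. l k (R g) * (\<Sum>j<m. A i j * B k j))"
        unfolding x_def sum_distrib_left by (subst sum.swap) (simp add: mult_ac)
      also have "\<dots> = (\<Sum>k<m. if i = k then l k (R g) else 0)"
        by (rule sum.cong) (use that in \<open>auto simp: B\<close>)
      also have "\<dots> = l i (R g)" using that by simp
      finally show ?thesis .
    qed
    then have "x i = l i (R g) + l i (comb x)" if "i < m" for i using A[OF that, of x] that by simp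
    then have "shift z T (R g + comb x) \<doteq> g" using R(1,2)[OF g] by (intro solves) auto
    moreover have "nrm (R g + comb x) \<le> C * nrm g"
    proof -
      have xb: "norm (x j) \<le> (\<Sum>k<m. D k * K * norm (B k j)) * nrm g" for j
      proof -
        have "norm (x j) \<le> (\<Sum>k<m. norm (l k (R g)) * norm (B k j))"
          unfolding x_def by (rule order_trans[OF norm_sum]) (simp add: norm_mult)
        also have "\<dots> \<le> (\<Sum>k<m. (D k * (K * nrm g)) * norm (B k j))"
        proof (intro sum_mono mult_right_mono)
          fix k assume k: "k \<in> {..<m}"
          have "norm (l k (R g)) \<le> D k * nrm (R g)" using D(2) k R(1)[OF g] by simp
          also have "\<dots> \<le> D k * (K * nrm g)" using D(1)[of k] k R(3)[OF g] by (intro mult_left_mono) (auto simp: K_def)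
          finally show "norm (l k (R g)) \<le> D k * (K * nrm g)" .
        qed auto
        also have "\<dots> = (\<Sum>k<m. D k * K * norm (B k j)) * nrm g"
          unfolding sum_distrib_right by (rule sum.cong) (simp_all add: mult_ac)
        finally show ?thesis .
      qed
      have "nrm (comb x) \<le> (\<Sum>j<m. nrm (x j \<odot> e' j))" unfolding comb_def using e' by (intro nrm_sum) auto
      also have "\<dots> = (\<Sum>j<m. norm (x j) * nrm (e' j))" using e' nrm_scale by simp
      also have "\<dots> \<le> (\<Sum>j<m. ((\<Sum>k<m. D k * K * norm (B k j)) * nrm g) * nrm (e' j))"
        using xb e' by (intro sum_mono mult_right_mono) auto
      also have "\<dots> = (\<Sum>j<m. (\<Sum>k<m. D k * K * norm (B k j)) * nrm (e' j)) * nrm g"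
        by (subst (3) sum_distrib_right) (rule sum.cong, simp_all only: mult_ac)
      finally have "nrm (comb x) \<le> \<dots>" .
      then show ?thesis using nrm_triangle[OF R(1)[OF g] comb[of x]] R(3)[OF g] unfolding C_def K_def
        by (simp add: distrib_right)
    qed
    ultimately show "\<exists>h\<in>V. shift z T h \<doteq> g \<and> nrm h \<le> C * nrm g" using R(1)[OF g] comb by blast
  qed
qed

text \<open>
  On the common kernel of the functionals \<open>z - T\<close> agrees with \<open>z - Q\<close>, which is bounded below, so
  the image of this kernel is closed.  The kernel has finite codimension, hence the full range
  only adds finitely many directions.
\<close>
lemma finite_rank_closed_range: "closed_sub {g. \<exists>h\<in>V. shift z T h \<doteq> g}" (is "closed_sub ?R")
proof -
  let ?K = "{h \<in> V. \<forall>i<m. l i h = 0}"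
  let ?W = "{g. \<exists>h\<in>?K. shift z T h \<doteq> g}"
  have S: "bounded_op (shift z T)" by (rule op_shift[OF T])
  have SQ: "bounded_op (shift z Q)" by (rule op_shift[OF Q])
  have subK: "subspace ?K"
    by (rule subspaceI) (auto simp: functional_zero[OF l] functional_add[OF l] functional_scale[OF l])
  have onK: "shift z T h = shift z Q h" if "h \<in> ?K" for h using that by (simp add: shift_perturbed)
  have W: "closed_sub ?W"
    unfolding closed_sub_def
  proof (intro conjI allI impI)
    show "subspace ?W" by (rule subspace_image[OF S subK]) auto
    show "?W \<subseteq> V" by auto
    fix u g assume *: "(\<forall>n::nat. u n \<in> ?W) \<and> g \<in> V \<and> (\<lambda>n. nrm (u n - g)) \<longlonglongrightarrow> 0"
    then have "\<forall>n. \<exists>h. h \<in> ?K \<and> shift z T h \<doteq> u n" by blast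
    from choice[OF this] obtain h where "\<forall>n. h n \<in> ?K \<and> shift z T (h n) \<doteq> u n" ..
    then have h: "\<And>n. h n \<in> ?K" "\<And>n. shift z T (h n) \<doteq> u n" by blast+
    have hV: "h n \<in> V" for n using h(1) by blast
    have uV: "u n \<in> V" for n using h(2) by blast
    have gV: "g \<in> V" and lim: "(\<lambda>n. nrm (u n - g)) \<longlonglongrightarrow> 0" using * by blast+
    obtain h0 where h0: "h0 \<in> V" "shift z Q h0 \<doteq> g" using neumann[OF Q Qc c gV] by blast
    have le: "(norm z - c) * nrm (h n - h0) \<le> nrm (u n - g)" for n
    proof -
      have "shift z Q (h n - h0) \<doteq> shift z Q (h n) - shift z Q h0"
        by (rule op_diff[OF SQ hV h0(1)])
      also have "shift z Q (h n) - shift z Q h0 \<doteq> u n - g"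
        using eqv_diff[OF h(2) h0(2)] onK[OF h(1)] by simp
      finally have "nrm (shift z Q (h n - h0)) = nrm (u n - g)" by (rule eqv_nrm)
      then show ?thesis using resolvent_lower_bound[OF Q Qc, of "h n - h0" z] hV h0 by simp
    qed
    have "l i h0 = 0" if i: "i < m" for i
    proof -
      obtain D where D: "D > 0" "\<And>h. h \<in> V \<Longrightarrow> norm (l i h) \<le> D * nrm h" using functional_bound[OF l[OF i]] by blast
      have "norm (l i h0) \<le> D / (norm z - c) * nrm (u n - g)" for n
      proof -
        have "l i (h n - h0) = - l i h0" using functional_diff[OF l[OF i] hV h0(1)] h(1)[of n] i by simp
        then have "norm (l i h0) \<le> D * nrm (h n - h0)" using D(2)[of "h n - h0"] hV h0 by simp
        also have "\<dots> \<le> D * (nrm (u n - g) / (norm z - c))"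
          using le[of n] c D by (intro mult_left_mono) (auto simp: field_simps)
        finally show ?thesis by simp
      qed
      moreover have "(\<lambda>n. D / (norm z - c) * nrm (u n - g)) \<longlonglongrightarrow> D / (norm z - c) * 0"
        by (rule tendsto_mult[OF tendsto_const lim])
      ultimately have "norm (l i h0) \<le> D / (norm z - c) * 0" by (intro LIMSEQ_le_const) blast+
      then show ?thesis by simp
    qed
    then have "h0 \<in> ?K" using h0 by simp
    then have "shift z T h0 \<doteq> g" using h0(2) onK[of h0] by simp
    with \<open>h0 \<in> ?K\<close> show "g \<in> ?W" by blast
  qed
  obtain B where B: "finite B" "B \<subseteq> V" "V \<subseteq> adjoin ?K B" using kernels_complement[of m l] l by blast
  let ?SB = "shift z T ` B"
  have SV: "shift z T h \<in> V" if "h \<in> V" for h using op_in[OF S that] .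
  have cl: "closed_sub (adjoin ?W ?SB)"
    by (rule closed_sub_adjoin[OF W]) (use B SV in blast)+
  have subR: "subspace ?R" by (rule subspace_image[OF S subspace_V]) auto
  have "?R = adjoin ?W ?SB"
  proof
    have "adjoin ?K B \<subseteq> {h \<in> V. shift z T h \<in> adjoin ?W ?SB}"
    proof (rule adjoin_least[OF subspace_vimage[OF S cl]])
      have "shift z T h \<in> adjoin ?W ?SB" if "h \<in> ?K" for h
      proof (rule adjoin_base[OF closed_subD(1)[OF W]])
        have "shift z T h \<doteq> shift z T h" using SV[of h] that by simp
        then show "shift z T h \<in> ?W" using that by blast
      qed
      then show "?K \<subseteq> {h \<in> V. shift z T h \<in> adjoin ?W ?SB}" by blast
      show "B \<subseteq> {h \<in> V. shift z T h \<in> adjoin ?W ?SB}"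
        using B(2) adjoin_gen[OF closed_subD(1)[OF W], of _ ?SB] by blast
    qed
    then have *: "shift z T h \<in> adjoin ?W ?SB" if "h \<in> V" for h using B(3) that by blast
    show "?R \<subseteq> adjoin ?W ?SB"
    proof
      fix g assume "g \<in> ?R"
      then obtain h where "h \<in> V" "shift z T h \<doteq> g" by blast
      then show "g \<in> adjoin ?W ?SB" using closed_sub_eqv[OF cl *] by blast
    qed
    show "adjoin ?W ?SB \<subseteq> ?R"
    proof (rule adjoin_least[OF subR])
      show "?W \<subseteq> ?R" by blast
      have "shift z T b \<doteq> shift z T b" if "b \<in> B" for b using SV that B(2) by auto
      then show "?SB \<subseteq> ?R" using B by blast
    qed
  qed
  then show ?thesis using cl by simp
qed

end

end

section \<open>Triangular chains\<close>

lemma bounded_functions_convergent_subseq: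
  fixes a :: "nat \<Rightarrow> nat \<Rightarrow> complex"
  assumes "\<And>i. i < (m::nat) \<Longrightarrow> bounded (range (a i))"
  shows "\<exists>r. strict_mono r \<and> (\<forall>i<m. convergent (\<lambda>n. a i (r n)))"
  using assms
proof (induction m)
  case 0
  show ?case by (rule exI[of _ id]) (simp add: strict_mono_def)
next
  case (Suc m)
  then obtain r where r: "strict_mono r" "\<forall>i<m. convergent (\<lambda>n. a i (r n))" by auto
  have "bounded (range (\<lambda>n. a m (r n)))"
    by (rule bounded_subset[OF Suc.prems[of m]]) auto
  then obtain lim s where s: "strict_mono (s :: nat \<Rightarrow> nat)" "((\<lambda>n. a m (r n)) \<circ> s) \<longlonglongrightarrow> lim"
    using bounded_imp_convergent_subsequence[of "\<lambda>n. a m (r n)"] by blast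
  have "convergent (\<lambda>n. a i ((r \<circ> s) n))" if "i < Suc m" for i
  proof (cases "i = m")
    case True then show ?thesis using s(2) by (auto simp: convergent_def o_def)
  next
    case False
    then have "convergent ((\<lambda>n. a i (r n)) \<circ> s)" using r(2) s(1) that by (intro convergent_subseq_convergent) auto
    then show ?thesis by (simp add: o_def)
  qed
  then show ?case using strict_mono_o[OF r(1) s(1)] by blast
qed

context complete_seminormed_space begin

text \<open>
  An operator within \<open>c\<close> of finite rank shrinks Kuratowski's measure of noncompactness by the
  factor \<open>c\<close>.  For sequences: along a subsequence the finitely many functionals converge, and the
  differences of the images are then due to the small part alone.
\<close>
lemma ess_bounded_diameter:
  assumes T: "bounded_op T" and ess: "ess_bounded c T" and c: "0 \<le> c"
    and w: "\<And>n. w n \<in> V" and d: "\<And>j k. nrm (w j - w k) \<le> d" and \<delta>: "\<delta> > 0"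
  shows "\<exists>r :: nat \<Rightarrow> nat. strict_mono r \<and> (\<forall>j k. nrm (T (w (r j)) - T (w (r k))) \<le> c * d + \<delta>)"
proof -
  obtain m l e Q where l: "\<And>i. i < (m::nat) \<Longrightarrow> functional (l i)" and e: "\<And>i. i < m \<Longrightarrow> e i \<in> V"
    and Q: "bounded_op Q" "\<And>h. h \<in> V \<Longrightarrow> nrm (Q h) \<le> c * nrm h" and TQ: "\<And>h. T h = Q h + (\<Sum>i<m. l i h \<odot> e i)"
    using ess_boundedE[OF T ess] by blast
  have "bounded (range (\<lambda>n. l i (w n)))" if i: "i < m" for i
  proof -
    obtain D where D: "D > 0" "\<And>h. h \<in> V \<Longrightarrow> norm (l i h) \<le> D * nrm h" using functional_bound[OF l[OF i]] by blast
    have "norm (l i (w n)) \<le> D * (d + nrm (w 0))" for n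
    proof -
      have "nrm (w n) \<le> d + nrm (w 0)" using nrm_le_diff[OF w[of n] w[of 0]] d[of n 0] by simp
      then show ?thesis using D(2)[OF w[of n]] D(1) by (meson mult_left_mono less_imp_le order_trans)
    qed
    then show ?thesis by (intro boundedI) auto
  qed
  then obtain r where r: "strict_mono r" "\<forall>i<m. convergent (\<lambda>n. l i (w (r n)))"
    using bounded_functions_convergent_subseq[of m "\<lambda>i n. l i (w n)"] by blast
  then have "\<forall>i. \<exists>L. i < m \<longrightarrow> (\<lambda>n. l i (w (r n))) \<longlonglongrightarrow> L" by (auto simp: convergent_def)
  then obtain L where L: "\<And>i. i < m \<Longrightarrow> (\<lambda>n. l i (w (r n))) \<longlonglongrightarrow> L i" by metis
  define \<rho> where "\<rho> n = (\<Sum>i<m. norm (l i (w (r n)) - L i) * nrm (e i))" for n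
  have "\<rho> \<longlonglongrightarrow> (\<Sum>i<m. 0 * nrm (e i))"
    unfolding \<rho>_def using L by (intro tendsto_sum tendsto_mult tendsto_const tendsto_norm_zero LIM_zero) auto
  then have "eventually (\<lambda>n. \<rho> n < \<delta> / 2) sequentially"
    using \<delta> by (intro order_tendstoD(2)[of \<rho> 0]) auto
  then obtain M where M: "\<And>n. n \<ge> M \<Longrightarrow> \<rho> n < \<delta> / 2" by (auto simp: eventually_sequentially)
  define s where "s n = r (n + M)" for n
  have "strict_mono s" using r(1) by (auto simp: s_def strict_mono_def)
  moreover have "nrm (T (w (s j)) - T (w (s k))) \<le> c * d + \<delta>" for j k
  proof -
    let ?x = "w (s j)" and ?y = "w (s k)"
    have eV: "(l i x - l i y) \<odot> e i \<in> V" if "i \<in> {..<m}" for i x y using e that by auto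
    have "T ?x - T ?y = (Q ?x - Q ?y) + (\<Sum>i<m. (l i ?x - l i ?y) \<odot> e i)"
      by (simp add: TQ scale_left_diff_distrib sum_subtractf)
    also have "nrm \<dots> \<le> nrm (Q ?x - Q ?y) + nrm (\<Sum>i<m. (l i ?x - l i ?y) \<odot> e i)"
      using eV Q w by (intro nrm_triangle sum_in_V) auto
    also have "nrm (Q ?x - Q ?y) = nrm (Q (?x - ?y))" using eqv_nrm[OF op_diff[OF Q(1) w w]] by simp
    also have "\<dots> \<le> c * d" using Q(2)[of "?x - ?y"] w mult_left_mono[OF d c] by (meson V_intros(3) order_trans)
    also have "nrm (\<Sum>i<m. (l i ?x - l i ?y) \<odot> e i) \<le> (\<Sum>i<m. nrm ((l i ?x - l i ?y) \<odot> e i))"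
      using eV by (rule nrm_sum)
    also have "\<dots> \<le> (\<Sum>i<m. norm (l i ?x - L i) * nrm (e i) + norm (l i ?y - L i) * nrm (e i))"
    proof (rule sum_mono)
      fix i assume "i \<in> {..<m}"
      then have eI: "e i \<in> V" using e by simp
      have "norm (l i ?x - l i ?y) \<le> norm (l i ?x - L i) + norm (l i ?y - L i)"
        using norm_triangle_ineq4[of "l i ?x - L i" "l i ?y - L i"] by simp
      then show "nrm ((l i ?x - l i ?y) \<odot> e i) \<le> norm (l i ?x - L i) * nrm (e i) + norm (l i ?y - L i) * nrm (e i)"
        using nrm_scale[OF eI] mult_right_mono[OF _ nrm_nonneg[OF eI]] by (simp flip: distrib_right)
    qed
    also have "\<dots> = \<rho> (j + M) + \<rho> (k + M)" by (simp add: sum.distrib \<rho>_def s_def)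
    also have "\<dots> \<le> \<delta>" using M[of "j + M"] M[of "k + M"] by simp
    finally show ?thesis by simp
  qed
  ultimately show ?thesis by (intro exI[of _ s]) blast
qed

text \<open>
  Passing to powers makes the gap between \<open>c\<close> and a larger radius beat every constant factor.
\<close>
lemma ess_bounded_diameter_funpow:
  assumes T: "bounded_op T" and ess: "ess_bounded c T" and c: "0 \<le> c" "c < c'"
    and y: "\<And>n. y n \<in> V" "\<And>n. nrm (y n) \<le> 1"
  shows "\<exists>r :: nat \<Rightarrow> nat. strict_mono r \<and> (\<forall>j k. nrm ((T ^^ n) (y (r j)) - (T ^^ n) (y (r k))) \<le> 2 * c' ^ n)"
proof (induction n)
  case 0
  have "nrm (y j - y k) \<le> 2" for j k using nrm_diff[of "y j" "y k"] y(1)[of j] y(1)[of k] y(2)[of j] y(2)[of k] by simp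
  then show ?case by (intro exI[of _ id]) (simp add: strict_mono_def)
next
  case (Suc n)
  then obtain r where r: "strict_mono (r :: nat \<Rightarrow> nat)" "\<And>j k. nrm ((T ^^ n) (y (r j)) - (T ^^ n) (y (r k))) \<le> 2 * c' ^ n" by blast
  \<comment> \<open>the slack \<open>2 c'\<^sup>n (c' - c)\<close> turns the factor \<open>c\<close> into \<open>c'\<close>\<close>
  have "\<exists>s :: nat \<Rightarrow> nat. strict_mono s \<and> (\<forall>j k. nrm (T ((T ^^ n) (y (r (s j)))) - T ((T ^^ n) (y (r (s k))))) \<le> c * (2 * c' ^ n) + 2 * c' ^ n * (c' - c))"
    by (rule ess_bounded_diameter[of T c "\<lambda>j. (T ^^ n) (y (r j))", OF T ess c(1)])
      (use r(2) c in \<open>auto intro: funpow_in[OF T y(1)]\<close>)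
  then obtain s where s: "strict_mono (s :: nat \<Rightarrow> nat)"
    "\<And>j k. nrm (T ((T ^^ n) (y (r (s j)))) - T ((T ^^ n) (y (r (s k))))) \<le> c * (2 * c' ^ n) + 2 * c' ^ n * (c' - c)" by blast
  have "c * (2 * c' ^ n) + 2 * c' ^ n * (c' - c) = 2 * c' ^ Suc n" by (simp add: algebra_simps)
  then show ?case using s(2) strict_mono_o[OF r(1) s(1)] by (intro exI[of _ "\<lambda>n. r (s n)"]) (simp add: o_def)
qed

lemma adjoin_null_invariant:
  assumes T: "bounded_op T" and B: "finite B" "B \<subseteq> V" "\<And>b. b \<in> B \<Longrightarrow> T b \<in> adjoin null B"
    and h: "h \<in> adjoin null B"
  shows "T h \<in> adjoin null B"
proof -
  have G: "closed_sub (adjoin null B)" by (rule closed_sub_adjoin[OF closed_sub_null B(1,2)])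
  have "T h \<in> adjoin null B" if "h \<in> null" for h
  proof -
    have "0 \<doteq> T h" using op_null[OF T, of h] that by (intro eqv_sym[of "T h"]) (simp add: null_def)
    then show ?thesis by (rule closed_sub_eqv[OF G subspace_0[OF closed_subD(1)[OF G]]])
  qed
  then have "null \<subseteq> {h \<in> V. T h \<in> adjoin null B}" "B \<subseteq> {h \<in> V. T h \<in> adjoin null B}"
    using B closed_subD(2)[OF closed_sub_null] by blast+
  from adjoin_least[OF subspace_vimage[OF T G] this] show ?thesis using h by blast
qed

text \<open>
  Riesz's lemma; the vector is a multiple of \<open>x\<close> modulo \<open>W\<close>, which preserves the triangular form of
  an operator.
\<close>
lemma riesz_vector:
  assumes W: "closed_sub W" and x: "x \<in> V" "x \<notin> W"
  obtains a v where "a \<noteq> 0" "v \<in> W" "nrm (a \<odot> x - v) = 1" "\<And>w. w \<in> W \<Longrightarrow> nrm (a \<odot> x - w) \<ge> 1 / 2"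
proof -
  note sub = closed_subD(1)[OF W]
  define D where "D = (INF w\<in>W. nrm (x - w))"
  have V: "x - w \<in> V" if "w \<in> W" for w using closed_subD(2)[OF W] x that by auto
  have bdd: "bdd_below ((\<lambda>w. nrm (x - w)) ` W)" using V by (intro bdd_belowI[of _ 0]) auto
  have ne: "W \<noteq> {}" using subspace_0[OF sub] by blast
  obtain d where d: "d > 0" "\<And>w. w \<in> W \<Longrightarrow> d \<le> nrm (w - x)" using closed_sub_distance[OF W x] by blast
  have "d \<le> D" unfolding D_def using d(2) nrm_diff_commute[of x] closed_subD(2)[OF W] x
    by (intro cINF_greatest[OF ne]) auto
  then have D: "D > 0" using d by simp
  have Dle: "D \<le> nrm (x - w)" if "w \<in> W" for w unfolding D_def using that by (intro cINF_lower[OF bdd])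
  have "\<exists>w\<in>W. nrm (x - w) < 2 * D"
  proof (rule ccontr)
    assume "\<not> ?thesis"
    then have "\<And>w. w \<in> W \<Longrightarrow> 2 * D \<le> nrm (x - w)" by (auto simp: not_less)
    then have "2 * D \<le> (INF w\<in>W. nrm (x - w))" by (rule cINF_greatest[OF ne])
    then have "2 * D \<le> D" by (simp only: D_def)
    then show False using D by simp
  qed
  then obtain w where w: "w \<in> W" "nrm (x - w) < 2 * D" by blast
  define t where "t = nrm (x - w)"
  have t: "t > 0" "t < 2 * D" using Dle[OF w(1)] D w by (auto simp: t_def)
  define a where "a = complex_of_real (1 / t)"
  have a: "a \<noteq> 0" "norm a = 1 / t" using t by (auto simp: a_def norm_divide)
  show thesis
  proof (rule that[of a "a \<odot> w"])
    show "a \<odot> w \<in> W" by (rule subspace_scale[OF sub w(1)])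
    have "nrm (a \<odot> x - a \<odot> w) = norm a * nrm (x - w)"
      using nrm_scale[OF V[OF w(1)], of a] by (simp add: scale_right_diff_distrib)
    then show "nrm (a \<odot> x - a \<odot> w) = 1" using a t by (simp add: t_def)
    fix u assume u: "u \<in> W"
    then have u': "inverse a \<odot> u \<in> W" by (rule subspace_scale[OF sub])
    have "nrm (a \<odot> x - u) = nrm (a \<odot> (x - inverse a \<odot> u))" using a by (simp add: scale_right_diff_distrib)
    also have "\<dots> = norm a * nrm (x - inverse a \<odot> u)" by (rule nrm_scale[OF V[OF u']])
    also have "\<dots> \<ge> 1 / t * D" using a t Dle[OF u'] by (intro mult_mono) auto
    also have "1 / t * D \<ge> 1 / 2" using t by (simp add: field_simps)
    finally show "nrm (a \<odot> x - u) \<ge> 1 / 2" by simp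
  qed (use a in auto)
qed

text \<open>
  Let \<open>G k\<close> be the span of the first \<open>k\<close> vectors.  Riesz's lemma gives \<open>y k\<close> in \<open>G (k + 1)\<close> of norm
  one and at distance at least \<open>1 / 2\<close> from \<open>G k\<close>.  Since \<open>T\<close> acts on \<open>G (k + 1) / G k\<close> as
  multiplication by \<open>z k\<close>, the vectors \<open>T\<^sup>n (y k)\<close> have mutual distances at least \<open>R\<^sup>n / 2\<close>.  Two
  of them have distance at most \<open>2 c'\<^sup>n\<close> with \<open>c < c' < R\<close>, a contradiction for large \<open>n\<close>.
\<close>
lemma no_triangular_chain:
  fixes x :: "nat \<Rightarrow> 'v" and z :: "nat \<Rightarrow> complex"
  assumes T: "bounded_op T" and ess: "ess_bounded c T" and c: "0 \<le> c" "c < R"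
    and x: "\<And>k. x k \<in> V" "\<And>k. x k \<notin> adjoin null (x ` {..<k})"
    and Tx: "\<And>k. shift (z k) T (x k) \<in> adjoin null (x ` {..<k})"
    and z: "\<And>k. R \<le> norm (z k)"
  shows False
proof -
  define G where "G k = adjoin null (x ` {..<k})" for k
  have G: "closed_sub (G k)" for k
    unfolding G_def using x(1) by (intro closed_sub_adjoin closed_sub_null) auto
  note sub = closed_subD(1)[OF G] and GV = closed_subD(2)[OF G]
  have mono: "G j \<subseteq> G k" if "j \<le> k" for j k unfolding G_def using that by (intro adjoin_mono) auto
  have xG: "x j \<in> G k" if "j < k" for j k
    unfolding G_def using that by (intro adjoin_gen closed_subD(1)[OF closed_sub_null]) auto
  have TG: "T h \<in> G k" if "h \<in> G k" for h k
  proof -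
    have "T (x j) \<in> G k" if "j < k" for j
    proof -
      have "z j \<odot> x j - shift (z j) T (x j) \<in> G k"
      proof (rule subspace_diff[OF sub subspace_scale[OF sub xG[OF that]]])
        show "shift (z j) T (x j) \<in> G k" using Tx[of j] mono[of j k] that by (auto simp: G_def[of j])
      qed
      then show ?thesis by simp
    qed
    then show ?thesis using adjoin_null_invariant[OF T, of "x ` {..<k}" h] that x(1) by (auto simp: G_def)
  qed
  have "\<exists>y. y \<in> V \<and> y \<in> G (Suc k) \<and> nrm y \<le> 1 \<and> shift (z k) T y \<in> G k \<and> (\<forall>w\<in>G k. nrm (y - w) \<ge> 1 / 2)" for k
  proof -
    have "x k \<notin> G k" using x(2) by (simp add: G_def)
    then obtain a v where av: "a \<noteq> 0" "v \<in> G k" "nrm (a \<odot> x k - v) = 1"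
      "\<And>w. w \<in> G k \<Longrightarrow> nrm (a \<odot> x k - w) \<ge> 1 / 2" using riesz_vector[OF G x(1)] by blast
    have vV: "v \<in> V" using av(2) GV by blast
    let ?y = "a \<odot> x k - v"
    have 1: "?y \<in> V" using vV x by auto
    have 2: "?y \<in> G (Suc k)" using xG[of k "Suc k"] av(2) mono[of k "Suc k"]
      by (intro subspace_diff[OF sub] subspace_scale[OF sub]) auto
    have S: "bounded_op (shift (z k) T)" by (rule op_shift[OF T])
    have "a \<odot> shift (z k) T (x k) - shift (z k) T v \<in> G k"
      by (rule subspace_diff[OF sub subspace_scale[OF sub]
            subspace_diff[OF sub subspace_scale[OF sub av(2)] TG[OF av(2)]]])
        (use Tx[of k] in \<open>simp add: G_def\<close>)
    moreover have "a \<odot> shift (z k) T (x k) - shift (z k) T v \<doteq> shift (z k) T ?y"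
      by (rule eqv_sym[of "shift (z k) T ?y"]) (use op_lin_diff[OF S x(1)[of k] vV, of a 1] in \<open>simp only: scale_one\<close>)
    ultimately have 3: "shift (z k) T ?y \<in> G k" by (rule closed_sub_eqv[OF G])
    have 4: "nrm (?y - w) \<ge> 1 / 2" if "w \<in> G k" for w
      using av(4)[OF subspace_add[OF sub av(2) that]] by (simp add: diff_diff_eq)
    show ?thesis using 1 2 3 4 av(3) by (intro exI[of _ ?y]) simp
  qed
  then obtain y where y: "\<And>k. y k \<in> V" "\<And>k. y k \<in> G (Suc k)" "\<And>k. nrm (y k) \<le> 1"
    "\<And>k. shift (z k) T (y k) \<in> G k" "\<And>k w. w \<in> G k \<Longrightarrow> nrm (y k - w) \<ge> 1 / 2" by metis
  have TnG: "(T ^^ n) h \<in> G k" if "h \<in> G k" for n h k by (induction n) (use that TG in auto)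
  have TnV: "(T ^^ n) (y k) \<in> V" for n k by (rule funpow_in[OF T y(1)])
  have pow: "(T ^^ n) (y k) - z k ^ n \<odot> y k \<in> G k" for n k
  proof (induction n)
    case 0 show ?case using subspace_0[OF sub] by simp
  next
    case (Suc n)
    let ?r = "(T ^^ n) (y k) - z k ^ n \<odot> y k"
    have "T ?r - z k ^ n \<odot> shift (z k) T (y k) \<in> G k"
      by (rule subspace_diff[OF sub TG[OF Suc] subspace_scale[OF sub y(4)]])
    moreover have "T ?r - z k ^ n \<odot> shift (z k) T (y k) \<doteq> (T ^^ Suc n) (y k) - z k ^ Suc n \<odot> y k"
    proof -
      have "T ?r \<doteq> T ((T ^^ n) (y k)) - z k ^ n \<odot> T (y k)"
        using op_lin_diff[OF T TnV[of n k] y(1)[of k], of 1 "z k ^ n"] by (simp only: scale_one)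
      then have "T ?r - z k ^ n \<odot> shift (z k) T (y k) \<doteq>
        (T ((T ^^ n) (y k)) - z k ^ n \<odot> T (y k)) - z k ^ n \<odot> shift (z k) T (y k)"
        by (rule eqv_diff) (use y(1) T in simp)
      also have "(T ((T ^^ n) (y k)) - z k ^ n \<odot> T (y k)) - z k ^ n \<odot> shift (z k) T (y k) =
        (T ^^ Suc n) (y k) - z k ^ Suc n \<odot> y k" by (simp add: algebra_simps)
      finally show ?thesis .
    qed
    ultimately show ?case by (rule closed_sub_eqv[OF G])
  qed
  obtain c' where c': "c < c'" "c' < R" using dense[OF c(2)] by blast
  have R: "R > 0" "c' > 0" using c c' by auto
  then have "(c' / R) < 1" "0 \<le> c' / R" using c' by auto
  then obtain n where n: "(c' / R) ^ n < 1 / 4" using real_arch_pow_inv[of "1/4" "c' / R"] by auto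
  obtain r where r: "strict_mono (r :: nat \<Rightarrow> nat)"
    "\<And>j k. nrm ((T ^^ n) (y (r j)) - (T ^^ n) (y (r k))) \<le> 2 * c' ^ n"
    using ess_bounded_diameter_funpow[of T c c' y n, OF T ess c(1) c'(1) y(1) y(3)] by blast
  define j k where "j = r 0" and "k = r 1"
  have jk: "j < k" using r(1) by (simp add: j_def k_def strict_mono_def)
  let ?p = "z k ^ n"
  have z0: "z k \<noteq> 0" using z[of k] R by auto
  have yj: "(T ^^ n) (y j) \<in> G k" using TnG[of "y j" k n] y(2)[of j] mono[of "Suc j" k] jk by auto
  \<comment> \<open>modulo \<open>G k\<close> the difference of the two images is \<open>z k ^ n\<close> times \<open>y k\<close>\<close>
  let ?v = "(T ^^ n) (y j) - ((T ^^ n) (y k) - ?p \<odot> y k)"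
  have v: "?v \<in> G k" by (rule subspace_diff[OF sub yj pow])
  then have v': "inverse ?p \<odot> ?v \<in> G k" by (rule subspace_scale[OF sub])
  have "(T ^^ n) (y k) - (T ^^ n) (y j) = ?p \<odot> (y k - inverse ?p \<odot> ?v)"
  proof -
    have "?p \<odot> (inverse ?p \<odot> ?v) = ?v" using z0 by simp
    then show ?thesis unfolding scale_right_diff_distrib[of ?p "y k"] by simp
  qed
  moreover have "y k - inverse ?p \<odot> ?v \<in> V" using y(1) v' GV by blast
  ultimately have "nrm ((T ^^ n) (y k) - (T ^^ n) (y j)) = norm ?p * nrm (y k - inverse ?p \<odot> ?v)"
    using nrm_scale by simp
  also have "\<dots> \<ge> R ^ n * (1 / 2)"
    using y(5)[OF v'] power_mono[OF z[of k], of n] R by (intro mult_mono) (auto simp: norm_power)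
  finally have "R ^ n * (1 / 2) \<le> 2 * c' ^ n" using r(2)[of 1 0] by (simp add: j_def k_def)
  moreover have "2 * c' ^ n < R ^ n * (1 / 2)" using n R by (simp add: power_divide field_simps)
  ultimately show False by simp
qed

end

section \<open>Spectrum outside the essential radius\<close>

context complete_seminormed_space begin

lemma not_invertible_eigenvector:
  assumes T: "bounded_op T" and ess: "ess_bounded c T" and c: "0 \<le> c" "c < norm z"
    and "\<not> invertible (shift z T)"
  obtains h where "h \<in> V" "nrm h \<noteq> 0" "shift z T h \<doteq> 0"
proof -
  obtain m l e Q where "\<And>i. i < (m::nat) \<Longrightarrow> functional (l i)" "\<And>i. i < m \<Longrightarrow> e i \<in> V"
    "bounded_op Q" "\<And>h. h \<in> V \<Longrightarrow> nrm (Q h) \<le> c * nrm h" "\<And>h. T h = Q h + (\<Sum>i<m. l i h \<odot> e i)"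
    using ess_boundedE[OF T ess] by blast
  from finite_rank_invertible[of m l e T Q c z, OF this(1,2) T this(3-5) c]
  have "\<not> (\<forall>h. h \<in> V \<longrightarrow> shift z T h \<doteq> 0 \<longrightarrow> h \<doteq> 0)" using assms(5) by blast
  then show thesis using that by (auto simp: eqv_zero)
qed

lemma ess_bounded_closed_range:
  assumes T: "bounded_op T" and ess: "ess_bounded c T" and c: "0 \<le> c" "c < norm z"
  shows "closed_sub {g. \<exists>h\<in>V. shift z T h \<doteq> g}"
proof -
  obtain m l e Q where "\<And>i. i < (m::nat) \<Longrightarrow> functional (l i)" "\<And>i. i < m \<Longrightarrow> e i \<in> V"
    "bounded_op Q" "\<And>h. h \<in> V \<Longrightarrow> nrm (Q h) \<le> c * nrm h" "\<And>h. T h = Q h + (\<Sum>i<m. l i h \<odot> e i)"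
    using ess_boundedE[OF T ess] by blast
  from finite_rank_closed_range[of m l e T Q c z, OF this(1,2) T this(3-5) c] show ?thesis .
qed

text \<open>
  Eigenvectors for distinct eigenvalues are independent.  If \<open>y\<close> involves \<open>x k\<close> with coefficient
  \<open>a\<close>, applying \<open>w - T\<close> shows that \<open>a (\<zeta> k - w) x k\<close> is a combination of the earlier eigenvectors.
\<close>
lemma eigenvectors_independent:
  fixes x :: "nat \<Rightarrow> 'v" and \<zeta> :: "nat \<Rightarrow> complex"
  assumes T: "bounded_op T" and x: "\<And>j. x j \<in> V" "\<And>j. \<not> x j \<doteq> 0" "\<And>j. shift (\<zeta> j) T (x j) \<doteq> 0"
    and inj: "inj \<zeta>"
    and y: "y \<in> adjoin null (x ` {..<k})" "shift w T y \<doteq> 0" "w \<notin> \<zeta> ` {..<k}"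
  shows "y \<doteq> 0"
  using y
proof (induction k arbitrary: y w)
  case 0
  then show ?case by (simp add: adjoin_empty null_def)
next
  case (Suc k)
  define G where "G = adjoin null (x ` {..<k})"
  have G: "closed_sub G" unfolding G_def using x(1) by (intro closed_sub_adjoin closed_sub_null) auto
  note sub = closed_subD(1)[OF G]
  have Tx: "T (x j) \<doteq> \<zeta> j \<odot> x j" for j
    using x(3)[of j] eqv_diff_zero[of "\<zeta> j \<odot> x j" "T (x j)"] T x(1)[of j] by (auto intro: eqv_sym[of "\<zeta> j \<odot> x j"])
  have TG: "T h \<in> G" if "h \<in> G" for h
    unfolding G_def
  proof (rule adjoin_null_invariant[OF T])
    fix b assume "b \<in> x ` {..<k}"
    then obtain j where j: "b = x j" "x j \<in> G"
      using adjoin_gen[OF closed_subD(1)[OF closed_sub_null], of b "x ` {..<k}"] by (auto simp: G_def)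
    have "\<zeta> j \<odot> x j \<doteq> T (x j)" by (rule eqv_sym[OF Tx])
    then have "T b \<in> G" unfolding j(1) by (rule closed_sub_eqv[OF G subspace_scale[OF sub j(2)]])
    then show "T b \<in> adjoin null (x ` {..<k})" by (simp add: G_def)
  qed (use x(1) that in \<open>auto simp: G_def\<close>)
  obtain a where a: "y - a \<odot> x k \<in> G"
    using Suc.prems(1) by (auto simp: lessThan_Suc adjoin_insert G_def)
  define v where "v = y - a \<odot> x k"
  have v: "v \<in> G" "v \<in> V" using a closed_subD(2)[OF G] by (auto simp: v_def)
  have y: "y \<in> V" using V_intros(2)[OF v(2) V_intros(4)[OF x(1)[of k], of a]] by (simp add: v_def)
  have S: "bounded_op (shift w T)" by (rule op_shift[OF T])
  have 1: "shift w T v \<in> G" by (rule subspace_diff[OF sub subspace_scale[OF sub v(1)] TG[OF v(1)]])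
  have "shift w T v \<doteq> shift w T y - a \<odot> shift w T (x k)"
    unfolding v_def using op_lin_diff[OF S y x(1)[of k], of 1 a] by (simp only: scale_one)
  also have "\<dots> \<doteq> 0 - a \<odot> (w \<odot> x k - \<zeta> k \<odot> x k)"
    by (rule eqv_diff[OF Suc.prems(2) eqv_scale[OF eqv_diff[OF _ Tx]]]) (use x(1) in simp)
  also have "0 - a \<odot> (w \<odot> x k - \<zeta> k \<odot> x k) = (a * (\<zeta> k - w)) \<odot> x k"
    by (simp add: algebra_simps)
  finally have "shift w T v \<doteq> (a * (\<zeta> k - w)) \<odot> x k" .
  then have 2: "(a * (\<zeta> k - w)) \<odot> x k \<in> G" by (rule closed_sub_eqv[OF G 1])
  have "a = 0"
  proof (rule ccontr)
    assume "a \<noteq> 0"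
    moreover have "w \<noteq> \<zeta> k" using Suc.prems(3) by auto
    ultimately have "a * (\<zeta> k - w) \<noteq> 0" by simp
    then have "inverse (a * (\<zeta> k - w)) * (a * (\<zeta> k - w)) = 1" by (rule left_inverse)
    then have "x k \<in> G" using subspace_scale[OF sub 2, of "inverse (a * (\<zeta> k - w))"] by (simp only: scale_scale scale_one)
    then have "x k \<doteq> 0"
      using Suc.IH[of "x k" "\<zeta> k"] x(3)[of k] inj by (auto simp: G_def inj_def)
    then show False using x(2) by blast
  qed
  moreover have "w \<notin> \<zeta> ` {..<k}" using Suc.prems(3) by (auto simp: lessThan_Suc)
  ultimately show ?case using Suc.IH[of y w] Suc.prems(2) a by (simp add: G_def)
qed

text \<open>
  Infinitely many spectral values near \<open>z0\<close> are eigenvalues, and their eigenvectors form a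
  triangular chain.
\<close>
lemma ess_bounded_isolated:
  assumes T: "bounded_op T" and ess: "ess_bounded c T" and c: "0 \<le> c" "c < norm z0"
  shows "\<not> z0 islimpt {z. \<not> invertible (shift z T)}"
proof
  assume "z0 islimpt {z. \<not> invertible (shift z T)}"
  obtain R where R: "c < R" "R < norm z0" using dense[OF c(2)] by blast
  have "infinite ({z. \<not> invertible (shift z T)} \<inter> ball z0 (norm z0 - R))"
    using \<open>z0 islimpt _\<close> R by (simp add: islimpt_eq_infinite_ball)
  then obtain \<zeta> :: "nat \<Rightarrow> complex" where \<zeta>: "inj \<zeta>"
    "range \<zeta> \<subseteq> {z. \<not> invertible (shift z T)} \<inter> ball z0 (norm z0 - R)"
    using infinite_countable_subset by blast
  have \<zeta>R: "R \<le> norm (\<zeta> k)" for k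
  proof -
    have "\<zeta> k \<in> ball z0 (norm z0 - R)" using \<zeta>(2) rangeI[of \<zeta> k] by blast
    then have "dist z0 (\<zeta> k) < norm z0 - R" by simp
    then show ?thesis using norm_triangle_ineq2[of z0 "\<zeta> k"] by (simp add: dist_norm)
  qed
  have "\<exists>h. h \<in> V \<and> nrm h \<noteq> 0 \<and> shift (\<zeta> k) T h \<doteq> 0" for k
  proof -
    have "\<not> invertible (shift (\<zeta> k) T)" using \<zeta>(2) by blast
    moreover have "c < norm (\<zeta> k)" using \<zeta>R[of k] R by simp
    ultimately show ?thesis using not_invertible_eigenvector[OF T ess c(1), of "\<zeta> k"] by blast
  qed
  from choice[OF allI[OF this]]
  obtain x where "\<forall>k. x k \<in> V \<and> nrm (x k) \<noteq> 0 \<and> shift (\<zeta> k) T (x k) \<doteq> 0" ..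
  then have x: "\<And>k. x k \<in> V" "\<And>k. \<not> x k \<doteq> 0" "\<And>k. shift (\<zeta> k) T (x k) \<doteq> 0"
    by (auto simp: eqv_zero)
  show False
  proof (rule no_triangular_chain[OF T ess c(1) R(1) x(1) _ _ \<zeta>R])
    fix k
    show "x k \<notin> adjoin null (x ` {..<k})"
      using eigenvectors_independent[OF T x \<zeta>(1), of "x k" k "\<zeta> k"] x(2,3) \<zeta>(1) by (auto simp: inj_def)
    show "shift (\<zeta> k) T (x k) \<in> adjoin null (x ` {..<k})"
      using x(3)[of k] by (intro adjoin_base closed_subD(1)[OF closed_sub_null]) (simp add: null_def)
  qed
qed

text \<open>
  If no finite set spans the generalized kernel, then a generalized eigenvector outside the span of
  the vectors chosen so far exists, and the last of its images under powers of \<open>z - T\<close> outside this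
  span continues a triangular chain with constant diagonal entry \<open>z\<close>.
\<close>
lemma ess_bounded_finite_generalized_kernel:
  assumes T: "bounded_op T" and ess: "ess_bounded c T" and c: "0 \<le> c" "c < norm z"
  shows "\<exists>B. finite B \<and> B \<subseteq> V \<and> (\<forall>h\<in>V. (\<exists>n. (shift z T ^^ n) h \<doteq> 0) \<longrightarrow> h \<in> adjoin null B)"
proof (rule ccontr)
  assume neg: "\<not> ?thesis"
  define S where "S = shift z T"
  define P where "P f k r \<longleftrightarrow> r \<in> V \<and> r \<notin> adjoin null (f ` {..<k}) \<and> S r \<in> adjoin null (f ` {..<k})"
    for f :: "nat \<Rightarrow> 'v" and k r
  have S: "bounded_op S" unfolding S_def by (rule op_shift[OF T])
  have "\<exists>x. \<forall>k. P x k (x k)"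
  proof (rule dependent_wellorder_choice)
    fix r k and f g :: "nat \<Rightarrow> 'v"
    assume "\<And>j. j < k \<Longrightarrow> f j = g j"
    then have "f ` {..<k} = g ` {..<k}" by (intro image_cong) auto
    then show "P f k r = P g k r" by (simp add: P_def)
  next
    fix k and f :: "nat \<Rightarrow> 'v"
    assume IH: "\<And>j. j < k \<Longrightarrow> P f j (f j)"
    define B where "B = f ` {..<k}"
    have B: "finite B" "B \<subseteq> V" using IH by (auto simp: B_def P_def)
    then obtain h n where h: "h \<in> V" "(S ^^ n) h \<doteq> 0" "h \<notin> adjoin null B"
      using neg unfolding S_def by blast
    have "(S ^^ n) h \<in> adjoin null B"
      using h(2) by (intro adjoin_base closed_subD(1)[OF closed_sub_null]) (simp add: null_def)
    moreover have "(S ^^ 0) h \<notin> adjoin null B" using h(3) by simp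
    ultimately obtain j where j: "(S ^^ j) h \<notin> adjoin null B" "(S ^^ Suc j) h \<in> adjoin null B"
      using ex_least_nat_less[of "\<lambda>j. (S ^^ j) h \<in> adjoin null B" n] by auto
    then have "P f k ((S ^^ j) h)" using funpow_in[OF S h(1)] by (simp add: P_def B_def)
    then show "\<exists>r. P f k r" by blast
  qed
  then obtain x where "\<forall>k. P x k (x k)" ..
  then have x: "\<And>k. x k \<in> V" "\<And>k. x k \<notin> adjoin null (x ` {..<k})"
    "\<And>k. S (x k) \<in> adjoin null (x ` {..<k})" by (simp_all add: P_def)
  show False
    by (rule no_triangular_chain[of T c "norm z" x "\<lambda>_. z", OF T ess c x(1,2)])
      (use x(3) in \<open>simp_all add: S_def\<close>)
qed

end

section \<open>Spaces of functions\<close>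

definition cscale :: "complex \<Rightarrow> ('a \<Rightarrow> complex) \<Rightarrow> 'a \<Rightarrow> complex" where
  "cscale c h = (\<lambda>x. c * h x)"

lemma cscale_apply [simp]: "cscale c h x = c * h x"
  by (simp add: cscale_def)

lemma vector_space_cscale: "vector_space (cscale :: complex \<Rightarrow> ('a \<Rightarrow> complex) \<Rightarrow> _)"
  by standard (auto simp: fun_eq_iff algebra_simps)

lemma sum_fun_apply: "(\<Sum>i\<in>I. f i) x = (\<Sum>i\<in>I. f i x :: complex)"
  by (induction I rule: infinite_finite_induct) simp_all

text \<open>
  The spectral notions only depend on the norm up to equivalence.  Estimates are made in \<open>nrm\<close>,
  conclusions are drawn for \<open>nrm'\<close>.
\<close>
locale equivalent_norm = complete_seminormed_space cscale V nrm
  for V :: "('a \<Rightarrow> complex) set" and nrm :: "('a \<Rightarrow> complex) \<Rightarrow> real" +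
  fixes nrm' :: "('a \<Rightarrow> complex) \<Rightarrow> real" and A :: real
  assumes A: "A > 0" and le_nrm: "\<And>h. h \<in> V \<Longrightarrow> nrm' h \<le> A * nrm h"
    and nrm_le: "\<And>h. h \<in> V \<Longrightarrow> nrm h \<le> A * nrm' h"
begin

lemma nrm'_zero: "x \<doteq> y \<Longrightarrow> nrm' (x - y) = 0"
  using le_nrm[of "x - y"] nrm_le[of "x - y"] A by (auto simp: eqv_def intro: antisym simp: zero_le_mult_iff)

lemma nrm'_zeroD: "x \<in> V \<Longrightarrow> y \<in> V \<Longrightarrow> nrm' (x - y) = 0 \<Longrightarrow> x \<doteq> y"
  using nrm_le[of "x - y"] nrm_nonneg[of "x - y"] by (simp add: eqv_def del: nrm_nonneg)

lemma lambda_eqs: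
  "(\<lambda>y. a * h y + b * k y) = cscale a h + cscale b k"
  "(\<lambda>x. f x - g x) = f - (g :: 'a \<Rightarrow> complex)"
  by (auto simp: fun_eq_iff)

lemma bounded_operator_nrm':
  assumes T: "bounded_op T" shows "bounded_operator V nrm' T"
  unfolding bounded_operator_def
proof (intro conjI ballI allI)
  show "T h \<in> V" if "h \<in> V" for h using T that by simp
  show "nrm' (\<lambda>x. T (\<lambda>y. a * h y + b * k y) x - (a * T h x + b * T k x)) = 0" if "h \<in> V" "k \<in> V" for h k a b
    using nrm'_zero[OF op_lin[OF T that, of a b]] unfolding lambda_eqs .
  obtain C where C: "C > 0" "\<And>h. h \<in> V \<Longrightarrow> nrm (T h) \<le> C * nrm h" using op_bound[OF T] by blast
  have "nrm' (T h) \<le> (A * C * A) * nrm' h" if h: "h \<in> V" for h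
  proof -
    have "nrm' (T h) \<le> A * nrm (T h)" using le_nrm T h by simp
    also have "\<dots> \<le> A * (C * nrm h)" using C(2)[OF h] A by (intro mult_left_mono) auto
    also have "\<dots> \<le> A * (C * (A * nrm' h))" using nrm_le[OF h] A C(1) by (intro mult_left_mono) auto
    finally show ?thesis by (simp add: mult_ac)
  qed
  then show "\<exists>C. \<forall>h\<in>V. nrm' (T h) \<le> C * nrm' h" by blast
qed

lemma shifted_eq: "shifted z T = (\<lambda>h. cscale z h - T h)"
  by (simp add: shifted_def fun_eq_iff)

lemma not_in_spectrumI:
  assumes "invertible (\<lambda>h. cscale z h - T h)" shows "z \<notin> spectrum V nrm' T"
proof -
  define S where "S = shifted z T"
  obtain R where R: "bounded_op S" "bounded_op R" "\<forall>h\<in>V. R (S h) \<doteq> h" "\<forall>h\<in>V. S (R h) \<doteq> h"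
    using assms unfolding invertible_def shifted_eq[symmetric] S_def[symmetric] by blast
  have "nrm' (\<lambda>x. R (S h) x - h x) = 0" "nrm' (\<lambda>x. S (R h) x - h x) = 0" if "h \<in> V" for h
    using nrm'_zero[OF R(3)[rule_format, OF that]] nrm'_zero[OF R(4)[rule_format, OF that]]
    by (simp_all only: lambda_eqs(2))
  then have "bounded_operator V nrm' S \<and> (\<exists>R. bounded_operator V nrm' R \<and>
      (\<forall>h\<in>V. nrm' (\<lambda>x. R (S h) x - h x) = 0) \<and> (\<forall>h\<in>V. nrm' (\<lambda>x. S (R h) x - h x) = 0))"
    by (intro conjI exI[of _ R] ballI bounded_operator_nrm' R(1,2))
  then show ?thesis unfolding spectrum_def S_def mem_Collect_eq by (rule contrapos_pn) simp
qed

lemma closed_range_nrm':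
  assumes T: "bounded_op T" and cl: "closed_sub {g. \<exists>h\<in>V. cscale z h - T h \<doteq> g}"
  shows "closed_range V nrm' (shifted z T)"
  unfolding closed_range_def shifted_eq
proof (intro allI impI)
  fix u :: "nat \<Rightarrow> 'a \<Rightarrow> complex" and g
  assume *: "(\<forall>n. u n \<in> V) \<and> g \<in> V \<and> (\<lambda>n. nrm' (\<lambda>x. (cscale z (u n) - T (u n)) x - g x)) \<longlonglongrightarrow> 0"
  define v where "v n = cscale z (u n) - T (u n)" for n
  have vV: "v n \<in> V" for n unfolding v_def using * T by auto
  have v: "v n \<in> {g. \<exists>h\<in>V. cscale z h - T h \<doteq> g}" for n
    unfolding mem_Collect_eq
    by (rule bexI[of _ "u n"]) (use * vV[of n] in \<open>auto simp: v_def[symmetric]\<close>)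
  have lim: "(\<lambda>n. nrm' (v n - g)) \<longlonglongrightarrow> 0" using * by (simp add: v_def fun_diff_def)
  have "(\<lambda>n. A * nrm' (v n - g)) \<longlonglongrightarrow> A * 0" by (intro tendsto_mult lim tendsto_const)
  then have lim': "(\<lambda>n. A * nrm' (v n - g)) \<longlonglongrightarrow> 0" by simp
  have gV: "g \<in> V" using * by blast
  have "(\<lambda>n. nrm (v n - g)) \<longlonglongrightarrow> 0"
  proof (rule tendsto_sandwich[OF always_eventually always_eventually tendsto_const lim'])
    show "\<forall>n. 0 \<le> nrm (v n - g)" using vV gV by auto
    show "\<forall>n. nrm (v n - g) \<le> A * nrm' (v n - g)" using vV gV by (auto intro: nrm_le)
  qed
  from closed_sub_limit[OF cl v gV this] obtain h where h: "h \<in> V" "cscale z h - T h \<doteq> g" by blast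
  have "nrm' (\<lambda>x. (cscale z h - T h) x - g x) = 0" using nrm'_zero[OF h(2)] by (simp add: fun_diff_def)
  then show "\<exists>h\<in>V. nrm' (\<lambda>x. (cscale z h - T h) x - g x) = 0" using h(1) by blast
qed

lemma finite_generalized_kernel_nrm':
  assumes S: "bounded_op S" and B: "finite B" "B \<subseteq> V" "\<And>h n. h \<in> V \<Longrightarrow> (S ^^ n) h \<doteq> 0 \<Longrightarrow> h \<in> adjoin null B"
  shows "finite_generalized_kernel V nrm' S"
  unfolding finite_generalized_kernel_def
proof (intro exI[of _ B] conjI B(1,2) ballI impI)
  fix h assume h: "h \<in> V" "\<exists>n. nrm' ((S ^^ n) h) = 0"
  then obtain n where "nrm' ((S ^^ n) h) = 0" by blast
  then have "(S ^^ n) h \<doteq> 0" using nrm'_zeroD[of "(S ^^ n) h" 0] funpow_in[OF S h(1)] by simp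
  then have "h \<in> adjoin null B" using B(3) h by blast
  then obtain s where s: "s \<in> span B" "h - s \<doteq> 0" by (auto simp: adjoin_def null_def)
  from s(1) obtain c where c: "s = (\<Sum>b\<in>B. cscale (c b) b)" using span_finite[OF B(1)] by auto
  have "h \<doteq> s"
    using s(2) h(1) span_minimal[OF B(2) subspace_V] s(1) by (subst eqv_diff_zero[symmetric]) auto
  then have "nrm' (h - s) = 0" by (rule nrm'_zero)
  moreover have "(\<lambda>x. h x - (\<Sum>b\<in>B. c b * b x)) = h - s" by (auto simp: c fun_eq_iff sum_fun_apply)
  ultimately show "\<exists>c. nrm' (\<lambda>x. h x - (\<Sum>b\<in>B. c b * b x)) = 0"
    by (intro exI[of _ c]) (simp only:)
qed

theorem essential_spectrum_bound:
  assumes T: "bounded_op T" and \<rho>: "0 \<le> \<rho>" and ess: "\<And>c. c > \<rho> \<Longrightarrow> ess_bounded c T"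
  shows "essential_spectrum V nrm' T \<subseteq> {z. norm z \<le> \<rho>}"
proof
  fix z assume z: "z \<in> essential_spectrum V nrm' T"
  show "z \<in> {z. norm z \<le> \<rho>}"
  proof (rule ccontr)
    assume "z \<notin> {z. norm z \<le> \<rho>}"
    then obtain c where c: "\<rho> < c" "c < norm z" using dense[of \<rho> "norm z"] by auto
    then have c0: "0 \<le> c" using \<rho> by simp
    note * = T ess[OF c(1)] c0 c(2)
    have "\<not> z islimpt spectrum V nrm' T"
      using ess_bounded_isolated[OF *] islimpt_subset[of z "spectrum V nrm' T" "{z. \<not> invertible (\<lambda>h. cscale z h - T h)}"]
        not_in_spectrumI by blast
    moreover have "closed_range V nrm' (shifted z T)"
      by (rule closed_range_nrm'[OF T ess_bounded_closed_range[OF *]])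
    moreover have "finite_generalized_kernel V nrm' (shifted z T)"
    proof -
      obtain B where "finite B" "B \<subseteq> V" "\<forall>h\<in>V. (\<exists>n. ((\<lambda>h. cscale z h - T h) ^^ n) h \<doteq> 0) \<longrightarrow> h \<in> adjoin null B"
        using ess_bounded_finite_generalized_kernel[OF *] by blast
      then show ?thesis unfolding shifted_eq
        by (intro finite_generalized_kernel_nrm'[OF op_shift[OF T], of B]) blast+
    qed
    ultimately show False using z by (simp add: essential_spectrum_def)
  qed
qed

theorem spectrum_eigenvector:
  assumes T: "bounded_op T" and ess: "ess_bounded c T" and c: "0 \<le> c" "c < norm z"
    and z: "z \<in> spectrum V nrm' T"
  obtains h where "h \<in> V" "nrm h \<noteq> 0" "cscale z h - T h \<doteq> 0"
  using not_invertible_eigenvector[OF T ess c] not_in_spectrumI z by blast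

end

section \<open>Test functions\<close>

lemma C_k_on_0: "C_k_on 0 f UNIV \<longleftrightarrow> continuous_on UNIV f"
proof -
  have "D = f" if "\<forall>x. D x = f x" for D using that by auto
  then show ?thesis unfolding C_k_on_def by (auto intro!: exI[of _ "\<lambda>_. f"])
qed

lemma C_k_on_Suc:
  "C_k_on (Suc n) f UNIV \<longleftrightarrow> (\<exists>f'. (\<forall>x. (f has_real_derivative f' x) (at x)) \<and> C_k_on n f' UNIV)"
proof
  assume "C_k_on (Suc n) f UNIV"
  then obtain D :: "nat \<Rightarrow> real \<Rightarrow> real" where D: "\<forall>x. D 0 x = f x" "\<forall>k<Suc n. \<forall>x. (D k has_real_derivative D (Suc k) x) (at x)"
    "\<forall>k\<le>Suc n. continuous_on UNIV (D k)" unfolding C_k_on_def by auto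
  have "D 0 = f" using D(1) by auto
  then have "\<forall>x. (f has_real_derivative D 1 x) (at x)" using D(2) by auto
  moreover have "C_k_on n (D 1) UNIV"
    unfolding C_k_on_def using D by (intro exI[of _ "\<lambda>k. D (Suc k)"]) auto
  ultimately show "\<exists>f'. (\<forall>x. (f has_real_derivative f' x) (at x)) \<and> C_k_on n f' UNIV" by blast
next
  assume "\<exists>f'. (\<forall>x. (f has_real_derivative f' x) (at x)) \<and> C_k_on n f' UNIV"
  then obtain f' D where f': "\<forall>x. (f has_real_derivative f' x) (at x)"
    and D: "\<forall>x. D 0 x = f' x" "\<forall>k<n. \<forall>x. (D k has_real_derivative D (Suc k) x) (at x)"
    "\<forall>k\<le>n. continuous_on UNIV (D k)" unfolding C_k_on_def by auto
  have "continuous_on UNIV f" using f' by (intro DERIV_continuous_on[where D = f']) auto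
  then show "C_k_on (Suc n) f UNIV"
    unfolding C_k_on_def
  proof (intro exI[of _ "\<lambda>k. case k of 0 \<Rightarrow> f | Suc j \<Rightarrow> D j"] conjI ballI allI impI)
    fix k x assume "k < Suc n"
    then show "((case k of 0 \<Rightarrow> f | Suc j \<Rightarrow> D j) has_real_derivative
        (case Suc k of 0 \<Rightarrow> f | Suc j \<Rightarrow> D j) x) (at x)"
      using f' D by (cases k) auto
  next
    fix k assume "k \<le> Suc n"
    then show "continuous_on UNIV (case k of 0 \<Rightarrow> f | Suc j \<Rightarrow> D j)"
      using D \<open>continuous_on UNIV f\<close> by (cases k) auto
  qed simp
qed

lemma C_k_on_decrease: "C_k_on (Suc n) f S \<Longrightarrow> C_k_on n f S"
  unfolding C_k_on_def by (erule exE, rule exI, erule conjE, intro conjI) auto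

lemma C_k_on_const: "C_k_on n (\<lambda>x. c) UNIV"
  by (induction n arbitrary: c) (auto simp: C_k_on_0 C_k_on_Suc intro!: exI[of _ "\<lambda>_. 0"])

lemma C_k_on_add: "C_k_on n f UNIV \<Longrightarrow> C_k_on n g UNIV \<Longrightarrow> C_k_on n (\<lambda>x. f x + g x) UNIV"
proof (induction n arbitrary: f g)
  case 0 then show ?case by (auto simp: C_k_on_0 intro: continuous_on_add)
next
  case (Suc n)
  then obtain f' g' where "\<forall>x. (f has_real_derivative f' x) (at x)" "C_k_on n f' UNIV"
    "\<forall>x. (g has_real_derivative g' x) (at x)" "C_k_on n g' UNIV" by (auto simp: C_k_on_Suc)
  then show ?case using Suc.IH unfolding C_k_on_Suc
    by (intro exI[of _ "\<lambda>x. f' x + g' x"]) (auto intro: DERIV_add)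
qed

lemma C_k_on_mult: "C_k_on n f UNIV \<Longrightarrow> C_k_on n g UNIV \<Longrightarrow> C_k_on n (\<lambda>x. f x * g x) UNIV"
proof (induction n arbitrary: f g)
  case 0 then show ?case by (auto simp: C_k_on_0 intro: continuous_on_mult)
next
  case (Suc n)
  then obtain f' g' where *: "\<forall>x. (f has_real_derivative f' x) (at x)" "C_k_on n f' UNIV"
    "\<forall>x. (g has_real_derivative g' x) (at x)" "C_k_on n g' UNIV" by (auto simp: C_k_on_Suc)
  have "C_k_on n (\<lambda>x. f' x * g x + g' x * f x) UNIV"
    using Suc * by (intro C_k_on_add Suc.IH) (auto intro: C_k_on_decrease)
  then show ?case using * unfolding C_k_on_Suc
    by (intro exI[of _ "\<lambda>x. f' x * g x + g' x * f x"]) (auto intro: DERIV_mult)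
qed

lemma C_k_on_affine: "C_k_on n f UNIV \<Longrightarrow> C_k_on n (\<lambda>x. f (a * x + b)) UNIV"
proof (induction n arbitrary: f)
  case 0
  then show ?case by (auto simp: C_k_on_0 intro!: continuous_intros continuous_on_compose2[of UNIV f])
next
  case (Suc n)
  then obtain f' where *: "\<forall>x. (f has_real_derivative f' x) (at x)" "C_k_on n f' UNIV" by (auto simp: C_k_on_Suc)
  have "((\<lambda>x. f (a * x + b)) has_real_derivative f' (a * x + b) * a) (at x)" for x
    by (rule DERIV_chain2[OF *(1)[rule_format]]) (auto intro!: derivative_eq_intros)
  moreover have "C_k_on n (\<lambda>x. f' (a * x + b) * a) UNIV"
    using Suc.IH[OF *(2)] by (intro C_k_on_mult C_k_on_const)
  ultimately show ?case unfolding C_k_on_Suc by (intro exI[of _ "\<lambda>x. f' (a * x + b) * a"]) simp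
qed

text \<open>
  For \<open>p = 1\<close> this is the classical smooth function that vanishes for negative arguments.  The
  polynomial factor makes the family closed under differentiation.
\<close>
definition flat :: "real poly \<Rightarrow> real \<Rightarrow> real" where
  "flat p x = (if 0 < x then poly p (1 / x) * exp (- (1 / x)) else 0)"

lemma poly_exp_tendsto_0: "((\<lambda>t. poly p t * exp (- t)) \<longlongrightarrow> (0::real)) at_top"
proof -
  have "((\<lambda>t. \<Sum>i\<le>degree p. coeff p i * (t ^ i / exp t)) \<longlongrightarrow> (\<Sum>i\<le>degree p. coeff p i * 0)) at_top"
    by (intro tendsto_sum tendsto_mult tendsto_const tendsto_power_div_exp_0)
  moreover have "(\<Sum>i\<le>degree p. coeff p i * (t ^ i / exp t)) = poly p t * exp (- t)" for t
    by (simp add: poly_altdef sum_distrib_right exp_minus divide_inverse mult.assoc)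
  ultimately show ?thesis by simp
qed

lemma flat_has_derivative:
  "(flat p has_real_derivative flat ([:0, 0, 1:] * (p - pderiv p)) x) (at x)"
proof (cases x "0::real" rule: linorder_cases)
  case greater
  have "((\<lambda>x. poly p (1 / x) * exp (- (1 / x))) has_real_derivative
      flat ([:0, 0, 1:] * (p - pderiv p)) x) (at x)"
    using greater
    by (auto intro!: derivative_eq_intros DERIV_chain2[OF poly_DERIV] simp: flat_def field_simps power2_eq_square)
  then show ?thesis
    by (rule has_field_derivative_transform_within_open[of _ _ _ "{0<..}"]) (use greater in \<open>auto simp: flat_def\<close>)
next
  case less
  have "((\<lambda>x. 0) has_real_derivative flat ([:0, 0, 1:] * (p - pderiv p)) x) (at x)"
    using less by (simp add: flat_def)
  then show ?thesis
    by (rule has_field_derivative_transform_within_open[of _ _ _ "{..<0}"]) (use less in \<open>auto simp: flat_def\<close>)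
next
  case equal
  have "((\<lambda>h. flat p h / h) \<longlongrightarrow> 0) (at_right 0)"
  proof -
    have "((\<lambda>h. poly ([:0, 1:] * p) (inverse h) * exp (- inverse h)) \<longlongrightarrow> 0) (at_right (0::real))"
      by (rule filterlim_compose[OF poly_exp_tendsto_0 filterlim_inverse_at_top_right])
    then show ?thesis
      by (rule Lim_transform_eventually)
        (auto simp: flat_def eventually_at_right_less field_simps intro: eventually_mono[OF eventually_at_right_less])
  qed
  moreover have "((\<lambda>h. flat p h / h) \<longlongrightarrow> 0) (at_left 0)"
    by (rule Lim_transform_eventually[OF tendsto_const])
      (auto simp: flat_def eventually_at_filter)
  ultimately have "((\<lambda>h. flat p h / h) \<longlongrightarrow> 0) (at 0)" by (simp add: filterlim_at_split)
  then show ?thesis using equal by (simp add: DERIV_def flat_def)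
qed

lemma flat_smooth: "C_k_on n (flat p) UNIV"
proof (induction n arbitrary: p)
  case 0
  show ?case unfolding C_k_on_0 by (rule DERIV_continuous_on) (auto intro: has_field_derivative_at_within flat_has_derivative)
next
  case (Suc n)
  then show ?case unfolding C_k_on_Suc using flat_has_derivative by blast
qed

text \<open>
  As \<open>c\<close> tends to infinity, the bumps converge pointwise to the indicator function of \<open>{a<..<b}\<close>.
\<close>
definition bump :: "real \<Rightarrow> real \<Rightarrow> real \<Rightarrow> real \<Rightarrow> real" where
  "bump c a b x = flat 1 (c * (x - a)) * flat 1 (c * (b - x))"

lemma bump_test_function:
  assumes "0 < a" "b < 1" "0 < c" shows "test_function (bump c a b)"
proof -
  have "C_k_on n (\<lambda>x. flat 1 (c * x + (- c * a)) * flat 1 ((- c) * x + c * b)) UNIV" for n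
    by (intro C_k_on_mult C_k_on_affine flat_smooth)
  moreover have "bump c a b = (\<lambda>x. flat 1 (c * x + (- c * a)) * flat 1 ((- c) * x + c * b))"
    by (simp add: bump_def fun_eq_iff algebra_simps)
  ultimately have "\<forall>n. C_k_on n (bump c a b) UNIV" by simp
  moreover have "\<forall>x. x \<notin> {a..b} \<longrightarrow> bump c a b x = 0"
    using assms by (auto simp: bump_def flat_def zero_less_mult_iff)
  ultimately show ?thesis using assms unfolding test_function_def by blast
qed

lemma bump_range: "0 \<le> bump c a b x" "bump c a b x \<le> 1"
proof -
  have "0 \<le> flat 1 t" "flat 1 t \<le> 1" for t by (auto simp: flat_def)
  then show "0 \<le> bump c a b x" "bump c a b x \<le> 1" unfolding bump_def by (auto intro: mult_le_one)
qed

lemma bump_pos: "0 < c \<Longrightarrow> a < x \<Longrightarrow> x < b \<Longrightarrow> 0 < bump c a b x"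
  by (simp add: bump_def flat_def)

lemma test_function_derivative:
  assumes "test_function \<phi>"
  shows "(\<phi> has_real_derivative deriv \<phi> x) (at x)" "continuous_on UNIV (deriv \<phi>)" "continuous_on UNIV \<phi>"
proof -
  have "C_k_on (Suc 0) \<phi> UNIV" "C_k_on 0 \<phi> UNIV" using assms unfolding test_function_def by blast+
  then obtain f' where f': "\<And>x. (\<phi> has_real_derivative f' x) (at x)" "continuous_on UNIV f'" "continuous_on UNIV \<phi>"
    by (auto simp: C_k_on_Suc C_k_on_0)
  have "deriv \<phi> = f'" using f'(1) by (auto intro: DERIV_imp_deriv)
  then show "(\<phi> has_real_derivative deriv \<phi> x) (at x)" "continuous_on UNIV (deriv \<phi>)" "continuous_on UNIV \<phi>"
    using f' by auto
qed

lemma test_function_boundary: assumes "test_function \<phi>" shows "x \<le> 0 \<or> 1 \<le> x \<Longrightarrow> \<phi> x = 0"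
  using assms unfolding test_function_def by force

lemma test_function_linear:
  assumes "test_function \<phi>" "test_function \<psi>" shows "test_function (\<lambda>x. \<phi> x + c * \<psi> x)"
proof -
  obtain a b a' b' where "0 < a" "b < 1" "\<forall>x. x \<notin> {a..b} \<longrightarrow> \<phi> x = 0"
    "0 < a'" "b' < 1" "\<forall>x. x \<notin> {a'..b'} \<longrightarrow> \<psi> x = 0" using assms unfolding test_function_def by blast
  then have "0 < min a a' \<and> max b b' < 1 \<and> (\<forall>x. x \<notin> {min a a'..max b b'} \<longrightarrow> \<phi> x + c * \<psi> x = 0)"
    by (simp add: min_le_iff_disj le_max_iff_disj)
  moreover have "C_k_on n (\<lambda>x. \<phi> x + c * \<psi> x) UNIV" for n
    using assms unfolding test_function_def by (intro C_k_on_add C_k_on_mult C_k_on_const) auto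
  ultimately show ?thesis unfolding test_function_def by blast
qed

lemma test_function_primitive:
  assumes \<theta>: "test_function \<theta>" and int: "integral {0..1} \<theta> = 0"
  shows "\<exists>\<phi>. test_function \<phi> \<and> deriv \<phi> = \<theta>"
proof -
  obtain a b where ab: "0 < a" "b < 1" "\<And>x. x \<notin> {a..b} \<Longrightarrow> \<theta> x = 0" and sm: "\<And>n. C_k_on n \<theta> UNIV"
    using \<theta> unfolding test_function_def by blast
  have cont: "continuous_on S \<theta>" for S using test_function_derivative(3)[OF \<theta>] continuous_on_subset by blast
  define \<phi> where "\<phi> x = integral {0..x} \<theta>" for x
  have left: "\<phi> x = 0" if "x < a" for x
  proof -
    have "integral {0..x} \<theta> = integral {0..x} (\<lambda>_. 0)" using ab(3) that by (intro integral_cong) auto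
    then show ?thesis by (simp add: \<phi>_def)
  qed
  have right: "\<phi> x = 0" if "b < x" "0 \<le> x" for x
  proof -
    have "(\<theta> has_integral integral {a..b} \<theta>) {a..b}" by (intro integrable_integral integrable_continuous_interval cont)
    then have "(\<theta> has_integral integral {a..b} \<theta>) {0..x}" "(\<theta> has_integral integral {a..b} \<theta>) {0..1}"
      by (rule has_integral_on_superset; use ab that in force)+
    then show ?thesis using int by (simp add: \<phi>_def integral_unique)
  qed
  have D: "(\<phi> has_real_derivative \<theta> x) (at x)" for x
  proof (cases "0 < x")
    case True
    have "((\<lambda>u. integral {0..u} \<theta>) has_real_derivative \<theta> x) (at x within {0..x+1})"
      using True by (intro integral_has_real_derivative cont) auto
    moreover have "at x within {0..x+1} = at x" using True by (intro at_within_interior) auto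
    ultimately show ?thesis by (simp add: \<phi>_def[abs_def])
  next
    case False
    then have "\<theta> x = 0" using ab by auto
    then have "((\<lambda>_. 0) has_real_derivative \<theta> x) (at x)" by simp
    then show ?thesis
      by (rule has_field_derivative_transform_within_open[of _ _ _ "{..<a}"]) (use False ab left in auto)
  qed
  have "C_k_on n \<phi> UNIV" for n
  proof -
    have "C_k_on (Suc n) \<phi> UNIV" unfolding C_k_on_Suc using D sm by blast
    then show ?thesis by (rule C_k_on_decrease)
  qed
  moreover have "\<phi> x = 0" if "x \<notin> {a..b}" for x using left[of x] right[of x] that ab by force
  ultimately have "test_function \<phi>" using ab unfolding test_function_def by blast
  moreover have "deriv \<phi> = \<theta>" using D by (auto intro: DERIV_imp_deriv)
  ultimately show ?thesis by blast
qed

section \<open>The fundamental lemma of the calculus of variations\<close>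

abbreviation \<mu> :: "real measure" where "\<mu> \<equiv> lebesgue_on {0..1}"

lemma sigma_finite_lebesgue: "sigma_finite_measure (lebesgue :: real measure)"
proof -
  obtain A :: "real set set" where A: "countable A" "A \<subseteq> sets lborel" "\<Union>A = space lborel"
    "\<forall>a\<in>A. emeasure lborel a \<noteq> \<infinity>"
    using lborel.sigma_finite_countable by blast
  then show ?thesis
    by (intro sigma_finite_measure.intro exI[of _ A]) (auto simp: subset_eq)
qed

lemma borel_measurable_unit: "f \<in> borel_measurable borel \<Longrightarrow> f \<in> borel_measurable \<mu>"
  by (intro measurable_restrict_space1 measurable_completion) simp

text \<open>
  Open intervals generate the Borel sets and are stable under intersection, so the integral
  vanishes over every Borel set, hence over every Lebesgue measurable set.
\<close>
lemma AE_zero_if_interval_integrals_zero: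
  fixes u :: "real \<Rightarrow> 'a::{banach, second_countable_topology}"
  assumes u: "integrable lebesgue u"
    and zero: "\<And>a b. a < b \<Longrightarrow> (LINT x:{a<..<b}|lebesgue. u x) = 0"
  shows "AE x in lebesgue. u x = 0"
proof (rule sigma_finite_measure.density_zero[OF sigma_finite_lebesgue u])
  have int: "set_integrable lebesgue A u" if "A \<in> sets lebesgue" for A
    using integrable_mult_indicator[OF that u] by (simp add: set_integrable_def)
  have UN: "(LINT x:(\<Union>i. A i)|lebesgue. u x) = 0"
    if "\<And>i::nat. A i \<in> sets lebesgue" "\<And>i j. i \<noteq> j \<Longrightarrow> A i \<inter> A j = {}"
      "\<And>i. (LINT x:A i|lebesgue. u x) = 0" for A
    using lebesgue_integral_countable_add[of A lebesgue u, OF that(1,2) int] that by auto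
  have total: "(LINT x:UNIV|lebesgue. u x) = 0"
  proof -
    have "(\<lambda>n. LINT x:{- real n<..<real n}|lebesgue. u x) \<longlonglongrightarrow> (LINT x:(\<Union>n. {- real n<..<real n})|lebesgue. u x)"
      by (rule set_integral_cont_up) (auto simp: incseq_def intro: int)
    moreover have "(\<Union>n. {- real n<..<real n}) = UNIV"
    proof -
      have "\<exists>n. - real n < x \<and> x < real n" for x
      proof -
        obtain n where "\<bar>x\<bar> < real n" using reals_Archimedean2 by blast
        then show ?thesis by (intro exI[of _ n]) linarith
      qed
      then show ?thesis by auto
    qed
    moreover have "(LINT x:{- real n<..<real n}|lebesgue. u x) = 0" for n
      by (cases "n = 0") (simp add: set_lebesgue_integral_def, simp add: zero)
    ultimately show ?thesis using LIMSEQ_unique[OF tendsto_const, of 0] by auto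
  qed
  have box: "borel = sigma UNIV (range (\<lambda>(a, b). {a<..<b :: real}))"
  proof -
    have "(\<lambda>(a, b). box a b) = (\<lambda>(a, b). {a<..<b :: real})" by (auto simp: fun_eq_iff)
    then show ?thesis using borel_eq_box[where 'a = real] by simp
  qed
  have borel: "(LINT x:A|lebesgue. u x) = 0" if "A \<in> sets borel" for A
  proof -
    have stable: "Int_stable (range (\<lambda>(a, b). {a<..<b :: real}))"
      unfolding Int_stable_def
    proof safe
      fix a b c d :: real
      have "{a<..<b} \<inter> {c<..<d} = {max a c<..<min b d}" by auto
      then show "{a<..<b} \<inter> {c<..<d} \<in> range (\<lambda>(a, b). {a<..<b})" by (auto simp: image_iff)
    qed
    moreover have "range (\<lambda>(a, b). {a<..<b :: real}) \<subseteq> Pow UNIV" by simp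
    moreover have "A \<in> sigma_sets UNIV (range (\<lambda>(a, b). {a<..<b :: real}))"
      using that unfolding box by simp
    ultimately show ?thesis
    proof (induction A rule: sigma_sets_induct_disjoint)
      case (basic A)
      then obtain a b where "A = {a<..<b}" by auto
      then show ?case using zero[of a b] by (cases "a < b") (simp, simp add: set_lebesgue_integral_def)
    next
      case empty show ?case by (simp add: set_lebesgue_integral_def)
    next
      case (compl A)
      then have A: "A \<in> sets lebesgue" by (simp add: box)
      have "(LINT x:A \<union> (UNIV - A)|lebesgue. u x) = (LINT x:A|lebesgue. u x) + (LINT x:UNIV - A|lebesgue. u x)"
        using A by (intro set_integral_Un int) auto
      moreover have "A \<union> (UNIV - A) = UNIV" by auto
      ultimately show ?case using total compl by simp
    next
      case (union A)
      then have "A i \<in> sigma_sets UNIV (range (\<lambda>(a, b). {a<..<b}))" for i by blast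
      then have "A i \<in> sets lebesgue" for i by (simp add: box)
      then show ?case using union by (intro UN) (auto simp: disjoint_family_on_def)
    qed
  qed
  fix A :: "real set" assume "A \<in> sets lebesgue"
  then obtain S N N' where A: "A = S \<union> N" "N \<subseteq> N'" "N' \<in> null_sets lborel" "S \<in> sets lborel"
    by (rule sets_completionE)
  have N: "N \<in> null_sets lebesgue" by (rule null_sets_completion_subset[OF A(2) null_sets_completionI[OF A(3)]])
  have "(LINT x:A|lebesgue. u x) = (LINT x:S|lebesgue. u x)"
  proof (rule set_integral_null_delta[OF u \<open>A \<in> sets lebesgue\<close>])
    show S: "S \<in> sets lebesgue" using A(4) by simp
    have "A - S \<union> (S - A) \<subseteq> N" using A(1) by auto
    then show "A - S \<union> (S - A) \<in> null_sets lebesgue"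
      using S \<open>A \<in> sets lebesgue\<close> by (intro null_sets_subset[OF N] sets.Un sets.Diff)
  qed
  then show "(LINT x:A|lebesgue. u x) = 0" using borel A(4) by simp
qed

lemma integral_unit: "(LINT x|\<mu>. h x) = (LINT x|lebesgue. indicator {0..1} x *\<^sub>R h x)"
  for h :: "real \<Rightarrow> 'a::{banach, second_countable_topology}"
  by (simp add: integral_restrict_space)

lemma integrable_unit: "integrable \<mu> h \<longleftrightarrow> integrable lebesgue (\<lambda>x. indicator {0..1} x *\<^sub>R h x)"
  for h :: "real \<Rightarrow> 'a::{banach, second_countable_topology}"
  by (simp add: integrable_restrict_space)

lemma AE_unit: "(AE x in \<mu>. P x) \<longleftrightarrow> (AE x in lebesgue. x \<in> {0..1} \<longrightarrow> P x)"
  by (rule AE_restrict_space_iff) simp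

text \<open>
  Bumps converge boundedly to the indicator function of any interval inside \<open>{0..1}\<close>.
\<close>
lemma fundamental_lemma:
  fixes v :: "real \<Rightarrow> complex"
  assumes v: "integrable \<mu> v"
    and zero: "\<And>\<theta>. test_function \<theta> \<Longrightarrow> (LINT x|\<mu>. v x * of_real (\<theta> x)) = 0"
  shows "AE x in \<mu>. v x = 0"
proof -
  define u where "u x = indicator {0..1} x *\<^sub>R v x" for x
  have u: "integrable lebesgue u" using v by (simp add: integrable_unit u_def[abs_def])
  have "(LINT x:{a<..<b}|lebesgue. u x) = 0" for a b
  proof -
    define a' where "a' = max a 0"
    define b' where "b' = min b 1"
    \<comment> \<open>the margin \<open>1 / sqrt n\<close> keeps the support away from 0 and 1, yet \<open>n\<close> times it still tends to infinity\<close>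
    define \<theta> where "\<theta> n = bump (real (Suc n)) (a' + 1 / sqrt (real (Suc n))) (b' - 1 / sqrt (real (Suc n)))" for n
    have test: "test_function (\<theta> n)" for n
    proof -
      have "0 < 1 / sqrt (real (Suc n))" by simp
      then show ?thesis unfolding \<theta>_def a'_def b'_def by (intro bump_test_function) linarith+
    qed
    have inv: "(\<lambda>n. 1 / sqrt (real (Suc n))) \<longlonglongrightarrow> 0"
      by (intro tendsto_divide_0[OF tendsto_const] filterlim_at_top_imp_at_infinity filterlim_compose[OF sqrt_at_top] filterlim_compose[OF filterlim_real_sequentially] filterlim_Suc)
    have flat1: "(\<lambda>n. flat 1 (real (Suc n) * (c - 1 / sqrt (real (Suc n))))) \<longlonglongrightarrow> (if 0 < c then 1 else 0)" for c :: real
    proof (cases "0 < c")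
      case True
      have lim: "filterlim (\<lambda>n. real (Suc n) * (c - 1 / sqrt (real (Suc n)))) at_top sequentially"
        by (rule filterlim_at_top_mult_tendsto_pos[OF tendsto_diff[OF tendsto_const inv]])
          (use True in \<open>auto intro!: filterlim_compose[OF filterlim_real_sequentially] filterlim_Suc simp del: of_nat_Suc\<close>)
      have "((\<lambda>t::real. exp (- (1 / t))) \<longlongrightarrow> exp (- 0)) at_top"
        by (intro tendsto_intros tendsto_divide_0[OF tendsto_const] filterlim_at_top_imp_at_infinity filterlim_ident)
      then have "((\<lambda>t::real. exp (- (1 / t))) \<longlongrightarrow> 1) at_top" by simp
      then have "(flat 1 \<longlongrightarrow> 1) at_top"
        by (rule Lim_transform_eventually)
          (auto simp: flat_def intro: eventually_mono[OF eventually_gt_at_top[of 0]])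
      from filterlim_compose[OF this lim] show ?thesis using True by simp
    next
      case False
      have "c - 1 / sqrt (real (Suc n)) < 0" for n using False by (smt (verit) divide_pos_pos of_nat_0_less_iff real_sqrt_gt_zero zero_less_Suc)
      then have "real (Suc n) * (c - 1 / sqrt (real (Suc n))) \<le> 0" for n by (intro mult_nonneg_nonpos) (auto intro: less_imp_le)
      then have "flat 1 (real (Suc n) * (c - 1 / sqrt (real (Suc n)))) = 0" for n
        unfolding flat_def by (simp only: not_less[symmetric] if_False)
      then show ?thesis using False by simp
    qed
    have pt: "(\<lambda>n. \<theta> n x) \<longlonglongrightarrow> (if a' < x \<and> x < b' then 1 else 0)" for x
    proof -
      have "(\<lambda>n. flat 1 (real (Suc n) * (x - a' - 1 / sqrt (real (Suc n)))) *
          flat 1 (real (Suc n) * (b' - x - 1 / sqrt (real (Suc n))))) \<longlonglongrightarrow>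
          (if 0 < x - a' then 1 else 0) * (if 0 < b' - x then 1 else 0)"
        by (intro tendsto_mult flat1)
      then show ?thesis by (auto simp: \<theta>_def bump_def algebra_simps simp del: of_nat_Suc split: if_splits)
    qed
    have "(\<lambda>n. LINT x|\<mu>. v x * of_real (\<theta> n x)) \<longlonglongrightarrow> (LINT x|\<mu>. v x * of_real (if a' < x \<and> x < b' then 1 else 0))"
    proof (rule integral_dominated_convergence[where w = "\<lambda>x. norm (v x)"])
      have "\<theta> n \<in> borel_measurable \<mu>" for n
        using test_function_derivative(3)[OF test[of n]]
        by (intro continuous_imp_measurable_on_sets_lebesgue) (auto intro: continuous_on_subset)
      then show "(\<lambda>x. v x * of_real (\<theta> n x)) \<in> borel_measurable \<mu>" for n
        using v by (intro borel_measurable_times borel_measurable_of_real) auto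
      have "(\<lambda>x. complex_of_real (if a' < x \<and> x < b' then 1 else 0)) \<in> borel_measurable \<mu>"
        by (intro borel_measurable_unit) measurable
      then show "(\<lambda>x. v x * of_real (if a' < x \<and> x < b' then 1 else 0)) \<in> borel_measurable \<mu>"
        using v by (intro borel_measurable_times) auto
      show "AE x in \<mu>. (\<lambda>n. v x * of_real (\<theta> n x)) \<longlonglongrightarrow> v x * of_real (if a' < x \<and> x < b' then 1 else 0)"
        by (intro AE_I2 tendsto_mult tendsto_const tendsto_of_real pt)
      show "AE x in \<mu>. norm (v x * of_real (\<theta> n x)) \<le> norm (v x)" for n
        using bump_range by (intro AE_I2) (auto simp: norm_mult \<theta>_def intro!: mult_left_le)
    qed (use v in auto)
    then have "(LINT x|\<mu>. v x * of_real (if a' < x \<and> x < b' then 1 else 0)) = 0"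
      using LIMSEQ_unique[OF tendsto_const, of 0] by (simp add: zero[OF test])
    also have "(LINT x|\<mu>. v x * of_real (if a' < x \<and> x < b' then 1 else 0)) = (LINT x|lebesgue. indicator {a'<..<b'} x *\<^sub>R u x)"
      unfolding integral_unit by (rule Bochner_Integration.integral_cong) (auto simp: u_def indicator_def)
    also have "\<dots> = (LINT x:{a<..<b}|lebesgue. u x)"
      unfolding set_lebesgue_integral_def
    proof (rule integral_cong_AE)
      have "AE x in lebesgue. x \<notin> {0, 1::real}"
        by (rule AE_not_in) (auto intro!: null_sets_completionI)
      then show "AE x in lebesgue. indicator {a'<..<b'} x *\<^sub>R u x = indicator {a<..<b} x *\<^sub>R u x"
        by eventually_elim (auto simp: a'_def b'_def u_def indicator_def)
    qed (auto intro!: borel_measurable_integrable integrable_mult_indicator u)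
    finally show ?thesis by simp
  qed
  then have "AE x in lebesgue. u x = 0" by (rule AE_zero_if_interval_integrals_zero[OF u])
  then show ?thesis unfolding AE_unit by eventually_elim (auto simp: u_def)
qed

section \<open>Primitives of integrable functions\<close>

interpretation unit: finite_measure \<mu>
  by (rule finite_measure_lebesgue_on) auto

interpretation unit_pair: pair_sigma_finite \<mu> \<mu> ..

definition primitive :: "(real \<Rightarrow> complex) \<Rightarrow> real \<Rightarrow> complex" where
  "primitive g x = (LINT t|\<mu>. indicator {..x} t *\<^sub>R g t)"

definition centred_primitive :: "(real \<Rightarrow> complex) \<Rightarrow> real \<Rightarrow> complex" where
  "centred_primitive g x = primitive g x - (LINT y|\<mu>. primitive g y)"

lemma measure_unit [simp]: "measure \<mu> {0..1} = 1"
  by (simp add: measure_restrict_space)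

lemma integrable_bounded_mult:
  fixes g :: "real \<Rightarrow> complex" and w :: "real \<Rightarrow> real"
  assumes g: "integrable \<mu> g" and w: "w \<in> borel_measurable \<mu>" "\<And>x. x \<in> {0..1} \<Longrightarrow> \<bar>w x\<bar> \<le> B"
  shows "integrable \<mu> (\<lambda>x. g x * of_real (w x))"
proof (rule Bochner_Integration.integrable_bound[where f = "\<lambda>x. B * norm (g x)"])
  show "integrable \<mu> (\<lambda>x. B * norm (g x))" using g by simp
  show "(\<lambda>x. g x * of_real (w x)) \<in> borel_measurable \<mu>"
    using w(1) g by (intro borel_measurable_times borel_measurable_of_real) auto
  have "norm (g x * of_real (w x)) \<le> norm (B * norm (g x))" if "x \<in> {0..1}" for x
  proof -
    have "norm (g x) * \<bar>w x\<bar> \<le> norm (g x) * B" using w(2)[OF that] by (intro mult_left_mono) auto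
    then show ?thesis by (simp add: norm_mult mult.commute)
  qed
  then show "AE x in \<mu>. norm (g x * of_real (w x)) \<le> norm (B * norm (g x))" by (intro AE_I2) simp
qed

lemma measurable_pair_indicator:
  "(indicator {(x, t). t \<le> x} :: real \<times> real \<Rightarrow> real) \<in> borel_measurable (\<mu> \<Otimes>\<^sub>M \<mu>)"
proof -
  have 1: "(\<lambda>x. x) \<in> borel_measurable \<mu>" by (rule borel_measurable_unit) simp
  have "{p \<in> space (\<mu> \<Otimes>\<^sub>M \<mu>). snd p \<le> fst p} \<in> sets (\<mu> \<Otimes>\<^sub>M \<mu>)"
    by (intro borel_measurable_le measurable_compose[OF measurable_fst 1] measurable_compose[OF measurable_snd 1])
  then have "{p \<in> space (\<mu> \<Otimes>\<^sub>M \<mu>). p \<in> {(x, t). t \<le> x}} \<in> sets (\<mu> \<Otimes>\<^sub>M \<mu>)"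
    by (simp add: case_prod_beta')
  from borel_measurable_indicator'[of "\<mu> \<Otimes>\<^sub>M \<mu>" "\<lambda>x. x" "\<lambda>_. {(x, t). t \<le> x}", OF this]
  show ?thesis .
qed

lemma primitive_integrand:
  fixes g :: "real \<Rightarrow> complex"
  assumes "integrable \<mu> g" shows "integrable \<mu> (\<lambda>t. indicator {..x} t *\<^sub>R g t)"
proof -
  have "{..x} \<inter> {0..1} \<in> sets \<mu>" by (auto simp: sets_restrict_space)
  from integrable_mult_indicator[OF this assms]
  show ?thesis by (rule Bochner_Integration.integrable_cong[THEN iffD1, rotated -1]) (auto simp: indicator_def)
qed

lemma primitive_diff:
  assumes g: "integrable \<mu> g" and "x \<le> y"
  shows "norm (primitive g y - primitive g x) \<le> (LINT t|\<mu>. indicator {x<..y} t * norm (g t))"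
proof -
  have "primitive g y - primitive g x = (LINT t|\<mu>. indicator {..y} t *\<^sub>R g t - indicator {..x} t *\<^sub>R g t)"
    unfolding primitive_def using primitive_integrand[OF g] by simp
  also have "\<dots> = (LINT t|\<mu>. indicator {x<..y} t *\<^sub>R g t)"
    using assms(2) by (intro Bochner_Integration.integral_cong) (auto simp: indicator_def)
  also have "norm \<dots> \<le> (LINT t|\<mu>. norm (indicator {x<..y} t *\<^sub>R g t))" by (rule integral_norm_bound)
  finally show ?thesis by simp
qed

lemma primitive_dist:
  assumes g: "integrable \<mu> g"
  shows "norm (primitive g x - primitive g y) \<le> (LINT t|\<mu>. norm (g t))"
proof -
  have *: "norm (primitive g y - primitive g x) \<le> (LINT t|\<mu>. norm (g t))" if "x \<le> y" for x y
  proof (rule order_trans[OF primitive_diff[OF g that]], rule integral_mono')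
    show "integrable \<mu> (\<lambda>t. norm (g t))" using g by simp
  qed (auto simp: indicator_def)
  show ?thesis using *[of x y] *[of y x] by (cases "x \<le> y") (auto simp: norm_minus_commute)
qed

lemma primitive_measurable:
  assumes g: "integrable \<mu> g" shows "primitive g \<in> borel_measurable \<mu>"
proof -
  have "(\<lambda>p. indicator {(x, t). t \<le> x} p *\<^sub>R g (snd p)) \<in> borel_measurable (\<mu> \<Otimes>\<^sub>M \<mu>)"
    by (intro borel_measurable_scaleR measurable_pair_indicator
        measurable_compose[OF measurable_snd borel_measurable_integrable[OF g]])
  moreover have "(\<lambda>p. indicator {(x, t). t \<le> x} p *\<^sub>R g (snd p)) =
      (\<lambda>(x, t). indicator {(x, t). t \<le> x} (x, t) *\<^sub>R g t)" by (auto simp: fun_eq_iff)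
  ultimately have "(\<lambda>x. LINT t|\<mu>. indicator {(x, t). t \<le> x} (x, t) *\<^sub>R g t) \<in> borel_measurable \<mu>"
    using unit.borel_measurable_lebesgue_integral[of "\<lambda>x t. indicator {(x, t). t \<le> x} (x, t) *\<^sub>R g t" \<mu>]
    by simp
  then show ?thesis unfolding primitive_def[abs_def] by (simp add: indicator_def)
qed

lemma primitive_integrable:
  assumes g: "integrable \<mu> g" shows "integrable \<mu> (primitive g)"
proof (rule unit.integrable_const_bound)
  have "primitive g (-1) = 0"
    unfolding primitive_def by (rule integral_eq_zero_AE) (auto intro!: AE_I2 simp: indicator_def)
  then show "AE x in \<mu>. norm (primitive g x) \<le> (LINT t|\<mu>. norm (g t))"
    using primitive_dist[OF g, of _ "-1"] by simp
qed (rule primitive_measurable[OF g])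

lemma centred_primitive_integrable: "integrable \<mu> g \<Longrightarrow> integrable \<mu> (centred_primitive g)"
  unfolding centred_primitive_def[abs_def] by (intro Bochner_Integration.integrable_diff primitive_integrable) auto

lemma centred_primitive_mean: "integrable \<mu> g \<Longrightarrow> (LINT x|\<mu>. centred_primitive g x) = 0"
  unfolding centred_primitive_def using primitive_integrable by simp

text \<open>
  The centred primitive at \<open>x\<close> is the mean over \<open>y\<close> of the differences of the primitive at \<open>x\<close> and \<open>y\<close>.
\<close>
lemma centred_primitive_bound:
  assumes g: "integrable \<mu> g" shows "norm (centred_primitive g x) \<le> (LINT t|\<mu>. norm (g t))"
proof -
  have "centred_primitive g x = (LINT y|\<mu>. primitive g x - primitive g y)"
    unfolding centred_primitive_def using primitive_integrable[OF g] by simp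
  also have "norm \<dots> \<le> (LINT y|\<mu>. norm (primitive g x - primitive g y))" by (rule integral_norm_bound)
  also have "\<dots> \<le> (LINT y|\<mu>. (LINT t|\<mu>. norm (g t)))"
    using primitive_dist[OF g]
    by (intro integral_mono integrable_norm Bochner_Integration.integrable_diff
        primitive_integrable[OF g] unit.integrable_const)
  finally show ?thesis by simp
qed

text \<open>
  Integration by parts for a primitive, by Fubini's theorem on the triangle \<open>t \<le> x\<close>.  Here
  \<open>w\<close> is minus the integral of \<open>w'\<close> from \<open>y\<close> to 1, so that \<open>w'\<close> may have jumps and \<open>w 1 = 0\<close>.
\<close>
lemma primitive_by_parts:
  fixes w w' :: "real \<Rightarrow> real"
  assumes g: "integrable \<mu> g"
    and w': "w' \<in> borel_measurable \<mu>" "\<And>x. x \<in> {0..1} \<Longrightarrow> \<bar>w' x\<bar> \<le> B"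
    and w: "\<And>y. y \<in> {0..1} \<Longrightarrow> (w' has_integral (- w y)) {y..1}"
  shows "(LINT x|\<mu>. primitive g x * of_real (w' x)) = - (LINT t|\<mu>. g t * of_real (w t))"
proof -
  define F where "F p = (indicator {(x, t). t \<le> x} p *\<^sub>R g (snd p)) * of_real (w' (fst p))" for p
  have F_meas: "F \<in> borel_measurable (\<mu> \<Otimes>\<^sub>M \<mu>)"
    unfolding F_def
    by (intro borel_measurable_times borel_measurable_scaleR measurable_pair_indicator
        measurable_compose[OF measurable_snd borel_measurable_integrable[OF g]]
        measurable_compose[OF measurable_compose[OF measurable_fst w'(1)] borel_measurable_of_real])
  have F_eq: "F (x, t) = (indicator {..x} t *\<^sub>R g t) * of_real (w' x)" for x t
    by (simp add: F_def indicator_def)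
  have B: "0 \<le> B" using w'(2)[of 0] by simp
  have F_int: "integrable (\<mu> \<Otimes>\<^sub>M \<mu>) F"
  proof (rule unit_pair.Fubini_integrable[OF F_meas])
    show "AE x in \<mu>. integrable \<mu> (\<lambda>t. F (x, t))"
      unfolding F_eq by (intro AE_I2 integrable_mult_left impI primitive_integrand[OF g])
    show "integrable \<mu> (\<lambda>x. LINT t|\<mu>. norm (F (x, t)))"
    proof (rule unit.integrable_const_bound[where B = "B * (LINT t|\<mu>. norm (g t))"])
      show "AE x in \<mu>. norm (LINT t|\<mu>. norm (F (x, t))) \<le> B * (LINT t|\<mu>. norm (g t))"
      proof (rule AE_I2)
        fix x assume "x \<in> space \<mu>"
        then have x: "\<bar>w' x\<bar> \<le> B" using w'(2) by simp
        have "(LINT t|\<mu>. norm (F (x, t))) \<le> (LINT t|\<mu>. B * norm (g t))"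
        proof (rule integral_mono')
          show "integrable \<mu> (\<lambda>t. B * norm (g t))" using g by simp
          show "norm (F (x, t)) \<le> B * norm (g t)" for t
            using x B mult_mono[of "norm (g t)" "norm (g t)" "\<bar>w' x\<bar>" B]
            by (auto simp: F_eq norm_mult indicator_def mult.commute)
        qed (use B in auto)
        then show "norm (LINT t|\<mu>. norm (F (x, t))) \<le> B * (LINT t|\<mu>. norm (g t))" by simp
      qed
      show "(\<lambda>x. LINT t|\<mu>. norm (F (x, t))) \<in> borel_measurable \<mu>"
        using unit.borel_measurable_lebesgue_integral[of "\<lambda>x t. norm (F (x, t))" \<mu>] F_meas by simp
    qed
  qed
  have inner: "(LINT x|\<mu>. F (x, t)) = - (g t * of_real (w t))" if t: "t \<in> {0..1}" for t
  proof -
    have int: "integrable \<mu> (\<lambda>x. if x \<in> {t..1} then w' x else 0)"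
    proof (rule unit.integrable_const_bound[where B = B])
      show "AE x in \<mu>. norm (if x \<in> {t..1} then w' x else 0) \<le> B" using w'(2) B by (intro AE_I2) auto
      show "(\<lambda>x. if x \<in> {t..1} then w' x else 0) \<in> borel_measurable \<mu>"
        using w'(1) borel_measurable_unit[of "indicator {t..1}"]
        by (intro measurable_If_set) (auto simp: sets_restrict_space)
    qed
    have "(LINT x|\<mu>. F (x, t)) = (LINT x|\<mu>. g t * of_real (if x \<in> {t..1} then w' x else 0))"
      by (rule Bochner_Integration.integral_cong) (use t in \<open>auto simp: F_eq indicator_def\<close>)
    also have "\<dots> = g t * of_real (LINT x|\<mu>. (if x \<in> {t..1} then w' x else 0))"
      using int by simp
    also have "(LINT x|\<mu>. (if x \<in> {t..1} then w' x else 0)) = integral {0..1} (\<lambda>x. if x \<in> {t..1} then w' x else 0)"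
      by (rule lebesgue_integral_eq_integral[OF int]) simp
    also have "\<dots> = - w t"
      by (rule integral_unique, subst has_integral_restrict) (use t w in auto)
    finally show ?thesis by simp
  qed
  have "(LINT t|\<mu>. F (x, t)) = primitive g x * of_real (w' x)" for x
    unfolding F_eq primitive_def by (rule Bochner_Integration.integral_mult_left) (rule primitive_integrand[OF g])
  then have "(LINT x|\<mu>. primitive g x * of_real (w' x)) = (LINT x|\<mu>. LINT t|\<mu>. F (x, t))"
    by (simp only:)
  also have "\<dots> = (LINT t|\<mu>. LINT x|\<mu>. F (x, t))"
    using unit_pair.Fubini_integral[of "\<lambda>x t. F (x, t)"] F_int by simp
  also have "\<dots> = (LINT t|\<mu>. - (g t * of_real (w t)))"
    by (rule Bochner_Integration.integral_cong) (use inner in auto)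
  finally show ?thesis by simp
qed

section \<open>Weak derivatives\<close>

lemma test_function_bounded:
  assumes "test_function \<phi>"
  obtains B where "\<And>x. x \<in> {0..1} \<Longrightarrow> \<bar>\<phi> x\<bar> \<le> B" "\<And>x. x \<in> {0..1} \<Longrightarrow> \<bar>deriv \<phi> x\<bar> \<le> B"
proof -
  have "bounded (\<phi> ` {0..1} \<union> deriv \<phi> ` {0..1})"
    using test_function_derivative(2,3)[OF assms]
    by (intro bounded_Un[THEN iffD2] conjI compact_imp_bounded compact_continuous_image) (auto intro: continuous_on_subset)
  then obtain B where "\<And>y. y \<in> \<phi> ` {0..1} \<union> deriv \<phi> ` {0..1} \<Longrightarrow> norm y \<le> B" by (auto simp: bounded_iff)
  then show thesis using that[of B] by auto
qed

lemma test_function_measurable: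
  assumes "test_function \<phi>" shows "\<phi> \<in> borel_measurable \<mu>" "deriv \<phi> \<in> borel_measurable \<mu>"
  using test_function_derivative(2,3)[OF assms] by (auto intro!: borel_measurable_unit borel_measurable_continuous_onI)

lemma test_function_integrable_mult:
  fixes g :: "real \<Rightarrow> complex"
  assumes "test_function \<phi>" "integrable \<mu> g"
  shows "integrable \<mu> (\<lambda>x. g x * of_real (\<phi> x))" "integrable \<mu> (\<lambda>x. g x * of_real (deriv \<phi> x))"
proof -
  obtain B where B: "\<And>x. x \<in> {0..1} \<Longrightarrow> \<bar>\<phi> x\<bar> \<le> B" "\<And>x. x \<in> {0..1} \<Longrightarrow> \<bar>deriv \<phi> x\<bar> \<le> B"
    using test_function_bounded[OF assms(1)] by blast
  show "integrable \<mu> (\<lambda>x. g x * of_real (\<phi> x))"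
    by (rule integrable_bounded_mult[OF assms(2) test_function_measurable(1)[OF assms(1)] B(1)])
  show "integrable \<mu> (\<lambda>x. g x * of_real (deriv \<phi> x))"
    by (rule integrable_bounded_mult[OF assms(2) test_function_measurable(2)[OF assms(1)] B(2)])
qed

lemma test_function_ftc:
  assumes "test_function \<phi>" "y \<le> 1" shows "(deriv \<phi> has_integral (- \<phi> y)) {y..1}"
proof -
  have "(deriv \<phi> has_integral (\<phi> 1 - \<phi> y)) {y..1}"
    using test_function_derivative(1)[OF assms(1)] assms(2)
    by (intro fundamental_theorem_of_calculus)
      (auto simp: has_real_derivative_iff_has_vector_derivative[symmetric] intro: has_field_derivative_at_within)
  then show ?thesis using test_function_boundary[OF assms(1), of 1] by simp
qed

lemma integral_unit_eq: 
  fixes w :: "real \<Rightarrow> real" assumes "continuous_on UNIV w" shows "(LINT x|\<mu>. w x) = integral {0..1} w"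
proof (rule lebesgue_integral_eq_integral)
  show "integrable \<mu> w"
    using assms by (intro continuous_imp_integrable_real) (auto intro: continuous_on_subset)
qed simp

lemma test_function_derivative_mean:
  assumes "test_function \<phi>" shows "(LINT x|\<mu>. deriv \<phi> x) = 0"
  using test_function_ftc[OF assms, of 0] test_function_boundary[OF assms, of 0]
    integral_unit_eq[OF test_function_derivative(2)[OF assms]]
  by (simp add: integral_unique)

lemma exists_normalized_test_function: "\<exists>\<theta>. test_function \<theta> \<and> (LINT x|\<mu>. \<theta> x) \<noteq> 0"
proof -
  define \<theta> where "\<theta> = bump 1 (1/4) (3/4)"
  have \<theta>: "test_function \<theta>" unfolding \<theta>_def by (rule bump_test_function) auto
  have cont: "continuous_on S \<theta>" for S using test_function_derivative(3)[OF \<theta>] continuous_on_subset by blast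
  have "integral {0..1} \<theta> \<noteq> 0"
  proof
    assume "integral {0..1} \<theta> = 0"
    then have "(\<theta> has_integral 0) (cbox 0 1)"
      using integrable_integral[OF integrable_continuous_interval[OF cont[of "{0..1}"]]] by simp
    from has_integral_0_cbox_imp_0[OF _ _ this, of "1/2"] cont bump_range(1)
    have "\<theta> (1/2) = 0" by (auto simp: \<theta>_def)
    moreover have "0 < \<theta> (1/2)" unfolding \<theta>_def by (rule bump_pos) auto
    ultimately show False by simp
  qed
  then show ?thesis using \<theta> integral_unit_eq[OF cont] by auto
qed

lemma weak_derivative_unique:
  assumes g: "weak_derivative h g" and g': "weak_derivative h g'" shows "AE x in \<mu>. g x = g' x"
proof -
  have int: "integrable \<mu> g" "integrable \<mu> g'" using g g' by (auto simp: weak_derivative_def)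
  have "AE x in \<mu>. g x - g' x = 0"
  proof (rule fundamental_lemma)
    show "integrable \<mu> (\<lambda>x. g x - g' x)" using int by simp
    fix \<phi> assume \<phi>: "test_function \<phi>"
    have "(LINT x|\<mu>. g x * of_real (\<phi> x)) = (LINT x|\<mu>. g' x * of_real (\<phi> x))"
      using g g' \<phi> by (auto simp: weak_derivative_def dest!: spec[of _ \<phi>])
    then show "(LINT x|\<mu>. (g x - g' x) * of_real (\<phi> x)) = 0"
      using test_function_integrable_mult(1)[OF \<phi> int(1)] test_function_integrable_mult(1)[OF \<phi> int(2)]
      by (simp add: left_diff_distrib)
  qed
  then show ?thesis by eventually_elim simp
qed

text \<open>
  Subtracting a multiple of a fixed test function \<open>\<theta>\<close> of nonzero integral from any test
  function makes the integral zero, and a test function of integral zero is the derivative of a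
  test function.  So \<open>k\<close> integrates every test function like a constant.
\<close>
lemma du_bois_reymond:
  fixes k :: "real \<Rightarrow> complex"
  assumes k: "integrable \<mu> k"
    and zero: "\<And>\<phi>. test_function \<phi> \<Longrightarrow> (LINT x|\<mu>. k x * of_real (deriv \<phi> x)) = 0"
  shows "AE x in \<mu>. k x = (LINT x|\<mu>. k x)"
proof -
  obtain \<theta> where \<theta>: "test_function \<theta>" "(LINT x|\<mu>. \<theta> x) \<noteq> 0" using exists_normalized_test_function by blast
  define I where "I \<psi> = (LINT x|\<mu>. \<psi> x)" for \<psi> :: "real \<Rightarrow> real"
  define m where "m = (LINT x|\<mu>. k x * of_real (\<theta> x)) / of_real (I \<theta>)"
  have int_test: "integrable \<mu> \<psi>" if "test_function \<psi>" for \<psi>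
    using test_function_derivative(3)[OF that] by (intro continuous_imp_integrable_real) (auto intro: continuous_on_subset)
  have "AE x in \<mu>. k x - m = 0"
  proof (rule fundamental_lemma)
    show km: "integrable \<mu> (\<lambda>x. k x - m)" using k by simp
    fix \<psi> assume \<psi>: "test_function \<psi>"
    define c where "c = - (I \<psi> / I \<theta>)"
    have t: "test_function (\<lambda>x. \<psi> x + c * \<theta> x)" by (rule test_function_linear[OF \<psi> \<theta>(1)])
    have "(LINT x|\<mu>. \<psi> x + c * \<theta> x) = 0"
      using int_test[OF \<psi>] int_test[OF \<theta>(1)] \<theta>(2) by (simp add: c_def I_def)
    then have "integral {0..1} (\<lambda>x. \<psi> x + c * \<theta> x) = 0"
      using integral_unit_eq[OF test_function_derivative(3)[OF t]] by simp
    then obtain \<phi> where \<phi>: "test_function \<phi>" "deriv \<phi> = (\<lambda>x. \<psi> x + c * \<theta> x)"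
      using test_function_primitive[OF t] by blast
    have "0 = (LINT x|\<mu>. k x * of_real (\<psi> x + c * \<theta> x))" using zero[OF \<phi>(1)] by (simp add: \<phi>(2))
    also have "\<dots> = (LINT x|\<mu>. k x * of_real (\<psi> x)) + of_real c * (LINT x|\<mu>. k x * of_real (\<theta> x))"
      using test_function_integrable_mult(1)[OF \<psi> k] test_function_integrable_mult(1)[OF \<theta>(1) k]
      by (simp add: distrib_left mult.left_commute)
    also have "of_real c * (LINT x|\<mu>. k x * of_real (\<theta> x)) = - (m * of_real (I \<psi>))"
      using \<theta>(2) by (simp add: c_def m_def I_def)
    finally have *: "(LINT x|\<mu>. k x * of_real (\<psi> x)) = m * of_real (I \<psi>)" by simp
    have "(LINT x|\<mu>. (k x - m) * of_real (\<psi> x)) = (LINT x|\<mu>. k x * of_real (\<psi> x)) - m * of_real (I \<psi>)"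
      using test_function_integrable_mult(1)[OF \<psi> k] int_test[OF \<psi>] by (simp add: left_diff_distrib I_def)
    then show "(LINT x|\<mu>. (k x - m) * of_real (\<psi> x)) = 0" using * by simp
  qed
  then have AE: "AE x in \<mu>. k x = m" by eventually_elim simp
  then have "(LINT x|\<mu>. k x) = (LINT x|\<mu>. m)" using k by (intro integral_cong_AE) auto
  then show ?thesis using AE by simp
qed

lemma weak_derivative_centred_primitive:
  assumes h: "integrable \<mu> h" and g: "integrable \<mu> g" and AE: "AE x in \<mu>. h x = c + centred_primitive g x"
  shows "weak_derivative h g"
  unfolding weak_derivative_def
proof (intro conjI allI impI g)
  fix \<phi> assume \<phi>: "test_function \<phi>"
  obtain B where B: "\<And>x. x \<in> {0..1} \<Longrightarrow> \<bar>deriv \<phi> x\<bar> \<le> B" using test_function_bounded[OF \<phi>] by metis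
  define d where "d = c - (LINT y|\<mu>. primitive g y)"
  have cd: "c + centred_primitive g x = d + primitive g x" for x by (simp add: d_def centred_primitive_def)
  note pi = primitive_integrable[OF g]
  have "(LINT x|\<mu>. h x * of_real (deriv \<phi> x)) = (LINT x|\<mu>. (d + primitive g x) * of_real (deriv \<phi> x))"
  proof (rule integral_cong_AE)
    show "AE x in \<mu>. h x * of_real (deriv \<phi> x) = (d + primitive g x) * of_real (deriv \<phi> x)"
      using AE by eventually_elim (simp add: cd)
  qed (intro borel_measurable_integrable test_function_integrable_mult[OF \<phi>] h Bochner_Integration.integrable_add unit.integrable_const pi)+
  also have "\<dots> = d * of_real (LINT x|\<mu>. deriv \<phi> x) + (LINT x|\<mu>. primitive g x * of_real (deriv \<phi> x))"
    using test_function_integrable_mult(2)[OF \<phi> pi] test_function_integrable_mult(2)[OF \<phi> unit.integrable_const[of d]]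
    by (simp add: distrib_right)
  also have "\<dots> = (LINT x|\<mu>. primitive g x * of_real (deriv \<phi> x))"
    by (simp add: test_function_derivative_mean[OF \<phi>])
  also have "\<dots> = - (LINT x|\<mu>. g x * of_real (\<phi> x))"
    by (rule primitive_by_parts[OF g test_function_measurable(2)[OF \<phi>] B test_function_ftc[OF \<phi>]]) auto
  finally show "(LINT x|\<mu>. h x * of_real (deriv \<phi> x)) = - (LINT x|\<mu>. g x * of_real (\<phi> x))" .
qed

text \<open>
  The difference of \<open>h\<close> and the centred primitive of its weak derivative has weak derivative zero.
\<close>
lemma weak_derivative_representation:
  assumes h: "integrable \<mu> h" and g: "weak_derivative h g"
  shows "AE x in \<mu>. h x = (LINT x|\<mu>. h x) + centred_primitive g x"
proof -
  have gi: "integrable \<mu> g" using g by (simp add: weak_derivative_def)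
  note ci = centred_primitive_integrable[OF gi]
  have w: "weak_derivative (centred_primitive g) g"
    by (rule weak_derivative_centred_primitive[where c = 0, OF ci gi]) simp
  have "(LINT x|\<mu>. h x - centred_primitive g x) = (LINT x|\<mu>. h x)"
    using h ci by (simp add: centred_primitive_mean[OF gi])
  moreover have "AE x in \<mu>. h x - centred_primitive g x = (LINT x|\<mu>. h x - centred_primitive g x)"
  proof (rule du_bois_reymond)
    show "integrable \<mu> (\<lambda>x. h x - centred_primitive g x)" using h ci by simp
    fix \<phi> assume \<phi>: "test_function \<phi>"
    have "(LINT x|\<mu>. h x * of_real (deriv \<phi> x)) = (LINT x|\<mu>. centred_primitive g x * of_real (deriv \<phi> x))"
      using g w \<phi> by (auto simp: weak_derivative_def dest!: spec[of _ \<phi>])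
    then show "(LINT x|\<mu>. (h x - centred_primitive g x) * of_real (deriv \<phi> x)) = 0"
      using test_function_integrable_mult(2)[OF \<phi> h] test_function_integrable_mult(2)[OF \<phi> ci]
      by (simp add: left_diff_distrib)
  qed
  ultimately have "AE x in \<mu>. h x - centred_primitive g x = (LINT x|\<mu>. h x)" by (simp only:)
  then show ?thesis by eventually_elim (simp add: algebra_simps)
qed

section \<open>The Sobolev space with the mean norm\<close>

lemma AE_summable_if_summable_integrals:
  fixes g :: "nat \<Rightarrow> 'a \<Rightarrow> 'b::{banach, second_countable_topology}"
  assumes g: "\<And>n. integrable M (g n)" and s: "summable (\<lambda>n. LINT x|M. norm (g n x))"
  shows "AE x in M. summable (\<lambda>n. norm (g n x))"
proof -
  have "(\<integral>\<^sup>+x. (\<Sum>n. ennreal (norm (g n x))) \<partial>M) = (\<Sum>n. \<integral>\<^sup>+x. norm (g n x) \<partial>M)"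
    using g by (intro nn_integral_suminf) auto
  also have "\<dots> = (\<Sum>n. ennreal (LINT x|M. norm (g n x)))"
    using g by (intro suminf_cong nn_integral_eq_integral) auto
  also have "\<dots> \<noteq> top" using s by (intro ennreal_suminf_neq_top) auto
  finally have "AE x in M. (\<Sum>n. ennreal (norm (g n x))) \<noteq> \<infinity>"
    using g by (intro nn_integral_PInf_AE) auto
  then show ?thesis by eventually_elim (rule summable_suminf_not_top; simp)
qed

lemma L1_complete:
  fixes g :: "nat \<Rightarrow> 'a \<Rightarrow> 'b::{banach, second_countable_topology}"
  assumes g: "\<And>n. integrable M (g n)" and s: "summable (\<lambda>n. LINT x|M. norm (g n x))"
  obtains G where "integrable M G" "(\<lambda>n. LINT x|M. norm (G x - (\<Sum>k<n. g k x))) \<longlonglongrightarrow> 0"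
proof -
  define G where "G x = (\<Sum>n. g n x)" for x
  have AE: "AE x in M. summable (\<lambda>n. norm (g n x))" by (rule AE_summable_if_summable_integrals[OF g s])
  have G: "integrable M G" unfolding G_def by (rule integrable_suminf[OF g AE s])
  define r where "r n = (\<Sum>k. LINT x|M. norm (g (k + n) x))" for n
  have r: "r \<longlonglongrightarrow> 0" unfolding r_def by (rule suminf_exist_split2[OF s])
  have le: "(LINT x|M. norm (G x - (\<Sum>k<n. g k x))) \<le> r n" for n
  proof -
    have AE': "AE x in M. summable (\<lambda>k. norm (norm (g (k + n) x)))"
      using AE
    proof eventually_elim
      fix x assume "summable (\<lambda>n. norm (g n x))"
      from summable_ignore_initial_segment[OF this, of n]
      show "summable (\<lambda>k. norm (norm (g (k + n) x)))" by simp
    qed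
    have s': "summable (\<lambda>k. LINT x|M. norm (norm (g (k + n) x)))"
      using summable_ignore_initial_segment[OF s, of n] by simp
    have gn: "integrable M (\<lambda>x. norm (g (k + n) x))" for k using g by simp
    have "(LINT x|M. norm (G x - (\<Sum>k<n. g k x))) \<le> (LINT x|M. (\<Sum>k. norm (g (k + n) x)))"
    proof (rule integral_mono_AE)
      show "integrable M (\<lambda>x. norm (G x - (\<Sum>k<n. g k x)))" using G g by simp
      show "integrable M (\<lambda>x. \<Sum>k. norm (g (k + n) x))" by (rule integrable_suminf[OF gn AE' s'])
      show "AE x in M. norm (G x - (\<Sum>k<n. g k x)) \<le> (\<Sum>k. norm (g (k + n) x))"
        using AE
      proof eventually_elim
        fix x assume x: "summable (\<lambda>n. norm (g n x))"
        have "G x - (\<Sum>k<n. g k x) = (\<Sum>k. g (k + n) x)"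
          unfolding G_def using suminf_split_initial_segment[OF summable_norm_cancel[OF x], of n] by simp
        then show "norm (G x - (\<Sum>k<n. g k x)) \<le> (\<Sum>k. norm (g (k + n) x))"
          using summable_norm[OF summable_ignore_initial_segment[OF x, of n]] by simp
      qed
    qed
    also have "\<dots> = r n" unfolding r_def by (rule integral_suminf[OF gn AE' s'])
    finally show ?thesis .
  qed
  have "(\<lambda>n. LINT x|M. norm (G x - (\<Sum>k<n. g k x))) \<longlonglongrightarrow> 0"
    by (rule tendsto_sandwich[OF always_eventually always_eventually tendsto_const r]) (use le in auto)
  then show thesis using that G by blast
qed

definition weak_deriv :: "(real \<Rightarrow> complex) \<Rightarrow> real \<Rightarrow> complex" where
  "weak_deriv h = (SOME g. weak_derivative h g)"

text \<open>
  A norm on \<open>W11\<close> that is equivalent to the usual one and adapted to operators preserving the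
  integral: for the mean zero part it is the \<open>L\<^sup>1\<close> norm of the derivative.
\<close>
definition mean_norm :: "(real \<Rightarrow> complex) \<Rightarrow> real" where
  "mean_norm h = norm (LINT x|\<mu>. h x) + (LINT x|\<mu>. norm (weak_deriv h x))"

lemma W11D:
  assumes "h \<in> W11"
  shows "integrable \<mu> h" "weak_derivative h (weak_deriv h)" "integrable \<mu> (weak_deriv h)"
proof -
  show "integrable \<mu> h" using assms by (simp add: W11_def)
  show w: "weak_derivative h (weak_deriv h)"
  proof -
    obtain g where "weak_derivative h g" using assms by (auto simp: W11_def)
    then show ?thesis unfolding weak_deriv_def by (rule someI[of "weak_derivative h"])
  qed
  then show "integrable \<mu> (weak_deriv h)" by (simp add: weak_derivative_def)
qed

lemma W11I: "integrable \<mu> h \<Longrightarrow> weak_derivative h g \<Longrightarrow> h \<in> W11"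
  by (auto simp: W11_def)

lemma weak_deriv_eq: assumes "weak_derivative h g" shows "AE x in \<mu>. weak_deriv h x = g x"
  using weak_derivative_unique[OF someI[of "weak_derivative h", OF assms] assms] by (simp add: weak_deriv_def)

lemma norm_weak_deriv_eq:
  assumes "weak_derivative h g" shows "(LINT x|\<mu>. norm (weak_deriv h x)) = (LINT x|\<mu>. norm (g x))"
proof (rule integral_cong_AE)
  have "weak_derivative h (weak_deriv h)" unfolding weak_deriv_def by (rule someI[of "weak_derivative h", OF assms])
  then have "integrable \<mu> (weak_deriv h)" "integrable \<mu> g" using assms by (simp_all add: weak_derivative_def)
  then show "(\<lambda>x. norm (weak_deriv h x)) \<in> borel_measurable \<mu>" "(\<lambda>x. norm (g x)) \<in> borel_measurable \<mu>"
    by (auto intro: borel_measurable_norm borel_measurable_integrable)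
  show "AE x in \<mu>. norm (weak_deriv h x) = norm (g x)" using weak_deriv_eq[OF assms] by eventually_elim simp
qed

lemma mean_norm_eq:
  "weak_derivative h g \<Longrightarrow> mean_norm h = norm (LINT x|\<mu>. h x) + (LINT x|\<mu>. norm (g x))"
  by (simp add: mean_norm_def norm_weak_deriv_eq)

lemma W11_norm_eq: "W11_norm h = (LINT x|\<mu>. norm (h x)) + (LINT x|\<mu>. norm (weak_deriv h x))"
  by (simp add: W11_norm_def weak_deriv_def)

lemma weak_derivative_lin:
  assumes h: "integrable \<mu> h" "weak_derivative h g" and k: "integrable \<mu> k" "weak_derivative k g'"
  shows "weak_derivative (\<lambda>x. a * h x + b * k x) (\<lambda>x. a * g x + b * g' x)"
proof -
  have gi: "integrable \<mu> g" "integrable \<mu> g'" using h k by (auto simp: weak_derivative_def)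
  have "(LINT x|\<mu>. (a * h x + b * k x) * of_real (deriv \<phi> x)) =
      - (LINT x|\<mu>. (a * g x + b * g' x) * of_real (\<phi> x))" if \<phi>: "test_function \<phi>" for \<phi>
  proof -
    have lin: "(LINT x|\<mu>. (a * h1 x + b * k1 x) * of_real (w x)) =
        a * (LINT x|\<mu>. h1 x * of_real (w x)) + b * (LINT x|\<mu>. k1 x * of_real (w x))"
      if "integrable \<mu> (\<lambda>x. h1 x * of_real (w x))" "integrable \<mu> (\<lambda>x. k1 x * of_real (w x))"
      for h1 k1 :: "real \<Rightarrow> complex" and w
      using that by (simp add: distrib_right mult.assoc)
    show ?thesis
      using lin[OF test_function_integrable_mult(2)[OF \<phi> h(1)] test_function_integrable_mult(2)[OF \<phi> k(1)]]
        lin[OF test_function_integrable_mult(1)[OF \<phi> gi(1)] test_function_integrable_mult(1)[OF \<phi> gi(2)]]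
        h(2) k(2) \<phi> by (simp add: weak_derivative_def)
  qed
  then show ?thesis using gi by (simp add: weak_derivative_def)
qed

lemma weak_derivative_zero: "weak_derivative (\<lambda>x. c) (\<lambda>x. 0)"
  by (rule weak_derivative_centred_primitive[where c = c]) (simp_all add: centred_primitive_def primitive_def)

lemma weak_derivative_sum:
  assumes "\<And>k. k < (n::nat) \<Longrightarrow> integrable \<mu> (u k) \<and> weak_derivative (u k) (g k)"
  shows "weak_derivative (\<lambda>x. \<Sum>k<n. u k x) (\<lambda>x. \<Sum>k<n. g k x)"
  using assms
proof (induction n)
  case 0 show ?case using weak_derivative_zero[of 0] by simp
next
  case (Suc n)
  have "integrable \<mu> (\<lambda>x. \<Sum>k<n. u k x)"
    using Suc.prems by (intro Bochner_Integration.integrable_sum) auto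
  then show ?case
    using weak_derivative_lin[of "\<lambda>x. \<Sum>k<n. u k x" "\<lambda>x. \<Sum>k<n. g k x" "u n" "g n" 1 1] Suc by simp
qed

lemma W11_centred_primitive:
  assumes "integrable \<mu> g"
  shows "weak_derivative (\<lambda>x. c + centred_primitive g x) g" "(\<lambda>x. c + centred_primitive g x) \<in> W11"
    "(LINT x|\<mu>. c + centred_primitive g x) = c"
proof -
  have i: "integrable \<mu> (\<lambda>x. c + centred_primitive g x)"
    using centred_primitive_integrable[OF assms] by simp
  show w: "weak_derivative (\<lambda>x. c + centred_primitive g x) g"
    by (rule weak_derivative_centred_primitive[where c = c, OF i assms]) simp
  show "(\<lambda>x. c + centred_primitive g x) \<in> W11" by (rule W11I[OF i w])
  show "(LINT x|\<mu>. c + centred_primitive g x) = c"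
    using centred_primitive_integrable[OF assms] by (simp add: centred_primitive_mean[OF assms])
qed

lemma W11_poincare:
  assumes h: "h \<in> W11"
  shows "AE x in \<mu>. norm (h x - (LINT x|\<mu>. h x)) \<le> (LINT x|\<mu>. norm (weak_deriv h x))"
  using weak_derivative_representation[OF W11D(1,2)[OF h]]
  by eventually_elim (simp add: centred_primitive_bound[OF W11D(3)[OF h]])

lemma L1_norm_le_mean_norm:
  assumes h: "h \<in> W11" shows "(LINT x|\<mu>. norm (h x)) \<le> mean_norm h"
proof -
  have "(LINT x|\<mu>. norm (h x)) \<le> (LINT x|\<mu>. mean_norm h)"
  proof (rule integral_mono_AE)
    show "AE x in \<mu>. norm (h x) \<le> mean_norm h"
      using W11_poincare[OF h]
    proof eventually_elim
      fix x assume "norm (h x - (LINT x|\<mu>. h x)) \<le> (LINT x|\<mu>. norm (weak_deriv h x))"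
      then show "norm (h x) \<le> mean_norm h"
        using norm_triangle_sub[of "h x" "LINT x|\<mu>. h x"] by (simp add: mean_norm_def)
    qed
  qed (use W11D[OF h] in auto)
  then show ?thesis by simp
qed

interpretation cs: vector_space "cscale :: complex \<Rightarrow> (real \<Rightarrow> complex) \<Rightarrow> _"
  by (rule vector_space_cscale)

lemma mean_norm_scale: assumes h: "h \<in> W11" shows "cscale c h \<in> W11" "mean_norm (cscale c h) = norm c * mean_norm h"
proof -
  have w: "weak_derivative (cscale c h) (\<lambda>x. c * weak_deriv h x)"
    using weak_derivative_lin[OF W11D(1,2)[OF h] W11D(1,2)[OF h], of c 0] by (simp add: cscale_def)
  then show "cscale c h \<in> W11" using W11D(1)[OF h] by (intro W11I) (simp_all add: cscale_def)
  show "mean_norm (cscale c h) = norm c * mean_norm h"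
    unfolding mean_norm_eq[OF w] unfolding cscale_def by (simp add: mean_norm_def norm_mult distrib_left)
qed

lemma mean_norm_add:
  assumes h: "h \<in> W11" and k: "k \<in> W11"
  shows "h + k \<in> W11" "mean_norm (h + k) \<le> mean_norm h + mean_norm k"
proof -
  have eq: "h + k = (\<lambda>x. h x + k x)" by (rule plus_fun_def)
  have w: "weak_derivative (h + k) (\<lambda>x. weak_deriv h x + weak_deriv k x)"
    using weak_derivative_lin[OF W11D(1,2)[OF h] W11D(1,2)[OF k], of 1 1] by (simp add: eq)
  show "h + k \<in> W11" using W11D(1)[OF h] W11D(1)[OF k] by (intro W11I[OF _ w]) (simp add: eq)
  have "(LINT x|\<mu>. norm (weak_deriv h x + weak_deriv k x)) \<le> (LINT x|\<mu>. norm (weak_deriv h x) + norm (weak_deriv k x))"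
    using W11D(3)[OF h] W11D(3)[OF k] by (intro integral_mono norm_triangle_ineq) auto
  moreover have m: "(LINT x|\<mu>. (h + k) x) = (LINT x|\<mu>. h x) + (LINT x|\<mu>. k x)"
    unfolding eq using W11D(1)[OF h] W11D(1)[OF k] by simp
  ultimately show "mean_norm (h + k) \<le> mean_norm h + mean_norm k"
    unfolding mean_norm_eq[OF w] m using W11D(3)[OF h] W11D(3)[OF k] norm_triangle_ineq[of "LINT x|\<mu>. h x" "LINT x|\<mu>. k x"]
    by (simp add: mean_norm_def)
qed

text \<open>
  Both the means and the weak derivatives form absolutely convergent series, and a mean together
  with a derivative determines an element of \<open>W11\<close>.
\<close>
lemma W11_complete:
  assumes u: "\<And>n::nat. u n \<in> W11" and s: "summable (\<lambda>n. mean_norm (u n))"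
  shows "\<exists>h\<in>W11. (\<lambda>n. mean_norm (h - (\<Sum>k<n. u k))) \<longlonglongrightarrow> 0"
proof -
  have "summable (\<lambda>n. LINT x|\<mu>. norm (weak_deriv (u n) x))"
    by (rule summable_comparison_test'[OF s]) (simp add: mean_norm_def)
  from L1_complete[of \<mu> "\<lambda>n. weak_deriv (u n)", OF W11D(3)[OF u] this]
  obtain G where G: "integrable \<mu> G" "(\<lambda>n. LINT x|\<mu>. norm (G x - (\<Sum>k<n. weak_deriv (u k) x))) \<longlonglongrightarrow> 0" .
  have "summable (\<lambda>n. LINT x|\<mu>. u n x)"
    by (rule summable_comparison_test'[OF s]) (simp add: mean_norm_def)
  then have m: "(\<lambda>n. norm ((\<Sum>n. LINT x|\<mu>. u n x) - (\<Sum>k<n. LINT x|\<mu>. u k x))) \<longlonglongrightarrow> 0"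
    using tendsto_norm[OF tendsto_diff[OF tendsto_const[of "\<Sum>n. LINT x|\<mu>. u n x"] summable_LIMSEQ[of "\<lambda>n. LINT x|\<mu>. u n x"]]]
    by simp
  define h where "h = (\<lambda>x. (\<Sum>n. LINT x|\<mu>. u n x) + centred_primitive G x)"
  note H = W11_centred_primitive[OF G(1), of "\<Sum>n. LINT x|\<mu>. u n x", folded h_def]
  have hi: "integrable \<mu> h" using W11D(1)[OF H(2)] .
  have eq: "mean_norm (h - (\<Sum>k<n. u k)) = norm ((\<Sum>n. LINT x|\<mu>. u n x) - (\<Sum>k<n. LINT x|\<mu>. u k x)) +
      (LINT x|\<mu>. norm (G x - (\<Sum>k<n. weak_deriv (u k) x)))" for n
  proof -
    have fe: "h - (\<Sum>k<n. u k) = (\<lambda>x. h x - (\<Sum>k<n. u k x))" by (simp add: fun_eq_iff sum_fun_apply)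
    have w: "weak_derivative (\<lambda>x. \<Sum>k<n. u k x) (\<lambda>x. \<Sum>k<n. weak_deriv (u k) x)"
      using W11D[OF u] by (intro weak_derivative_sum) auto
    have i: "integrable \<mu> (\<lambda>x. \<Sum>k<n. u k x)" using W11D(1)[OF u] by simp
    have "weak_derivative (\<lambda>x. h x - (\<Sum>k<n. u k x)) (\<lambda>x. G x - (\<Sum>k<n. weak_deriv (u k) x))"
      using weak_derivative_lin[OF hi H(1) i w, of 1 "-1"] by simp
    from mean_norm_eq[OF this] show ?thesis unfolding fe using hi i W11D(1)[OF u] H(3)
      by (simp add: h_def[symmetric])
  qed
  have "(\<lambda>n. mean_norm (h - (\<Sum>k<n. u k))) \<longlonglongrightarrow> 0"
    unfolding eq using tendsto_add[OF m G(2)] by simp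
  then show ?thesis using H(2) by blast
qed

interpretation W: equivalent_norm W11 mean_norm W11_norm 2
proof
  show "cs.subspace W11"
  proof (rule cs.subspaceI)
    show "0 \<in> W11"
      using weak_derivative_zero[of 0] W11I[of "\<lambda>_. 0" "\<lambda>_. 0"] by (simp add: zero_fun_def)
  qed (auto intro: mean_norm_add mean_norm_scale)
  show "mean_norm (x + y) \<le> mean_norm x + mean_norm y" if "x \<in> W11" "y \<in> W11" for x y
    using mean_norm_add that by blast
  show "mean_norm (cscale c x) = norm c * mean_norm x" if "x \<in> W11" for c x
    using mean_norm_scale that by blast
  show "\<exists>h\<in>W11. (\<lambda>n. mean_norm (h - (\<Sum>k<n. u k))) \<longlonglongrightarrow> 0"
    if "\<And>n::nat. u n \<in> W11" "summable (\<lambda>n. mean_norm (u n))" for u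
    using W11_complete that by blast
  show "W11_norm h \<le> 2 * mean_norm h" if "h \<in> W11" for h
  proof -
    have "0 \<le> (LINT x|\<mu>. norm (weak_deriv h x))" by simp
    then show ?thesis using L1_norm_le_mean_norm[OF that] norm_ge_zero[of "LINT x|\<mu>. h x"]
      unfolding W11_norm_eq mean_norm_def distrib_left by linarith
  qed
  show "mean_norm h \<le> 2 * W11_norm h" if "h \<in> W11" for h
  proof -
    have "0 \<le> (LINT x|\<mu>. norm (h x))" "0 \<le> (LINT x|\<mu>. norm (weak_deriv h x))" by simp_all
    then show ?thesis using integral_norm_bound[of \<mu> h] unfolding W11_norm_eq mean_norm_def distrib_left by linarith
  qed
qed simp

section \<open>The branches of an expanding map\<close>

locale expanding_map =
  fixes r N :: nat and p :: "nat \<Rightarrow> real" and lam :: real and f :: "real \<Rightarrow> real"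
  assumes r: "r \<ge> 2" and full_branch: "full_branch_expanding r N p lam f"
begin

abbreviation branch :: "nat \<Rightarrow> real set" where "branch i \<equiv> {p i<..<p (i + 1)}"

definition smooth_points :: "real set" where "smooth_points = (\<Union>i\<in>{1..N}. branch i)"

abbreviation L :: "(real \<Rightarrow> complex) \<Rightarrow> real \<Rightarrow> complex" where "L \<equiv> transfer_operator N p f"

abbreviation u :: "real \<Rightarrow> real" where "u \<equiv> (\<lambda>x. 1 / deriv f x)"

lemma branch_data:
  "p 1 = 0" "p (N + 1) = 1" "i \<in> {1..N} \<Longrightarrow> p i < p (i + 1)" "lam > 1"
  "i \<in> {1..N} \<Longrightarrow> x \<in> branch i \<Longrightarrow> lam < deriv f x"
  using full_branch by (simp_all add: full_branch_expanding_def)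

lemma p_mono: assumes "1 \<le> i" "i \<le> j" "j \<le> N + 1" shows "p i \<le> p j"
  using assms(2,3)
proof (induction j rule: dec_induct)
  case (step k)
  then show ?case using branch_data(3)[of k] assms(1) by force
qed simp

lemma branch_subset: assumes "i \<in> {1..N}" shows "{p i..p (i + 1)} \<subseteq> {0..1}"
  using p_mono[of 1 i] p_mono[of "i + 1" "N + 1"] assms branch_data(1,2) by auto

lemma smooth_points_eq: "{0..1} - p ` {1..N + 1} = smooth_points"
proof
  show "smooth_points \<subseteq> {0..1} - p ` {1..N + 1}"
  proof
    fix y assume "y \<in> smooth_points"
    then obtain i where i: "i \<in> {1..N}" "y \<in> branch i" by (auto simp: smooth_points_def)
    have "y \<noteq> p j" if "j \<in> {1..N + 1}" for j
      using p_mono[of j i] p_mono[of "i + 1" j] i that by (cases "j \<le> i") force+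
    then have "y \<notin> p ` {1..N + 1}" by blast
    moreover have "y \<in> {p i..p (i + 1)}" using i by simp
    ultimately show "y \<in> {0..1} - p ` {1..N + 1}" using branch_subset[OF i(1)] by blast
  qed
  show "{0..1} - p ` {1..N + 1} \<subseteq> smooth_points"
  proof
    fix x assume x: "x \<in> {0..1} - p ` {1..N + 1}"
    define A where "A = {i \<in> {1..N}. p i \<le> x}"
    have N: "N \<ge> 1" using branch_data(1,2) by (cases N) auto
    have "finite A" "1 \<in> A" using x N branch_data(1) by (auto simp: A_def)
    then have M: "Max A \<in> A" by (intro Max_in) auto
    define i where "i = Max A"
    have i: "i \<in> {1..N}" "p i \<le> x" using M by (auto simp: A_def i_def)
    have "x < p (i + 1)"
    proof (cases "i = N")
      case True
      have "N + 1 \<in> {1..N + 1}" by simp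
      then have "x \<noteq> p (N + 1)" using x by blast
      then show ?thesis using True x branch_data(2) by simp
    next
      case False
      then have "i + 1 \<notin> A" using Max_ge[OF \<open>finite A\<close>, of "i + 1"] by (auto simp: i_def)
      then show ?thesis using False i by (auto simp: A_def)
    qed
    moreover have "x \<noteq> p i" using x i by auto
    ultimately have "x \<in> branch i" using i by auto
    then show "x \<in> smooth_points" using i(1) unfolding smooth_points_def by blast
  qed
qed

lemma open_smooth_points: "open smooth_points" by (auto simp: smooth_points_def)

lemma finite_break_points: "finite ({0..1} - smooth_points)"
  unfolding smooth_points_eq[symmetric] by (rule finite_subset[of _ "p ` {1..N + 1}"]) auto

lemma branch_extension:
  assumes i: "i \<in> {1..N}"
  obtains F F1 F2 where
    "\<And>x. x \<in> branch i \<Longrightarrow> F x = f x" "F ` {p i..p (i + 1)} = {0..1}"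
    "\<And>x. x \<in> {p i..p (i + 1)} \<Longrightarrow> (F has_real_derivative F1 x) (at x within {p i..p (i + 1)})"
    "\<And>x. x \<in> {p i..p (i + 1)} \<Longrightarrow> (F1 has_real_derivative F2 x) (at x within {p i..p (i + 1)})"
    "continuous_on {p i..p (i + 1)} F" "continuous_on {p i..p (i + 1)} F1" "continuous_on {p i..p (i + 1)} F2"
proof -
  let ?S = "{p i..p (i + 1)}"
  obtain G where G: "\<forall>x\<in>branch i. G x = f x" "C_k_on r G ?S" "G ` ?S = {0..1}"
    using full_branch i unfolding full_branch_expanding_def by blast
  then obtain D :: "nat \<Rightarrow> real \<Rightarrow> real" where D: "\<forall>x\<in>?S. D 0 x = G x"
    "\<forall>k<r. \<forall>x\<in>?S. (D k has_real_derivative D (Suc k) x) (at x within ?S)" "\<forall>k\<le>r. continuous_on ?S (D k)"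
    unfolding C_k_on_def by blast
  show thesis
  proof (rule that[of "D 0" "D 1" "D 2"])
    show "D 0 x = f x" if "x \<in> branch i" for x using G(1) D(1) that by simp
    show "D 0 ` ?S = {0..1}" using image_cong[OF refl, of ?S "D 0" G] D(1) G(3) by simp
    show "(D 0 has_real_derivative D 1 x) (at x within ?S)" "(D 1 has_real_derivative D 2 x) (at x within ?S)"
      if "x \<in> ?S" for x
      using D(2)[rule_format, of 0 x] D(2)[rule_format, of 1 x] r that by (simp_all add: numeral_2_eq_2)
    show "continuous_on ?S (D 0)" "continuous_on ?S (D 1)" "continuous_on ?S (D 2)" using D(3) r by auto
  qed
qed

text \<open>
  The one-sided derivatives at the end points supply the compactness needed for uniform bounds, and
  the increasing extension sends the end points to 0 and 1.
\<close>
lemma branch_structure: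
  assumes i: "i \<in> {1..N}"
  obtains F F1 F2 where
    "\<And>x. x \<in> branch i \<Longrightarrow> F x = f x" 
    "continuous_on {p i..p (i + 1)} F" "continuous_on {p i..p (i + 1)} F1" "continuous_on {p i..p (i + 1)} F2"
    "\<And>x. x \<in> {p i..p (i + 1)} \<Longrightarrow> lam \<le> F1 x"
    "\<And>x. x \<in> branch i \<Longrightarrow> (f has_real_derivative F1 x) (at x)"
    "\<And>x. x \<in> branch i \<Longrightarrow> deriv f x = F1 x"
    "\<And>x. x \<in> branch i \<Longrightarrow> (u has_real_derivative - F2 x / (F1 x)\<^sup>2) (at x)"
    "F (p i) = 0" "F (p (i + 1)) = 1" "f ` branch i = {0<..<1}" "inj_on f (branch i)"
proof -
  let ?S = "{p i..p (i + 1)}"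
  obtain F F1 F2 where F: "\<And>x. x \<in> branch i \<Longrightarrow> F x = f x" "F ` ?S = {0..1}"
    "\<And>x. x \<in> ?S \<Longrightarrow> (F has_real_derivative F1 x) (at x within ?S)"
    "\<And>x. x \<in> ?S \<Longrightarrow> (F1 has_real_derivative F2 x) (at x within ?S)"
    "continuous_on ?S F" "continuous_on ?S F1" "continuous_on ?S F2"
    using branch_extension[OF i] by blast
  have lt: "p i < p (i + 1)" using branch_data(3)[OF i] .
  have within: "at x within ?S = at x" if "x \<in> branch i" for x
    using that by (intro at_within_interior) (simp add: interior_atLeastAtMost_real)
  have df: "(f has_real_derivative F1 x) (at x)" if x: "x \<in> branch i" for x
  proof -
    have "(F has_real_derivative F1 x) (at x)" using F(3)[of x] within[OF x] x by simp
    then show ?thesis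
      by (rule has_field_derivative_transform_within_open[of _ _ _ "branch i"]) (use x F(1) in auto)
  qed
  have deriv: "deriv f x = F1 x" if "x \<in> branch i" for x using df[OF that] by (rule DERIV_imp_deriv)
  have F1_open: "lam \<le> F1 x" if "x \<in> branch i" for x using branch_data(5)[OF i that] deriv[OF that] by simp
  have F1: "lam \<le> F1 x" if "x \<in> ?S" for x
  proof -
    have cl: "closure (branch i) = ?S" using lt by simp
    show ?thesis
      by (rule continuous_ge_on_closure[of "branch i" F1 x lam]) (use F(6) cl that F1_open in auto)
  qed
  have du: "(u has_real_derivative - F2 x / (F1 x)\<^sup>2) (at x)" if x: "x \<in> branch i" for x
  proof -
    have "(F1 has_real_derivative F2 x) (at x)" using F(4)[of x] within[OF x] x by simp
    moreover have "F1 x \<noteq> 0" using F1_open[OF x] branch_data(4) by simp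
    ultimately have "((\<lambda>x. 1 / F1 x) has_real_derivative - F2 x / (F1 x)\<^sup>2) (at x)"
      by (auto intro!: derivative_eq_intros simp: power2_eq_square)
    then show ?thesis
      by (rule has_field_derivative_transform_within_open[of _ _ _ "branch i"]) (use x deriv in auto)
  qed
  have mono: "F x < F y" if "x \<in> ?S" "y \<in> ?S" "x < y" for x y
  proof (rule DERIV_pos_imp_increasing_open[OF that(3)])
    fix t assume t: "x < t" "t < y"
    then have tb: "t \<in> branch i" using that by auto
    have "(F has_real_derivative F1 t) (at t)" using F(3)[of t] within[OF tb] tb by simp
    moreover have "F1 t > 0" using F1_open[OF tb] branch_data(4) by simp
    ultimately show "\<exists>y. (F has_real_derivative y) (at t) \<and> y > 0" by blast
  next
    show "continuous_on {x..y} F" by (rule continuous_on_subset[OF F(5)]) (use that in auto)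
  qed
  have ends: "p i \<in> ?S" "p (i + 1) \<in> ?S" using lt by auto
  have F0: "F (p i) = 0"
  proof -
    obtain x where x: "x \<in> ?S" "F x = 0" using F(2) by (metis atLeastAtMost_iff imageE order_refl zero_le_one)
    have "0 \<le> F (p i)" using F(2) ends(1) by (metis atLeastAtMost_iff imageI)
    then show ?thesis using mono[OF ends(1) x(1)] x by (cases "x = p i") force+
  qed
  have Fe: "F (p (i + 1)) = 1"
  proof -
    obtain x where x: "x \<in> ?S" "F x = 1" using F(2) by (metis atLeastAtMost_iff imageE order_refl zero_le_one)
    have "F (p (i + 1)) \<le> 1" using F(2) ends(2) by (metis atLeastAtMost_iff imageI)
    then show ?thesis using mono[OF x(1) ends(2)] x by (cases "x = p (i + 1)") force+
  qed
  have img: "f ` branch i = {0<..<1}"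
  proof
    show "f ` branch i \<subseteq> {0<..<1}"
    proof
      fix y assume "y \<in> f ` branch i"
      then obtain x where x: "x \<in> branch i" "y = F x" using F(1) by auto
      then show "y \<in> {0<..<1}" using mono[OF ends(1), of x] mono[OF _ ends(2), of x] F0 Fe by auto
    qed
    show "{0<..<1} \<subseteq> f ` branch i"
    proof
      fix y :: real assume y: "y \<in> {0<..<1}"
      then have "y \<in> F ` ?S" using F(2) by simp
      then obtain x where x: "x \<in> ?S" "y = F x" by blast
      have "x \<noteq> p i" "x \<noteq> p (i + 1)" using x y F0 Fe by auto
      then have "x \<in> branch i" using x by auto
      then show "y \<in> f ` branch i" using x F(1) by auto
    qed
  qed
  have inj: "inj_on f (branch i)"
  proof (rule inj_onI)
    fix x y assume "x \<in> branch i" "y \<in> branch i" "f x = f y"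
    then show "x = y" using mono[of x y] mono[of y x] F(1)[of x] F(1)[of y] by (cases x y rule: linorder_cases) auto
  qed
  show thesis by (rule that[OF F(1,5,6,7) F1 df deriv du F0 Fe img inj])
qed

lemma smooth_pointE:
  assumes "x \<in> smooth_points" obtains i where "i \<in> {1..N}" "x \<in> branch i"
  using assms by (auto simp: smooth_points_def)

lemma deriv_f:
  assumes x: "x \<in> smooth_points"
  shows "(f has_real_derivative deriv f x) (at x)" "lam < deriv f x" "f x \<in> {0<..<1}"
    "(u has_real_derivative deriv u x) (at x)"
proof -
  obtain i where i: "i \<in> {1..N}" "x \<in> branch i" using x by (rule smooth_pointE)
  have "(f has_real_derivative deriv f x) (at x) \<and> f x \<in> {0<..<1} \<and> (u has_real_derivative deriv u x) (at x)"
  proof (rule branch_structure[OF i(1)])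
    fix F F1 F2
    assume df: "\<And>x. x \<in> branch i \<Longrightarrow> (f has_real_derivative F1 x) (at x)"
      "\<And>x. x \<in> branch i \<Longrightarrow> deriv f x = F1 x"
      and du: "\<And>x. x \<in> branch i \<Longrightarrow> (u has_real_derivative - F2 x / (F1 x)\<^sup>2) (at x)"
      and img: "f ` branch i = {0<..<1}"
    have "deriv u x = - F2 x / (F1 x)\<^sup>2" by (rule DERIV_imp_deriv[OF du[OF i(2)]])
    moreover have "f x \<in> {0<..<1}" using img i(2) by blast
    ultimately show ?thesis using df[OF i(2)] du[OF i(2)] by simp
  qed
  then show "(f has_real_derivative deriv f x) (at x)" "f x \<in> {0<..<1}" "(u has_real_derivative deriv u x) (at x)"
    by blast+
  show "lam < deriv f x" by (rule branch_data(5)[OF i])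
qed

lemma u_bound: assumes "x \<in> smooth_points" shows "0 < u x" "u x \<le> inverse lam"
  using deriv_f(2)[OF assms] branch_data(4) by (auto simp: field_simps)

lemma continuous_smooth: "continuous_on smooth_points f" "continuous_on smooth_points u"
  by (rule DERIV_continuous_on, rule has_field_derivative_at_within, erule deriv_f)+

lemma deriv_u_continuous_bounded:
  shows "continuous_on smooth_points (deriv u)" "\<exists>C>0. \<forall>x\<in>smooth_points. \<bar>deriv u x\<bar> \<le> C"
proof -
  have *: "continuous_on (branch i) (deriv u) \<and> (\<exists>C. \<forall>x\<in>branch i. \<bar>deriv u x\<bar> \<le> C)" if i: "i \<in> {1..N}" for i
  proof -
    let ?S = "{p i..p (i + 1)}"
    show ?thesis
    proof (rule branch_structure[OF i])
    fix F F1 F2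
    assume F: "continuous_on ?S F1" "continuous_on ?S F2"
      "\<And>x. x \<in> ?S \<Longrightarrow> lam \<le> F1 x"
      "\<And>x. x \<in> branch i \<Longrightarrow> (u has_real_derivative - F2 x / (F1 x)\<^sup>2) (at x)"
    have eq: "deriv u x = - F2 x / (F1 x)\<^sup>2" if "x \<in> branch i" for x using F(4)[OF that] by (rule DERIV_imp_deriv)
    have "F1 x \<noteq> 0" if "x \<in> ?S" for x using F(3)[OF that] branch_data(4) by simp
    then have cont: "continuous_on ?S (\<lambda>x. - F2 x / (F1 x)\<^sup>2)" using F(1,2) by (intro continuous_intros) auto
    then have "bounded ((\<lambda>x. - F2 x / (F1 x)\<^sup>2) ` ?S)" by (intro compact_imp_bounded compact_continuous_image) auto
    then obtain C where "\<forall>y\<in>(\<lambda>x. - F2 x / (F1 x)\<^sup>2) ` ?S. norm y \<le> C" unfolding bounded_iff by blast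
    then have C: "\<bar>- F2 x / (F1 x)\<^sup>2\<bar> \<le> C" if "x \<in> ?S" for x using that by fastforce
    have "continuous_on (branch i) (\<lambda>x. - F2 x / (F1 x)\<^sup>2)" by (rule continuous_on_subset[OF cont]) auto
    then have "continuous_on (branch i) (deriv u)" by (rule continuous_on_eq) (rule eq[symmetric])
    moreover have "\<forall>x\<in>branch i. \<bar>deriv u x\<bar> \<le> C"
    proof
      fix x assume x: "x \<in> branch i"
      then have "x \<in> ?S" by simp
      from C[OF this] show "\<bar>deriv u x\<bar> \<le> C" unfolding eq[OF x] .
    qed
    ultimately show ?thesis by blast
    qed
  qed
  show "continuous_on smooth_points (deriv u)"
    unfolding smooth_points_def using * by (intro continuous_on_open_UN) auto
  have "\<forall>i. \<exists>C. i \<in> {1..N} \<longrightarrow> (\<forall>x\<in>branch i. \<bar>deriv u x\<bar> \<le> C)" using * by blast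
  from choice[OF this] obtain C where C: "\<And>i x. i \<in> {1..N} \<Longrightarrow> x \<in> branch i \<Longrightarrow> \<bar>deriv u x\<bar> \<le> C i" by blast
  have "\<bar>deriv u x\<bar> \<le> (\<Sum>i\<in>{1..N}. \<bar>C i\<bar>) + 1" if "x \<in> smooth_points" for x
  proof -
    obtain i where i: "i \<in> {1..N}" "x \<in> branch i" using \<open>x \<in> smooth_points\<close> by (rule smooth_pointE)
    have "\<bar>deriv u x\<bar> \<le> \<bar>C i\<bar>" using C[OF i] by simp
    also have "\<dots> \<le> (\<Sum>i\<in>{1..N}. \<bar>C i\<bar>)" using i(1) by (intro member_le_sum) auto
    finally show ?thesis by simp
  qed
  moreover have "(\<Sum>i\<in>{1..N}. \<bar>C i\<bar>) + 1 > 0" by (intro add_nonneg_pos sum_nonneg) auto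
  ultimately show "\<exists>C>0. \<forall>x\<in>smooth_points. \<bar>deriv u x\<bar> \<le> C" by blast
qed

lemma smooth_subset: "smooth_points \<subseteq> {0..1}" using smooth_points_eq by blast

lemma AE_smooth: "AE x in \<mu>. x \<in> smooth_points"
proof -
  have "finite ({0..1} - smooth_points)" by (rule finite_break_points)
  then have "AE x in lebesgue. x \<notin> {0..1} - smooth_points"
    by (intro AE_not_in null_sets_completionI finite_imp_null_set_lborel)
  then show ?thesis unfolding AE_unit by eventually_elim auto
qed

lemma measurable_smooth:
  fixes v :: "real \<Rightarrow> real" assumes v: "continuous_on smooth_points v" shows "v \<in> borel_measurable \<mu>"
proof -
  have "(\<lambda>x. indicator smooth_points x *\<^sub>R v x) \<in> borel_measurable \<mu>"
    using v open_smooth_points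
    by (intro borel_measurable_unit borel_measurable_continuous_on_indicator) auto
  then show ?thesis
    by (rule measurable_discrete_difference[where X = "{0..1} - smooth_points"])
      (use finite_break_points in \<open>auto simp: sets_restrict_space countable_finite intro: image_eqI[of _ _ "{_}"]\<close>)
qed

lemma integrable_mult_smooth:
  fixes v :: "real \<Rightarrow> real" and k :: "real \<Rightarrow> complex"
  assumes k: "integrable \<mu> k" and v: "continuous_on smooth_points v" "\<And>x. x \<in> smooth_points \<Longrightarrow> \<bar>v x\<bar> \<le> B"
  shows "integrable \<mu> (\<lambda>x. k x * of_real (v x))"
proof (rule Bochner_Integration.integrable_bound[where f = "\<lambda>x. B * norm (k x)"])
  show "integrable \<mu> (\<lambda>x. B * norm (k x))" using k by simp
  show "(\<lambda>x. k x * of_real (v x)) \<in> borel_measurable \<mu>"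
    using k by (intro borel_measurable_times borel_measurable_integrable
        measurable_compose[OF measurable_smooth[OF v(1)] borel_measurable_of_real])
  show "AE x in \<mu>. norm (k x * of_real (v x)) \<le> norm (B * norm (k x))"
    using AE_smooth
  proof eventually_elim
    fix x assume "x \<in> smooth_points"
    then have "norm (k x) * \<bar>v x\<bar> \<le> norm (k x) * B" using v(2) by (intro mult_left_mono) auto
    also have "\<dots> \<le> norm (B * norm (k x))" by (simp add: mult.commute)
    finally show "norm (k x * of_real (v x)) \<le> norm (B * norm (k x))" by (simp add: norm_mult)
  qed
qed

end

section \<open>The transfer operator and weak derivatives\<close>

context expanding_map begin

lemma branch_image: assumes "i \<in> {1..N}" shows "f ` branch i = {0<..<1}" "inj_on f (branch i)"
  using branch_structure[OF assms] by blast+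

lemma branches_disjoint: "disjoint_family_on branch {1..N}"
  unfolding disjoint_family_on_def
proof (intro ballI impI)
  have *: "branch i \<inter> branch j = {}" if "i \<in> {1..N}" "j \<in> {1..N}" "i < j" for i j
    using p_mono[of "i + 1" j] that by auto
  fix i j assume "i \<in> {1..N}" "j \<in> {1..N}" "i \<noteq> j"
  then show "branch i \<inter> branch j = {}" using *[of i j] *[of j i] by (cases "i < j") auto
qed

lemma transfer_eq: "L k x = (\<Sum>y\<in>{y \<in> smooth_points. f y = x}. k y / of_real (deriv f y))"
  unfolding transfer_operator_def smooth_points_eq ..

lemma transfer_lin: "L (\<lambda>y. a * h y + b * k y) x = a * L h x + b * L k x"
  unfolding transfer_eq sum_distrib_left sum.distrib[symmetric]
  by (rule sum.cong) (auto simp: add_divide_distrib)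

lemma transfer_sum: "L (\<lambda>y. \<Sum>j\<in>J. a j * h j y) x = (\<Sum>j\<in>J. a j * L (h j) x)"
proof -
  have "L (\<lambda>y. \<Sum>j\<in>J. a j * h j y) x = (\<Sum>y\<in>{y \<in> smooth_points. f y = x}. \<Sum>j\<in>J. a j * h j y / of_real (deriv f y))"
    unfolding transfer_eq by (simp add: sum_divide_distrib)
  also have "\<dots> = (\<Sum>j\<in>J. \<Sum>y\<in>{y \<in> smooth_points. f y = x}. a j * h j y / of_real (deriv f y))" by (rule sum.swap)
  finally show ?thesis unfolding transfer_eq sum_distrib_left by simp
qed

lemma transfer_cong: "(\<And>y. y \<in> smooth_points \<Longrightarrow> h y = k y) \<Longrightarrow> L h = L k"
  unfolding fun_eq_iff transfer_eq by (auto intro!: sum.cong)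

lemma transfer_mult: "L (\<lambda>y. k y * of_real (\<phi> (f y))) x = L k x * of_real (\<phi> x)"
  unfolding transfer_eq sum_distrib_right by (rule sum.cong) auto

lemma transfer_outside: "x \<notin> {0<..<1} \<Longrightarrow> L k x = 0"
  using deriv_f(3) unfolding transfer_eq by (intro sum.neutral) blast

lemma transfer_branches:
  assumes x: "x \<in> {0<..<1}"
  shows "L k x = (\<Sum>i\<in>{1..N}. k (the_inv_into (branch i) f x) / of_real (deriv f (the_inv_into (branch i) f x)))"
proof -
  define \<psi> where "\<psi> i = the_inv_into (branch i) f x" for i
  have \<psi>: "\<psi> i \<in> branch i" "f (\<psi> i) = x" if "i \<in> {1..N}" for i
  proof -
    have "x \<in> f ` branch i" using branch_image(1)[OF that] x by simp
    then show "\<psi> i \<in> branch i" "f (\<psi> i) = x"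
      unfolding \<psi>_def using the_inv_into_into[OF branch_image(2)[OF that]] f_the_inv_into_f[OF branch_image(2)[OF that]] by blast+
  qed
  have fib: "{y \<in> smooth_points. f y = x} = \<psi> ` {1..N}"
  proof
    show "\<psi> ` {1..N} \<subseteq> {y \<in> smooth_points. f y = x}" using \<psi> unfolding smooth_points_def by blast
    show "{y \<in> smooth_points. f y = x} \<subseteq> \<psi> ` {1..N}"
    proof
      fix y assume "y \<in> {y \<in> smooth_points. f y = x}"
      then obtain i where i: "i \<in> {1..N}" "y \<in> branch i" "f y = x" by (auto elim: smooth_pointE)
      then have "y = \<psi> i" using inj_onD[OF branch_image(2)[OF i(1)], of y "\<psi> i"] \<psi>[OF i(1)] by simp
      then show "y \<in> \<psi> ` {1..N}" using i(1) by blast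
    qed
  qed
  have inj: "inj_on \<psi> {1..N}"
  proof (rule inj_onI, rule ccontr)
    fix i j assume ij: "i \<in> {1..N}" "j \<in> {1..N}" "\<psi> i = \<psi> j" "i \<noteq> j"
    then have "branch i \<inter> branch j = {}" using branches_disjoint unfolding disjoint_family_on_def by blast
    then show False using \<psi>(1)[OF ij(1)] \<psi>(1)[OF ij(2)] ij(3) by auto
  qed
  show ?thesis unfolding transfer_eq fib sum.reindex[OF inj] by (simp add: \<psi>_def)
qed

lemma set_integrable_unit: "integrable \<mu> k \<longleftrightarrow> set_integrable lebesgue {0..1} k" for k :: "real \<Rightarrow> complex"
  unfolding set_integrable_def by (rule integrable_unit)

lemma branch_change_of_variables:
  fixes k :: "real \<Rightarrow> complex"
  assumes i: "i \<in> {1..N}" and k: "k absolutely_integrable_on branch i"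
  defines "b \<equiv> \<lambda>x. k (the_inv_into (branch i) f x) / of_real (deriv f (the_inv_into (branch i) f x))"
  shows "b absolutely_integrable_on {0<..<1}" "integral {0<..<1} b = integral (branch i) k"
proof -
  have der: "(f has_field_derivative deriv f y) (at y within branch i)" if "y \<in> branch i" for y
  proof -
    have "y \<in> smooth_points" using that i unfolding smooth_points_def by blast
    then show ?thesis by (rule has_field_derivative_at_within[OF deriv_f(1)])
  qed
  have eq: "\<bar>deriv f y\<bar> *\<^sub>R b (f y) = k y" if "y \<in> branch i" for y
    using branch_data(4) branch_data(5)[OF i that] the_inv_into_f_f[OF branch_image(2)[OF i] that]
    by (simp add: b_def scaleR_conv_of_real)
  have "(\<lambda>y. \<bar>deriv f y\<bar> *\<^sub>R b (f y)) absolutely_integrable_on branch i"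
    using k by (subst set_integrable_cong[OF refl refl eq]) auto
  moreover have "integral (branch i) (\<lambda>y. \<bar>deriv f y\<bar> *\<^sub>R b (f y)) = integral (branch i) k"
    by (rule integral_cong) (rule eq)
  ultimately show "b absolutely_integrable_on {0<..<1}" "integral {0<..<1} b = integral (branch i) k"
    using has_absolute_integral_change_of_variables_real[OF _ der branch_image(2)[OF i], of b "integral (branch i) k"]
    unfolding branch_image(1)[OF i] by auto
qed

text \<open>
  On each branch, \<open>x = f y\<close> turns the integral of a summand over \<open>{0..1}\<close> into the integral of \<open>k\<close>
  over the branch.
\<close>
lemma transfer_integral:
  assumes k: "integrable \<mu> k"
  shows "integrable \<mu> (L k)" "(LINT x|\<mu>. L k x) = (LINT x|\<mu>. k x)"
proof -
  define b where "b i x = k (the_inv_into (branch i) f x) / of_real (deriv f (the_inv_into (branch i) f x))" for i x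
  have k01: "set_integrable lebesgue {0..1} k" using k by (simp add: set_integrable_unit)
  have ki: "k absolutely_integrable_on branch i" if "i \<in> {1..N}" for i
    by (rule set_integrable_subset[OF k01]) (use branch_subset[OF that] in auto)
  have b: "b i absolutely_integrable_on {0<..<1}" "integral {0<..<1} (b i) = integral (branch i) k" if "i \<in> {1..N}" for i
    using branch_change_of_variables[OF that ki[OF that]] by (simp_all add: b_def[abs_def])
  have eq: "indicator {0..1} x *\<^sub>R L k x = (\<Sum>i\<in>{1..N}. indicator {0<..<1} x *\<^sub>R b i x)" for x
    using transfer_branches[of x k] transfer_outside[of x k] by (cases "x \<in> {0<..<1}") (auto simp: b_def indicator_def)
  have bi: "integrable lebesgue (\<lambda>x. indicator {0<..<1} x *\<^sub>R b i x)" if "i \<in> {1..N}" for i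
    using b(1)[OF that] by (simp add: set_integrable_def)
  then show "integrable \<mu> (L k)" unfolding integrable_unit eq by (intro Bochner_Integration.integrable_sum)
  have "(LINT x|\<mu>. L k x) = (\<Sum>i\<in>{1..N}. LINT x:{0<..<1}|lebesgue. b i x)"
    unfolding integral_unit eq set_lebesgue_integral_def by (rule Bochner_Integration.integral_sum[OF bi])
  also have "\<dots> = (\<Sum>i\<in>{1..N}. LINT x:branch i|lebesgue. k x)"
  proof (rule sum.cong[OF refl])
    fix i assume i: "i \<in> {1..N}"
    show "(LINT x:{0<..<1}|lebesgue. b i x) = (LINT x:branch i|lebesgue. k x)"
      using b[OF i] ki[OF i] by (simp add: set_lebesgue_integral_eq_integral)
  qed
  also have "\<dots> = (LINT x:smooth_points|lebesgue. k x)"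
    unfolding smooth_points_def
    by (rule set_integral_finite_Union[symmetric]) (use ki branches_disjoint in auto)
  also have "\<dots> = (LINT x|\<mu>. k x)"
  proof -
    have "(LINT x:smooth_points|lebesgue. k x) = (LINT x|\<mu>. indicator smooth_points x *\<^sub>R k x)"
      unfolding integral_unit set_lebesgue_integral_def
      by (rule Bochner_Integration.integral_cong) (use smooth_subset in \<open>auto simp: indicator_def\<close>)
    also have "\<dots> = (LINT x|\<mu>. k x)"
    proof (rule integral_cong_AE)
      show "(\<lambda>x. indicator smooth_points x *\<^sub>R k x) \<in> borel_measurable \<mu>"
        using open_smooth_points
        by (intro borel_measurable_scaleR[OF borel_measurable_unit borel_measurable_integrable[OF k]]) simp
      show "AE x in \<mu>. indicator smooth_points x *\<^sub>R k x = k x" using AE_smooth by eventually_elim simp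
    qed (use k in auto)
    finally show ?thesis .
  qed
  finally show "(LINT x|\<mu>. L k x) = (LINT x|\<mu>. k x)" .
qed

text \<open>
  Pointwise the modulus of \<open>L k\<close> is at most \<open>L\<close> of the modulus of \<open>k\<close>, and \<open>L\<close> preserves integrals.
\<close>
lemma transfer_norm:
  assumes k: "integrable \<mu> k" shows "(LINT x|\<mu>. norm (L k x)) \<le> (LINT x|\<mu>. norm (k x))"
proof -
  let ?a = "\<lambda>y. complex_of_real (norm (k y))"
  have a: "integrable \<mu> ?a" using k by (intro integrable_of_real) simp
  have "norm (L k x) \<le> Re (L ?a x)" for x
  proof -
    have "norm (L k x) \<le> (\<Sum>y\<in>{y \<in> smooth_points. f y = x}. norm (k y) / deriv f y)"
      unfolding transfer_eq
    proof (rule order_trans[OF norm_sum], rule sum_mono)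
      fix y assume "y \<in> {y \<in> smooth_points. f y = x}"
      then have "0 < deriv f y" using deriv_f(2)[of y] branch_data(4) by auto
      then show "norm (k y / of_real (deriv f y)) \<le> norm (k y) / deriv f y" by (simp add: norm_divide)
    qed
    then show ?thesis unfolding transfer_eq by simp
  qed
  then have "(LINT x|\<mu>. norm (L k x)) \<le> (LINT x|\<mu>. Re (L ?a x))"
    using transfer_integral(1)[OF k] transfer_integral(1)[OF a] by (intro integral_mono) auto
  also have "\<dots> = Re (LINT x|\<mu>. L ?a x)" using transfer_integral(1)[OF a] by (rule integral_Re)
  also have "\<dots> = (LINT x|\<mu>. norm (k x))" unfolding transfer_integral(2)[OF a] by simp
  finally show ?thesis .
qed

text \<open>
  The map \<open>f\<close> jumps at the break points, but it approaches 0 or 1 there, where \<open>\<phi>\<close> vanishes.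
\<close>
lemma transported_test_function_continuous:
  assumes \<phi>: "test_function \<phi>"
  shows "continuous_on {0..1} (\<lambda>x. if x \<in> smooth_points then u x * \<phi> (f x) else 0)" (is "continuous_on _ ?w")
proof -
  have cont: "continuous_on {p i..p (i + 1)} ?w" if i: "i \<in> {1..N}" for i
  proof (rule branch_structure[OF i])
    let ?S = "{p i..p (i + 1)}"
    fix F F1 F2
    assume F: "\<And>x. x \<in> branch i \<Longrightarrow> F x = f x" "continuous_on ?S F" "continuous_on ?S F1"
      "\<And>x. x \<in> ?S \<Longrightarrow> lam \<le> F1 x" "\<And>x. x \<in> branch i \<Longrightarrow> deriv f x = F1 x" "F (p i) = 0" "F (p (i + 1)) = 1"
    have "F1 x \<noteq> 0" if "x \<in> ?S" for x using F(4)[OF that] branch_data(4) by simp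
    moreover have "continuous_on ?S (\<lambda>x. \<phi> (F x))"
      by (rule continuous_on_compose2[OF test_function_derivative(3)[OF \<phi>] F(2)]) simp
    ultimately have "continuous_on ?S (\<lambda>x. (1 / F1 x) * \<phi> (F x))" using F(3) by (intro continuous_intros) auto
    then show "continuous_on ?S ?w"
    proof (rule continuous_on_eq)
      fix x assume x: "x \<in> ?S"
      show "(1 / F1 x) * \<phi> (F x) = ?w x"
      proof (cases "x \<in> branch i")
        case True
        then have "x \<in> smooth_points" using i unfolding smooth_points_def by blast
        then show ?thesis using F(1,5)[OF True] by simp
      next
        case False
        then have e: "x = p i \<or> x = p (i + 1)" using x by auto
        have "i \<in> {1..N + 1}" "i + 1 \<in> {1..N + 1}" using i by auto
        then have "x \<notin> smooth_points" unfolding smooth_points_eq[symmetric] using e by blast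
        then show ?thesis using e F(6,7) test_function_boundary[OF \<phi>] by auto
      qed
    qed
  qed
  have "{0..1} = (\<Union>i\<in>{1..N}. {p i..p (i + 1)})"
  proof
    show "(\<Union>i\<in>{1..N}. {p i..p (i + 1)}) \<subseteq> {0..1}" using branch_subset by blast
    show "{0..1} \<subseteq> (\<Union>i\<in>{1..N}. {p i..p (i + 1)})"
    proof
      fix x :: real assume x: "x \<in> {0..1}"
      show "x \<in> (\<Union>i\<in>{1..N}. {p i..p (i + 1)})"
      proof (cases "x \<in> smooth_points")
        case True
        then obtain i where "i \<in> {1..N}" "x \<in> branch i" by (rule smooth_pointE)
        then show ?thesis by (intro UN_I[of i]) auto
      next
        case False
        then obtain j where j: "j \<in> {1..N + 1}" "x = p j" using x smooth_points_eq by blast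
        have N: "N \<ge> 1" using branch_data(1,2) by (cases N) auto
        show ?thesis
        proof (cases "j \<le> N")
          case True
          then show ?thesis using j branch_data(3)[of j] by (intro UN_I[of j]) auto
        next
          case False
          then have "j = N + 1" using j by simp
          then show ?thesis using j branch_data(3)[of N] N by (intro UN_I[of N]) auto
        qed
      qed
    qed
  qed
  then show ?thesis using cont by (simp only:) (rule continuous_on_closed_Union, auto)
qed

text \<open>
  The function \<open>w = u (\<phi> \<circ> f)\<close> is continuous on \<open>{0..1}\<close>, vanishes at 0 and 1, and has derivative
  \<open>w' = \<phi>' \<circ> f + u' (\<phi> \<circ> f)\<close> outside the break points, because \<open>u f' = 1\<close>.
\<close>
lemma transported_by_parts:
  fixes g :: "real \<Rightarrow> complex"
  assumes \<phi>: "test_function \<phi>" and g: "integrable \<mu> g"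
  defines "w' \<equiv> \<lambda>x. if x \<in> smooth_points then deriv \<phi> (f x) + deriv u x * \<phi> (f x) else 0"
  shows "(LINT x|\<mu>. (c + centred_primitive g x) * of_real (w' x)) = - (LINT x|\<mu>. g x * of_real (u x * \<phi> (f x)))"
    and "integrable \<mu> (\<lambda>x. (c + centred_primitive g x) * of_real (w' x))"
proof -
  define w where "w x = (if x \<in> smooth_points then u x * \<phi> (f x) else 0)" for x
  have w_cont: "continuous_on {0..1} w"
    using transported_test_function_continuous[OF \<phi>] by (simp add: w_def[abs_def])
  obtain B where B: "\<And>x. x \<in> {0..1} \<Longrightarrow> \<bar>\<phi> x\<bar> \<le> B" "\<And>x. x \<in> {0..1} \<Longrightarrow> \<bar>deriv \<phi> x\<bar> \<le> B"
    using test_function_bounded[OF \<phi>] by blast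
  obtain C where C: "C > 0" "\<And>x. x \<in> smooth_points \<Longrightarrow> \<bar>deriv u x\<bar> \<le> C"
    using deriv_u_continuous_bounded(2) by blast
  have B0: "0 \<le> B" using B(1)[of 0] by simp
  have w'_bound: "\<bar>w' x\<bar> \<le> B + C * B" for x
  proof (cases "x \<in> smooth_points")
    case True
    then have fx: "f x \<in> {0..1}" using deriv_f(3)[OF True] by auto
    have "\<bar>w' x\<bar> \<le> \<bar>deriv \<phi> (f x)\<bar> + \<bar>deriv u x\<bar> * \<bar>\<phi> (f x)\<bar>"
      using True by (simp add: w'_def flip: abs_mult)
    also have "\<dots> \<le> B + C * B" using B[OF fx] C True by (intro add_mono mult_mono) auto
    finally show ?thesis .
  next
    case False then show ?thesis using B0 C(1) by (simp add: w'_def)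
  qed
  have comp: "continuous_on smooth_points (\<lambda>x. \<phi> (f x))" "continuous_on smooth_points (\<lambda>x. deriv \<phi> (f x))"
    by (rule continuous_on_compose2[OF _ continuous_smooth(1)], rule test_function_derivative[OF \<phi>], simp)+
  have "continuous_on smooth_points (\<lambda>x. deriv \<phi> (f x) + deriv u x * \<phi> (f x))"
    by (intro continuous_intros comp deriv_u_continuous_bounded)
  then have "continuous_on smooth_points w'" by (rule continuous_on_eq) (simp add: w'_def)
  then have w'_meas: "w' \<in> borel_measurable \<mu>" by (rule measurable_smooth)
  have ftc: "(w' has_integral (- w y)) {y..1}" if y: "y \<in> {0..1}" for y
  proof -
    have "(w' has_integral (w 1 - w y)) {y..1}"
    proof (rule fundamental_theorem_of_calculus_interior_strong[OF finite_break_points])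
      fix x assume "x \<in> {y<..<1} - ({0..1} - smooth_points)"
      then have x: "x \<in> smooth_points" using y by auto
      have "((\<lambda>x. u x * \<phi> (f x)) has_real_derivative u x * (deriv \<phi> (f x) * deriv f x) + deriv u x * \<phi> (f x)) (at x)"
        using DERIV_mult[OF deriv_f(4)[OF x] DERIV_chain2[OF test_function_derivative(1)[OF \<phi>] deriv_f(1)[OF x]]]
        by (simp add: add.commute)
      moreover have "u x * (deriv \<phi> (f x) * deriv f x) + deriv u x * \<phi> (f x) = w' x"
        using x deriv_f(2)[OF x] branch_data(4) by (simp add: w'_def)
      ultimately have "((\<lambda>x. u x * \<phi> (f x)) has_real_derivative w' x) (at x)" by simp
      then have "(w has_real_derivative w' x) (at x)"
        by (rule has_field_derivative_transform_within_open[OF _ open_smooth_points x]) (simp add: w_def)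
      then show "(w has_vector_derivative w' x) (at x)" by (simp add: has_real_derivative_iff_has_vector_derivative)
    qed (use y in \<open>auto intro: continuous_on_subset[OF w_cont]\<close>)
    moreover have "w 1 = 0"
    proof -
      have "1 \<in> p ` {1..N + 1}" using branch_data(2) by (intro image_eqI[of _ _ "N + 1"]) auto
      then have "1 \<notin> smooth_points" unfolding smooth_points_eq[symmetric] by blast
      then show ?thesis by (simp add: w_def)
    qed
    ultimately show ?thesis by simp
  qed
  have w'_mean: "(LINT x|\<mu>. w' x) = 0"
  proof -
    have "integrable \<mu> w'"
      by (rule unit.integrable_const_bound[where B = "B + C * B"]) (use w'_bound w'_meas in auto)
    then have "(LINT x|\<mu>. w' x) = integral {0..1} w'" by (rule lebesgue_integral_eq_integral) simp
    moreover have "0 \<in> p ` {1..N + 1}" using branch_data(1) by (intro image_eqI[of _ _ 1]) auto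
    then have "0 \<notin> smooth_points" unfolding smooth_points_eq[symmetric] by blast
    then have "w 0 = 0" by (simp add: w_def)
    ultimately show ?thesis using ftc[of 0] by (simp add: integral_unique)
  qed
  note pi = primitive_integrable[OF g]
  define d where "d = c - (LINT y|\<mu>. primitive g y)"
  have cd: "c + centred_primitive g x = d + primitive g x" for x by (simp add: d_def centred_primitive_def)
  have int: "integrable \<mu> (\<lambda>x. k x * of_real (w' x))" if "integrable \<mu> k" for k :: "real \<Rightarrow> complex"
    by (rule integrable_bounded_mult[OF that w'_meas w'_bound])
  show "integrable \<mu> (\<lambda>x. (c + centred_primitive g x) * of_real (w' x))"
    by (rule int) (use centred_primitive_integrable[OF g] in auto)
  have "(LINT x|\<mu>. (c + centred_primitive g x) * of_real (w' x)) =
      d * of_real (LINT x|\<mu>. w' x) + (LINT x|\<mu>. primitive g x * of_real (w' x))"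
    unfolding cd using int[OF pi] int[OF unit.integrable_const[of d]] by (simp add: distrib_right)
  also have "\<dots> = - (LINT t|\<mu>. g t * of_real (w t))"
    unfolding w'_mean using primitive_by_parts[OF g w'_meas w'_bound ftc] by simp
  also have "(LINT t|\<mu>. g t * of_real (w t)) = (LINT x|\<mu>. g x * of_real (u x * \<phi> (f x)))"
  proof (rule integral_cong_AE)
    have m1: "w \<in> borel_measurable \<mu>" by (rule measurable_smooth[OF continuous_on_subset[OF w_cont smooth_subset]])
    have m2: "(\<lambda>x. u x * \<phi> (f x)) \<in> borel_measurable \<mu>"
      by (rule measurable_smooth[OF continuous_on_mult[OF continuous_smooth(2) comp(1)]])
    note m = borel_measurable_times[OF borel_measurable_integrable[OF g] measurable_compose[OF _ borel_measurable_of_real]]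
    show "(\<lambda>t. g t * of_real (w t)) \<in> borel_measurable \<mu>" by (rule m[OF m1])
    show "(\<lambda>x. g x * of_real (u x * \<phi> (f x))) \<in> borel_measurable \<mu>" by (rule m[OF m2])
    show "AE x in \<mu>. g x * of_real (w x) = g x * of_real (u x * \<phi> (f x))"
      using AE_smooth by eventually_elim (simp add: w_def)
  qed
  finally show "(LINT x|\<mu>. (c + centred_primitive g x) * of_real (w' x)) = - (LINT x|\<mu>. g x * of_real (u x * \<phi> (f x)))" .
qed

lemma weak_derivative_integrand:
  fixes h g :: "real \<Rightarrow> complex"
  assumes "integrable \<mu> h" "integrable \<mu> g"
  shows "integrable \<mu> (\<lambda>y. g y * of_real (u y))" "integrable \<mu> (\<lambda>y. h y * of_real (deriv u y))"
proof -
  show "integrable \<mu> (\<lambda>y. g y * of_real (u y))"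
    by (rule integrable_mult_smooth[OF assms(2) continuous_smooth(2), of "inverse lam"])
      (use u_bound in \<open>auto simp: less_imp_le\<close>)
  obtain C where "\<And>x. x \<in> smooth_points \<Longrightarrow> \<bar>deriv u x\<bar> \<le> C" using deriv_u_continuous_bounded(2) by blast
  then show "integrable \<mu> (\<lambda>y. h y * of_real (deriv u y))"
    by (rule integrable_mult_smooth[OF assms(1) deriv_u_continuous_bounded(1)])
qed

text \<open>
  The product rule for \<open>L h\<close>, by duality: the integral of \<open>L h \<phi>'\<close> is that of \<open>h (\<phi>' \<circ> f)\<close>, and
  \<open>\<phi>' \<circ> f = (u (\<phi> \<circ> f))' - u' (\<phi> \<circ> f)\<close>.
\<close>
lemma weak_derivative_transfer:
  assumes h: "integrable \<mu> h" and g: "weak_derivative h g"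
  shows "weak_derivative (L h) (L (\<lambda>y. g y * of_real (u y) + h y * of_real (deriv u y)))" (is "weak_derivative _ (L ?k)")
proof -
  have gi: "integrable \<mu> g" using g by (simp add: weak_derivative_def)
  note int = weak_derivative_integrand[OF h gi]
  have k: "integrable \<mu> ?k" using int by simp
  have "(LINT x|\<mu>. L h x * of_real (deriv \<phi> x)) = - (LINT x|\<mu>. L ?k x * of_real (\<phi> x))" if \<phi>: "test_function \<phi>" for \<phi>
  proof -
    obtain B where B: "\<And>x. x \<in> {0..1} \<Longrightarrow> \<bar>\<phi> x\<bar> \<le> B" "\<And>x. x \<in> {0..1} \<Longrightarrow> \<bar>deriv \<phi> x\<bar> \<le> B"
      using test_function_bounded[OF \<phi>] by blast
    have fx: "f x \<in> {0..1}" if "x \<in> smooth_points" for x using deriv_f(3)[OF that] by auto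
    have comp: "continuous_on smooth_points (\<lambda>x. \<phi> (f x))" "continuous_on smooth_points (\<lambda>x. deriv \<phi> (f x))"
      by (rule continuous_on_compose2[OF _ continuous_smooth(1)], rule test_function_derivative[OF \<phi>], simp)+
    have int_\<phi>: "integrable \<mu> (\<lambda>x. k x * of_real (\<phi> (f x)))" if "integrable \<mu> k" for k :: "real \<Rightarrow> complex"
      by (rule integrable_mult_smooth[OF that comp(1)]) (rule B(1)[OF fx])
    have int_\<phi>': "integrable \<mu> (\<lambda>x. k x * of_real (deriv \<phi> (f x)))" if "integrable \<mu> k" for k :: "real \<Rightarrow> complex"
      by (rule integrable_mult_smooth[OF that comp(2)]) (rule B(2)[OF fx])
    define c where "c = (LINT x|\<mu>. h x)"
    define w' where "w' x = (if x \<in> smooth_points then deriv \<phi> (f x) + deriv u x * \<phi> (f x) else 0)" for x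
    note parts = transported_by_parts[OF \<phi> gi, of c, folded w'_def]
    have i1: "integrable \<mu> (\<lambda>x. h x * of_real (deriv u x) * of_real (\<phi> (f x)))" by (rule int_\<phi>[OF int(2)])
    have i2: "integrable \<mu> (\<lambda>x. g x * of_real (u x) * of_real (\<phi> (f x)))" by (rule int_\<phi>[OF int(1)])
    have "(LINT x|\<mu>. L h x * of_real (deriv \<phi> x)) = (LINT x|\<mu>. L (\<lambda>y. h y * of_real (deriv \<phi> (f y))) x)"
      by (rule Bochner_Integration.integral_cong[OF refl]) (rule transfer_mult[symmetric])
    also have "\<dots> = (LINT y|\<mu>. h y * of_real (deriv \<phi> (f y)))" by (rule transfer_integral(2)[OF int_\<phi>'[OF h]])
    also have "\<dots> = (LINT y|\<mu>. (c + centred_primitive g y) * of_real (w' y) - h y * of_real (deriv u y) * of_real (\<phi> (f y)))"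
    proof (rule integral_cong_AE)
      show "AE y in \<mu>. h y * of_real (deriv \<phi> (f y)) =
          (c + centred_primitive g y) * of_real (w' y) - h y * of_real (deriv u y) * of_real (\<phi> (f y))"
        using AE_smooth weak_derivative_representation[OF h g]
      proof eventually_elim
        fix y assume "y \<in> smooth_points" and hy: "h y = (LINT x|\<mu>. h x) + centred_primitive g y"
        then have "w' y = deriv \<phi> (f y) + deriv u y * \<phi> (f y)" by (simp add: w'_def)
        then show "h y * of_real (deriv \<phi> (f y)) =
          (c + centred_primitive g y) * of_real (w' y) - h y * of_real (deriv u y) * of_real (\<phi> (f y))"
          unfolding c_def hy[symmetric] by (simp add: algebra_simps)
      qed
    qed (intro borel_measurable_integrable int_\<phi>'[OF h] Bochner_Integration.integrable_diff parts(2) i1)+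
    also have "\<dots> = - (LINT x|\<mu>. g x * of_real (u x * \<phi> (f x))) - (LINT y|\<mu>. h y * of_real (deriv u y) * of_real (\<phi> (f y)))"
      using parts i1 by simp
    also have "\<dots> = - (LINT y|\<mu>. ?k y * of_real (\<phi> (f y)))"
      using i1 i2 by (simp add: distrib_right mult.assoc)
    also have "(LINT y|\<mu>. ?k y * of_real (\<phi> (f y))) = (LINT x|\<mu>. L (\<lambda>y. ?k y * of_real (\<phi> (f y))) x)"
      by (rule transfer_integral(2)[OF int_\<phi>[OF k], symmetric])
    also have "\<dots> = (LINT x|\<mu>. L ?k x * of_real (\<phi> x))" 
      by (rule Bochner_Integration.integral_cong[OF refl]) (rule transfer_mult)
    finally show ?thesis .
  qed
  then show ?thesis using transfer_integral(1)[OF k] by (simp add: weak_derivative_def)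
qed

end

section \<open>Approximation of the transfer operator by operators of finite rank\<close>

context expanding_map begin

abbreviation distortion :: real where "distortion \<equiv> LINT x|\<mu>. \<bar>deriv u x\<bar>"

text \<open>
  Subtracting vectors \<open>e j\<close> with weak derivatives \<open>L (u' s j)\<close> replaces \<open>h\<close> in the term \<open>u' h\<close> of the
  product rule by its difference from a combination of the \<open>s j\<close>.  Since the means cancel, the norm
  of the difference is the \<open>L\<^sup>1\<close> norm of its weak derivative, which \<open>L\<close> does not increase.
\<close>
lemma weak_derivative_transfer_minus:
  fixes a :: "nat \<Rightarrow> complex" and s e :: "nat \<Rightarrow> real \<Rightarrow> complex"
  assumes h: "h \<in> W11"
    and s: "\<And>j. j < n \<Longrightarrow> integrable \<mu> (s j)"
    and e: "\<And>j. j < n \<Longrightarrow> integrable \<mu> (e j) \<and> weak_derivative (e j) (L (\<lambda>y. s j y * of_real (deriv u y)))"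
    and mean: "(LINT x|\<mu>. h x) = (\<Sum>j<n. a j * (LINT x|\<mu>. e j x))"
  shows "mean_norm (\<lambda>x. L h x - (\<Sum>j<n. a j * e j x)) \<le>
    inverse lam * (LINT x|\<mu>. norm (weak_deriv h x)) +
    (LINT x|\<mu>. norm (h x - (\<Sum>j<n. a j * s j x)) * \<bar>deriv u x\<bar>)"
proof -
  note H = W11D[OF h]
  define k where "k y = weak_deriv h y * of_real (u y) + h y * of_real (deriv u y)" for y
  define q where "q y = weak_deriv h y * of_real (u y) + (h y - (\<Sum>j<n. a j * s j y)) * of_real (deriv u y)" for y
  have Lh: "integrable \<mu> (L h)" "(LINT x|\<mu>. L h x) = (LINT x|\<mu>. h x)" using transfer_integral[OF H(1)] .
  have w1: "weak_derivative (L h) (L k)"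
    unfolding k_def[abs_def] by (rule weak_derivative_transfer[OF H(1,2)])
  have ei: "integrable \<mu> (\<lambda>x. a j * e j x)" if "j < n" for j using e[OF that] by simp
  have w2: "weak_derivative (\<lambda>x. \<Sum>j<n. a j * e j x) (\<lambda>x. \<Sum>j<n. a j * L (\<lambda>y. s j y * of_real (deriv u y)) x)"
  proof (rule weak_derivative_sum)
    fix j assume j: "j < n"
    show "integrable \<mu> (\<lambda>x. a j * e j x) \<and> weak_derivative (\<lambda>x. a j * e j x) (\<lambda>x. a j * L (\<lambda>y. s j y * of_real (deriv u y)) x)"
      using e[OF j] weak_derivative_lin[of "e j" _ "e j" _ "a j" 0] by auto
  qed
  have ie: "integrable \<mu> (\<lambda>x. \<Sum>j<n. a j * e j x)" by (rule Bochner_Integration.integrable_sum) (use ei in simp)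
  have ihs: "integrable \<mu> (\<lambda>x. h x - (\<Sum>j<n. a j * s j x))"
    using H(1) s by (intro Bochner_Integration.integrable_diff Bochner_Integration.integrable_sum integrable_mult_right) auto
  have Lq: "L k x - (\<Sum>j<n. a j * L (\<lambda>y. s j y * of_real (deriv u y)) x) = L q x" for x
  proof -
    have "L q x = L (\<lambda>y. 1 * k y + (- 1) * (\<Sum>j<n. a j * (s j y * of_real (deriv u y)))) x"
      by (rule fun_cong[OF transfer_cong]) (simp add: q_def k_def left_diff_distrib sum_distrib_right mult.assoc)
    also have "\<dots> = 1 * L k x + (- 1) * L (\<lambda>y. \<Sum>j<n. a j * (s j y * of_real (deriv u y))) x" by (rule transfer_lin)
    finally show ?thesis by (simp only: transfer_sum) simp
  qed
  have w: "weak_derivative (\<lambda>x. L h x - (\<Sum>j<n. a j * e j x)) (L q)"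
    using weak_derivative_lin[OF Lh(1) w1 ie w2, of 1 "- 1"] by (simp add: Lq)
  have "(LINT x|\<mu>. L h x - (\<Sum>j<n. a j * e j x)) = 0"
    using Lh ie ei mean e by (simp add: Bochner_Integration.integral_sum)
  then have "mean_norm (\<lambda>x. L h x - (\<Sum>j<n. a j * e j x)) = (LINT x|\<mu>. norm (L q x))"
    using mean_norm_eq[OF w] by simp
  also have "\<dots> \<le> (LINT x|\<mu>. norm (q x))"
    unfolding q_def[abs_def] using weak_derivative_integrand[OF ihs H(3)]
    by (intro transfer_norm Bochner_Integration.integrable_add)
  also have "\<dots> \<le> (LINT x|\<mu>. inverse lam * norm (weak_deriv h x) + norm (h x - (\<Sum>j<n. a j * s j x)) * \<bar>deriv u x\<bar>)"
  proof (rule integral_mono_AE)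
    show "integrable \<mu> (\<lambda>x. norm (q x))"
      unfolding q_def using weak_derivative_integrand[OF ihs H(3)] by simp
    show "integrable \<mu> (\<lambda>x. inverse lam * norm (weak_deriv h x) + norm (h x - (\<Sum>j<n. a j * s j x)) * \<bar>deriv u x\<bar>)"
      using integrable_norm[OF weak_derivative_integrand(2)[OF ihs H(3)]] H(3) by (simp add: norm_mult)
    show "AE x in \<mu>. norm (q x) \<le> inverse lam * norm (weak_deriv h x) + norm (h x - (\<Sum>j<n. a j * s j x)) * \<bar>deriv u x\<bar>"
      using AE_smooth
    proof eventually_elim
      fix x assume x: "x \<in> smooth_points"
      have "norm (q x) \<le> norm (weak_deriv h x * of_real (u x)) + norm ((h x - (\<Sum>j<n. a j * s j x)) * of_real (deriv u x))"
        unfolding q_def by (rule norm_triangle_ineq)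
      also have "norm (weak_deriv h x * of_real (u x)) = norm (weak_deriv h x) * u x"
        using u_bound[OF x] unfolding norm_mult norm_of_real by simp
      also have "\<dots> \<le> norm (weak_deriv h x) * inverse lam" using u_bound[OF x] by (intro mult_left_mono) auto
      finally show "norm (q x) \<le> inverse lam * norm (weak_deriv h x) + norm (h x - (\<Sum>j<n. a j * s j x)) * \<bar>deriv u x\<bar>"
        by (simp add: norm_mult mult.commute)
    qed
  qed
  also have "\<dots> = inverse lam * (LINT x|\<mu>. norm (weak_deriv h x)) +
      (LINT x|\<mu>. norm (h x - (\<Sum>j<n. a j * s j x)) * \<bar>deriv u x\<bar>)"
    using integrable_norm[OF weak_derivative_integrand(2)[OF ihs H(3)]] H(3) by (simp add: norm_mult)
  finally show ?thesis .
qed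

lemma integrable_deriv_u: "integrable \<mu> (\<lambda>x. \<bar>deriv u x\<bar>)"
  using integrable_norm[OF weak_derivative_integrand(2)[of "\<lambda>_. 1" "\<lambda>_. 1"]] by simp

lemma one_W11: "(\<lambda>_. 1) \<in> W11" "weak_derivative (L (\<lambda>_. 1)) (L (\<lambda>y. 1 * of_real (deriv u y)))"
  using weak_derivative_zero[of 1] weak_derivative_transfer[of "\<lambda>_. 1" "\<lambda>_. 0"] by (auto intro: W11I)

text \<open>
  The case of a single vector \<open>L 1\<close> with \<open>s = 1\<close>: the mean of \<open>h\<close> approximates \<open>h\<close> uniformly up to
  the \<open>L\<^sup>1\<close> norm of the derivative.
\<close>
lemma transfer_minus_mean:
  assumes h: "h \<in> W11"
  shows "mean_norm (L h - cscale (LINT x|\<mu>. h x) (L (\<lambda>_. 1))) \<le> (inverse lam + distortion) * mean_norm h"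
proof -
  define c where "c = (LINT x|\<mu>. h x)"
  define G where "G = (LINT x|\<mu>. norm (weak_deriv h x))"
  note H = W11D[OF h]
  have one: "integrable \<mu> (L (\<lambda>_. 1))" "(LINT x|\<mu>. L (\<lambda>_. 1) x) = 1"
    using transfer_integral[of "\<lambda>_. 1"] by simp_all
  have eq: "L h - cscale c (L (\<lambda>_. 1)) = (\<lambda>x. L h x - (\<Sum>j<(1::nat). c * L (\<lambda>_. 1) x))"
    by (simp add: fun_eq_iff)
  have 1: "mean_norm (L h - cscale c (L (\<lambda>_. 1))) \<le> inverse lam * G +
    (LINT x|\<mu>. norm (h x - (\<Sum>j<(1::nat). c * 1)) * \<bar>deriv u x\<bar>)"
    unfolding eq G_def
    by (rule weak_derivative_transfer_minus[OF h]) (use one one_W11(2) in \<open>auto simp: c_def\<close>)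
  have "(LINT x|\<mu>. norm (h x - (\<Sum>j<(1::nat). c * 1)) * \<bar>deriv u x\<bar>) \<le> (LINT x|\<mu>. G * \<bar>deriv u x\<bar>)"
  proof (rule integral_mono_AE)
    have "integrable \<mu> (\<lambda>x. h x - c)" using H(1) by simp
    from integrable_norm[OF weak_derivative_integrand(2)[OF this H(3)]]
    show "integrable \<mu> (\<lambda>x. norm (h x - (\<Sum>j<(1::nat). c * 1)) * \<bar>deriv u x\<bar>)" by (simp add: norm_mult)
    show "integrable \<mu> (\<lambda>x. G * \<bar>deriv u x\<bar>)" using integrable_deriv_u by simp
    show "AE x in \<mu>. norm (h x - (\<Sum>j<(1::nat). c * 1)) * \<bar>deriv u x\<bar> \<le> G * \<bar>deriv u x\<bar>"
      using W11_poincare[OF h] unfolding c_def G_def by eventually_elim (auto intro!: mult_right_mono)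
  qed
  then have 2: "(LINT x|\<mu>. norm (h x - (\<Sum>j<(1::nat). c * 1)) * \<bar>deriv u x\<bar>) \<le> G * distortion" by simp
  have 3: "(inverse lam + distortion) * G \<le> (inverse lam + distortion) * mean_norm h"
    using branch_data(4) by (intro mult_left_mono add_nonneg_nonneg) (auto simp: mean_norm_def G_def)
  have "inverse lam * G + G * distortion = (inverse lam + distortion) * G" by (simp add: algebra_simps)
  then have "mean_norm (L h - cscale c (L (\<lambda>_. 1))) \<le> (inverse lam + distortion) * mean_norm h"
    using 1 2 3 by linarith
  then show ?thesis unfolding c_def .
qed

lemma functional_mean: "W.functional (\<lambda>h. LINT x|\<mu>. h x)"
  unfolding W.functional_def
proof (intro conjI ballI allI exI)
  show "(LINT x|\<mu>. (cscale a h + cscale b k) x) = a * (LINT x|\<mu>. h x) + b * (LINT x|\<mu>. k x)"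
    if "h \<in> W11" "k \<in> W11" for h k a b
    using W11D(1)[OF that(1)] W11D(1)[OF that(2)] unfolding plus_fun_def cscale_def by simp
  show "norm (LINT x|\<mu>. h x) \<le> 1 * mean_norm h" for h by (simp add: mean_norm_def)
qed

lemma L_one: "L (\<lambda>_. 1) \<in> W11"
  using transfer_integral(1)[of "\<lambda>_. 1"] one_W11(2) by (auto intro: W11I)

lemma op_transfer: "W.bounded_op L"
proof (rule W.opI)
  fix h assume h: "h \<in> W11"
  note H = W11D[OF h]
  show L: "L h \<in> W11" by (rule W11I[OF transfer_integral(1)[OF H(1)] weak_derivative_transfer[OF H(1,2)]])
  let ?c = "LINT x|\<mu>. h x"
  have "mean_norm (L h) \<le> mean_norm (L h - cscale ?c (L (\<lambda>_. 1))) + mean_norm (cscale ?c (L (\<lambda>_. 1)))"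
    by (rule W.nrm_le_diff[OF L mean_norm_scale(1)[OF L_one]])
  also have "\<dots> \<le> (inverse lam + distortion) * mean_norm h + norm ?c * mean_norm (L (\<lambda>_. 1))"
    using transfer_minus_mean[OF h] mean_norm_scale(2)[OF L_one] by simp
  also have "\<dots> \<le> (inverse lam + distortion) * mean_norm h + mean_norm h * mean_norm (L (\<lambda>_. 1))"
    by (intro add_mono order_refl mult_right_mono W.nrm_nonneg L_one) (simp add: mean_norm_def)
  finally show "mean_norm (L h) \<le> (inverse lam + distortion + mean_norm (L (\<lambda>_. 1))) * mean_norm h"
    by (simp add: algebra_simps)
next
  fix h k a b assume hk: "h \<in> W11" "k \<in> W11"
  have "L (cscale a h + cscale b k) = cscale a (L h) + cscale b (L k)"
    unfolding plus_fun_def cscale_def by (rule ext) (rule transfer_lin)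
  moreover have "L h \<in> W11" "L k \<in> W11"
    using W11I[OF transfer_integral(1) weak_derivative_transfer] W11D hk by blast+
  ultimately show "W.eqv (L (cscale a h + cscale b k)) (cscale a (L h) + cscale b (L k))"
    by (simp only: W.eqv_refl) (intro W.V_intros)
qed

lemma transfer_ess_bounded_distortion: "W.ess_bounded (inverse lam + distortion) L"
  unfolding W.ess_bounded_def
proof (intro exI conjI allI impI ballI)
  show "mean_norm (L h - (\<Sum>i<(1::nat). cscale (LINT x|\<mu>. h x) (L (\<lambda>_. 1)))) \<le> (inverse lam + distortion) * mean_norm h"
    if "h \<in> W11" for h
    using transfer_minus_mean[OF that] by simp
qed (rule functional_mean, rule L_one)

text \<open>
  The value at \<open>t\<close> of the continuous representative of \<open>h\<close>, which does not depend on the chosen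
  representative.
\<close>
definition point_value :: "real \<Rightarrow> (real \<Rightarrow> complex) \<Rightarrow> complex" where
  "point_value t h = (LINT x|\<mu>. h x) + centred_primitive (weak_deriv h) t"

lemma functional_point_value: "W.functional (point_value t)"
  unfolding W.functional_def
proof (intro conjI ballI allI exI)
  show "norm (point_value t h) \<le> 1 * mean_norm h" if "h \<in> W11" for h
    unfolding point_value_def mean_norm_def
    using norm_triangle_mono[OF order_refl centred_primitive_bound[OF W11D(3)[OF that]]] by simp
  fix h k a b assume h: "h \<in> W11" and k: "k \<in> W11"
  let ?s = "\<lambda>x. a * h x + b * k x"
  let ?g = "\<lambda>x. a * weak_deriv h x + b * weak_deriv k x"
  have eq: "cscale a h + cscale b k = ?s" unfolding plus_fun_def cscale_def ..
  note H = W11D[OF h] and K = W11D[OF k]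
  have w: "weak_derivative ?s ?g" by (rule weak_derivative_lin[OF H(1,2) K(1,2)])
  have s: "?s \<in> W11" by (rule W11I[OF _ w]) (use H K in simp)
  have prim: "primitive (weak_deriv ?s) x = a * primitive (weak_deriv h) x + b * primitive (weak_deriv k) x" for x
  proof -
    have "primitive (weak_deriv ?s) x = primitive ?g x"
      unfolding primitive_def
    proof (rule integral_cong_AE)
      show "AE t in \<mu>. indicator {..x} t *\<^sub>R weak_deriv ?s t = indicator {..x} t *\<^sub>R ?g t"
        using weak_deriv_eq[OF w] by eventually_elim simp
      show "(\<lambda>t. indicator {..x} t *\<^sub>R weak_deriv ?s t) \<in> borel_measurable \<mu>"
        by (rule borel_measurable_integrable[OF primitive_integrand[OF W11D(3)[OF s]]])
      show "(\<lambda>t. indicator {..x} t *\<^sub>R ?g t) \<in> borel_measurable \<mu>"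
        by (rule borel_measurable_integrable[OF primitive_integrand]) (use H K in simp)
    qed
    also have "\<dots> = (LINT t|\<mu>. a * (indicator {..x} t *\<^sub>R weak_deriv h t) + b * (indicator {..x} t *\<^sub>R weak_deriv k t))"
      unfolding primitive_def by (rule Bochner_Integration.integral_cong) (auto simp: scaleR_add_right)
    also have "\<dots> = a * primitive (weak_deriv h) x + b * primitive (weak_deriv k) x"
      unfolding primitive_def integral_mult_right_zero[symmetric]
      by (rule Bochner_Integration.integral_add; rule integrable_mult_right; rule primitive_integrand[OF H(3)] primitive_integrand[OF K(3)])
    finally show ?thesis .
  qed
  have "(LINT x|\<mu>. primitive (weak_deriv ?s) x) =
      a * (LINT x|\<mu>. primitive (weak_deriv h) x) + b * (LINT x|\<mu>. primitive (weak_deriv k) x)"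
    unfolding prim using primitive_integrable[OF H(3)] primitive_integrable[OF K(3)] by simp
  then show "point_value t (cscale a h + cscale b k) = a * point_value t h + b * point_value t k"
    unfolding eq point_value_def centred_primitive_def prim using H K by (simp add: algebra_simps)
qed

definition cell :: "nat \<Rightarrow> nat \<Rightarrow> real set" where
  "cell n j = {real j / real n..<real (Suc j) / real n}"

lemma cells:
  assumes "n > 0" "x \<in> {0..<1}"
  obtains j where "j < n" "x \<in> cell n j" "\<And>i. x \<in> cell n i \<Longrightarrow> i = j"
proof -
  define j where "j = nat \<lfloor>real n * x\<rfloor>"
  have nx: "0 \<le> real n * x" "real n * x < real n" using assms by auto
  have "real j \<le> real n * x" "real n * x < real (Suc j)" unfolding j_def using nx(1) by linarith+
  then have "j < n" using nx(2) by linarith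
  moreover have "x \<in> cell n j" using \<open>real j \<le> real n * x\<close> \<open>real n * x < real (Suc j)\<close> assms(1)
    by (simp add: cell_def field_simps)
  moreover have "i = j" if "x \<in> cell n i" for i
  proof -
    have "real i \<le> real n * x" "real n * x < real (Suc i)" using that assms(1) by (auto simp: cell_def field_simps)
    then show ?thesis using \<open>real j \<le> real n * x\<close> \<open>real n * x < real (Suc j)\<close> by linarith
  qed
  ultimately show thesis using that by blast
qed

lemma cell_measurable: "(indicator (cell n j) :: real \<Rightarrow> real) \<in> borel_measurable \<mu>"
  unfolding cell_def by (intro borel_measurable_unit) simp

lemma integrable_cell:
  "integrable \<mu> (indicator (cell n j) :: real \<Rightarrow> real)" "integrable \<mu> (indicator (cell n j) :: real \<Rightarrow> complex)"
proof -
  show 1: "integrable \<mu> (indicator (cell n j) :: real \<Rightarrow> real)"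
    by (rule unit.integrable_const_bound[where B = 1]) (use cell_measurable in \<open>auto simp: indicator_def\<close>)
  have "(\<lambda>x. complex_of_real (indicator (cell n j) x)) = indicator (cell n j)"
    by (auto simp: fun_eq_iff indicator_def)
  then show "integrable \<mu> (indicator (cell n j) :: real \<Rightarrow> complex)"
    using integrable_of_real[OF 1, where 'a = complex] by (simp only:)
qed

lemma integral_cell:
  assumes "j < n" shows "(LINT x|\<mu>. indicator (cell n j) x :: real) = 1 / real n"
proof -
  have sub: "cell n j \<subseteq> {0..1}"
  proof
    fix x assume "x \<in> cell n j"
    then have "real j / real n \<le> x" "x < real (Suc j) / real n" by (auto simp: cell_def)
    moreover have "real (Suc j) / real n \<le> 1" "0 \<le> real j / real n" using assms by (auto simp: field_simps)
    ultimately have "0 \<le> x" "x \<le> 1" by linarith+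
    then show "x \<in> {0..1}" by simp
  qed
  have "(LINT x|\<mu>. indicator (cell n j) x :: real) = (LINT x|lebesgue. indicator (cell n j) x)"
    unfolding integral_unit using sub by (intro Bochner_Integration.integral_cong) (auto simp: indicator_def)
  also have "\<dots> = measure lebesgue (cell n j)" by simp
  also have "\<dots> = 1 / real n" unfolding cell_def by (simp add: divide_right_mono diff_divide_distrib[symmetric])
  finally show ?thesis .
qed

text \<open>
  On a cell of length \<open>1 / n\<close> the function differs from its value at the left end point by at most the
  integral \<open>G j\<close> of the modulus of its derivative over the cell.
\<close>
lemma sampling_error:
  assumes h: "h \<in> W11" and n: "n > 0"
  shows "(LINT x|\<mu>. norm (h x - (\<Sum>j<n. point_value (real j / real n) h * indicator (cell n j) x))) \<le>
    (LINT x|\<mu>. norm (weak_deriv h x)) / real n"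
proof -
  note H = W11D[OF h]
  define g where "g = weak_deriv h"
  have g: "integrable \<mu> g" using H(3) by (simp add: g_def)
  define G where "G j = (LINT t|\<mu>. indicator (cell n j) t * norm (g t))" for j
  have int_cell: "integrable \<mu> (\<lambda>t. indicator (cell n j) t * norm (g t))" for j
  proof (rule Bochner_Integration.integrable_bound[OF integrable_norm[OF g]])
    show "(\<lambda>t. indicator (cell n j) t * norm (g t)) \<in> borel_measurable \<mu>"
      by (rule borel_measurable_times[OF cell_measurable borel_measurable_integrable[OF integrable_norm[OF g]]])
  qed (auto simp: indicator_def)
  have AE1: "AE x in \<mu>. x \<noteq> 1"
    unfolding AE_unit using AE_not_in[of "{1::real}" lebesgue] by (auto intro: null_sets_completionI)
  have "(LINT x|\<mu>. norm (h x - (\<Sum>j<n. point_value (real j / real n) h * indicator (cell n j) x))) \<le>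
      (LINT x|\<mu>. (\<Sum>j<n. G j * indicator (cell n j) x))"
  proof (rule integral_mono_AE)
    show "integrable \<mu> (\<lambda>x. \<Sum>j<n. G j * indicator (cell n j) x)"
      by (intro Bochner_Integration.integrable_sum integrable_mult_right integrable_cell(1))
    show "integrable \<mu> (\<lambda>x. norm (h x - (\<Sum>j<n. point_value (real j / real n) h * indicator (cell n j) x)))"
      by (intro integrable_norm Bochner_Integration.integrable_diff H(1) Bochner_Integration.integrable_sum integrable_mult_right integrable_cell(2))
    show "AE x in \<mu>. norm (h x - (\<Sum>j<n. point_value (real j / real n) h * indicator (cell n j) x)) \<le>
        (\<Sum>j<n. G j * indicator (cell n j) x)"
      using weak_derivative_representation[OF H(1,2)] AE1 AE_space[of \<mu>]
    proof eventually_elim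
      fix x assume hx: "h x = (LINT x|\<mu>. h x) + centred_primitive (weak_deriv h) x" and "x \<noteq> 1" "x \<in> space \<mu>"
      then have "x \<in> {0..<1}" by auto
      then obtain j where j: "j < n" "x \<in> cell n j" "\<And>i. x \<in> cell n i \<Longrightarrow> i = j" using cells[OF n] by blast
      have mem: "x \<in> cell n i \<longleftrightarrow> i = j" for i using j(2) j(3)[of i] by blast
      have ind: "indicator (cell n i) x = (if i = j then 1 else 0 :: complex)"
        "indicator (cell n i) x = (if i = j then 1 else 0 :: real)" for i
        by (simp_all add: indicator_def mem)
      have s: "(\<Sum>i<n. point_value (real i / real n) h * indicator (cell n i) x) = point_value (real j / real n) h"
        "(\<Sum>i<n. G i * indicator (cell n i) x) = G j"
        using j(1) by (simp_all add: ind if_distrib cong: if_cong)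
      have jx: "real j / real n \<le> x" using j(2) by (simp add: cell_def)
      have "h x - point_value (real j / real n) h = primitive g x - primitive g (real j / real n)"
        unfolding point_value_def hx g_def by (simp add: centred_primitive_def)
      then have "norm (h x - point_value (real j / real n) h) \<le> (LINT t|\<mu>. indicator {real j / real n<..x} t * norm (g t))"
        using primitive_diff[OF g jx] by simp
      also have "\<dots> \<le> G j"
        unfolding G_def
      proof (rule integral_mono'[OF int_cell])
        show "indicator {real j / real n<..x} t * norm (g t) \<le> indicator (cell n j) t * norm (g t)" for t
          using j(2) by (auto simp: indicator_def cell_def)
      qed (auto simp: indicator_def)
      finally show "norm (h x - (\<Sum>j<n. point_value (real j / real n) h * indicator (cell n j) x)) \<le>
        (\<Sum>j<n. G j * indicator (cell n j) x)" unfolding s .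
    qed
  qed
  also have "\<dots> = (\<Sum>j<n. LINT x|\<mu>. G j * indicator (cell n j) x)"
    by (rule Bochner_Integration.integral_sum) (intro integrable_mult_right integrable_cell(1))
  also have "\<dots> = (\<Sum>j<n. G j * (1 / real n))"
    by (rule sum.cong) (simp_all only: integral_mult_right_zero integral_cell lessThan_iff)
  also have "\<dots> = (\<Sum>j<n. G j) / real n" by (simp add: sum_divide_distrib)
  also have "(\<Sum>j<n. G j) = (LINT t|\<mu>. (\<Sum>j<n. indicator (cell n j) t * norm (g t)))"
    unfolding G_def by (rule Bochner_Integration.integral_sum[symmetric]) (rule int_cell)
  also have "\<dots> / real n \<le> (LINT t|\<mu>. norm (g t)) / real n"
  proof (rule divide_right_mono, rule integral_mono_AE)
    show "integrable \<mu> (\<lambda>t. \<Sum>j<n. indicator (cell n j) t * norm (g t))"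
      by (rule Bochner_Integration.integrable_sum) (rule int_cell)
    show "AE t in \<mu>. (\<Sum>j<n. indicator (cell n j) t * norm (g t)) \<le> norm (g t)"
      using AE1 AE_space[of \<mu>]
    proof eventually_elim
      fix x :: real assume "x \<noteq> 1" "x \<in> space \<mu>"
      then have "x \<in> {0..<1}" by auto
      then obtain j where j: "j < n" "x \<in> cell n j" "\<And>i. x \<in> cell n i \<Longrightarrow> i = j" using cells[OF n] by blast
      have mem: "x \<in> cell n i \<longleftrightarrow> i = j" for i using j(2) j(3)[of i] by blast
      have ind: "indicator (cell n i) x = (if i = j then 1 else 0 :: real)" for i
        by (simp add: indicator_def mem)
      show "(\<Sum>j<n. indicator (cell n j) x * norm (g x)) \<le> norm (g x)"
        using j(1) by (simp add: ind if_distrib[of "\<lambda>z. z * _"] cong: if_cong)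
    qed
  qed (use g in auto)
  finally show ?thesis by (simp add: g_def)
qed

text \<open>
  Sampling at \<open>n\<close> points costs at most \<open>C / n\<close>, where \<open>C\<close> bounds \<open>u'\<close>.  The vector \<open>e 0 = 1\<close> with
  \<open>s 0 = 0\<close> corrects the mean; the others are the centred primitives of \<open>L (u' s j)\<close>, where \<open>s j\<close> is
  the indicator function of a cell.
\<close>
lemma transfer_ess_bounded:
  assumes c: "inverse lam < c" shows "W.ess_bounded c L"
proof -
  obtain C where C: "C > 0" "\<And>x. x \<in> smooth_points \<Longrightarrow> \<bar>deriv u x\<bar> \<le> C"
    using deriv_u_continuous_bounded(2) by blast
  obtain m where m: "C / (c - inverse lam) < real m" using reals_Archimedean2 by blast
  define n where "n = Suc m"
  have n: "n > 0" "C / (c - inverse lam) < real n" using m by (auto simp: n_def)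
  have Cn: "inverse lam + C / real n \<le> c" using n c by (simp add: field_simps)
  define s where "s j = (case j of 0 \<Rightarrow> (\<lambda>_. 0) | Suc i \<Rightarrow> (\<lambda>x. indicator (cell n i) x :: complex))" for j
  define e where "e j = (case j of 0 \<Rightarrow> (\<lambda>_. 1) | Suc i \<Rightarrow> (\<lambda>x. 0 + centred_primitive (L (\<lambda>y. s j y * of_real (deriv u y))) x))" for j
  define l where "l j = (case j of 0 \<Rightarrow> (\<lambda>h. LINT x|\<mu>. h x) | Suc i \<Rightarrow> point_value (real i / real n))" for j
  have s: "integrable \<mu> (s j)" for j
  proof (cases j)
    case (Suc i)
    then show ?thesis using integrable_cell(2)[of n i] by (simp add: s_def)
  qed (simp add: s_def)
  have Ls: "integrable \<mu> (L (\<lambda>y. s j y * of_real (deriv u y)))" for j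
    by (rule transfer_integral(1)[OF weak_derivative_integrand(2)[OF s s]])
  have L0: "L (\<lambda>y. 0 * of_real (deriv u y)) = (\<lambda>_. 0)" by (simp add: fun_eq_iff transfer_eq)
  have e: "e j \<in> W11" "weak_derivative (e j) (L (\<lambda>y. s j y * of_real (deriv u y)))"
    "(LINT x|\<mu>. e j x) = (if j = 0 then 1 else 0)" for j
  proof -
    have "e j \<in> W11 \<and> weak_derivative (e j) (L (\<lambda>y. s j y * of_real (deriv u y))) \<and> (LINT x|\<mu>. e j x) = (if j = 0 then 1 else 0)"
    proof (cases j)
      case 0
      then show ?thesis using one_W11(1) weak_derivative_zero[of 1] L0 by (simp add: e_def s_def)
    next
      case (Suc i)
      then show ?thesis using W11_centred_primitive[OF Ls[of j], of 0] unfolding e_def by simp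
    qed
    then show "e j \<in> W11" "weak_derivative (e j) (L (\<lambda>y. s j y * of_real (deriv u y)))"
      "(LINT x|\<mu>. e j x) = (if j = 0 then 1 else 0)" by blast+
  qed
  have l: "W.functional (l j)" for j
    by (cases j) (simp_all add: l_def functional_mean functional_point_value)
  have bound: "mean_norm (L h - (\<Sum>j<Suc n. cscale (l j h) (e j))) \<le> c * mean_norm h" if h: "h \<in> W11" for h
  proof -
    note H = W11D[OF h]
    define G where "G = (LINT x|\<mu>. norm (weak_deriv h x))"
    define d where "d x = h x - (\<Sum>j<Suc n. l j h * s j x)" for x
    have d_eq: "d x = h x - (\<Sum>j<n. point_value (real j / real n) h * indicator (cell n j) x)" for x
      unfolding d_def sum.lessThan_Suc_shift by (simp add: l_def s_def)
    have di: "integrable \<mu> d"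
      unfolding d_def[abs_def] using s by (intro Bochner_Integration.integrable_diff H(1) Bochner_Integration.integrable_sum integrable_mult_right)
    have eq: "L h - (\<Sum>j<Suc n. cscale (l j h) (e j)) = (\<lambda>x. L h x - (\<Sum>j<Suc n. l j h * e j x))"
      unfolding fun_eq_iff minus_apply sum_fun_apply cscale_apply by simp
    have 1: "mean_norm (L h - (\<Sum>j<Suc n. cscale (l j h) (e j))) \<le> inverse lam * G + (LINT x|\<mu>. norm (d x) * \<bar>deriv u x\<bar>)"
      unfolding eq G_def d_def
    proof (rule weak_derivative_transfer_minus[OF h s])
      show "integrable \<mu> (e j) \<and> weak_derivative (e j) (L (\<lambda>y. s j y * of_real (deriv u y)))" for j
        using e(2) W11D(1)[OF e(1)] by blast
      show "(LINT x|\<mu>. h x) = (\<Sum>j<Suc n. l j h * (LINT x|\<mu>. e j x))"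
        unfolding e(3) sum.lessThan_Suc_shift by (simp add: l_def)
    qed
    have "(LINT x|\<mu>. norm (d x) * \<bar>deriv u x\<bar>) \<le> (LINT x|\<mu>. C * norm (d x))"
    proof (rule integral_mono_AE)
      show "integrable \<mu> (\<lambda>x. norm (d x) * \<bar>deriv u x\<bar>)"
        using integrable_norm[OF weak_derivative_integrand(2)[OF di di]] by (simp add: norm_mult)
      show "AE x in \<mu>. norm (d x) * \<bar>deriv u x\<bar> \<le> C * norm (d x)"
        using AE_smooth
      proof eventually_elim
        fix x assume "x \<in> smooth_points"
        from mult_left_mono[OF C(2)[OF this] norm_ge_zero[of "d x"]]
        show "norm (d x) * \<bar>deriv u x\<bar> \<le> C * norm (d x)" by (simp add: mult.commute)
      qed
    qed (use di in auto)
    then have 2: "(LINT x|\<mu>. norm (d x) * \<bar>deriv u x\<bar>) \<le> C * (LINT x|\<mu>. norm (d x))" by simp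
    have "(LINT x|\<mu>. norm (d x)) \<le> G / real n"
      unfolding d_eq G_def by (rule sampling_error[OF h n(1)])
    then have 3: "C * (LINT x|\<mu>. norm (d x)) \<le> C * (G / real n)" using C(1) by (intro mult_left_mono) auto
    have 4: "inverse lam * G + C * (G / real n) = (inverse lam + C / real n) * G" by (simp add: algebra_simps)
    have 5: "(inverse lam + C / real n) * G \<le> c * mean_norm h"
      using Cn c branch_data(4) by (intro mult_mono) (auto simp: G_def mean_norm_def intro: order_trans[of 0 "inverse lam"])
    show ?thesis using 1 2 3 4 5 by linarith
  qed
  show ?thesis unfolding W.ess_bounded_def
    by (rule exI[of _ "Suc n"], rule exI[of _ l], rule exI[of _ e]) (use l e(1) bound in blast)
qed

theorem essential_spectrum_transfer: "essential_spectrum W11 W11_norm L \<subseteq> {z. norm z \<le> inverse lam}"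
  by (rule W.essential_spectrum_bound[OF op_transfer _ transfer_ess_bounded]) (use branch_data(4) in auto)

text \<open>
  A spectral value of modulus greater than \<open>\<tau>\<close> is an eigenvalue.  Since \<open>L\<close> preserves integrals, an
  eigenvector for an eigenvalue other than 1 has mean zero, and on such functions \<open>L\<close> has norm at
  most \<open>\<tau>\<close>.
\<close>
theorem spectrum_transfer: "spectrum W11 W11_norm L - {1} \<subseteq> {z. norm z \<le> inverse lam + distortion}"
proof
  fix z assume z: "z \<in> spectrum W11 W11_norm L - {1}"
  define \<tau> where "\<tau> = inverse lam + distortion"
  have \<tau>: "0 \<le> \<tau>" using branch_data(4) by (simp add: \<tau>_def)
  show "z \<in> {z. norm z \<le> inverse lam + distortion}"
  proof (rule ccontr)
    assume "z \<notin> {z. norm z \<le> inverse lam + distortion}"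
    then have z\<tau>: "\<tau> < norm z" by (simp add: \<tau>_def)
    obtain h where h: "h \<in> W11" "mean_norm h \<noteq> 0" "W.eqv (cscale z h - L h) 0"
      using W.spectrum_eigenvector[OF op_transfer transfer_ess_bounded_distortion[folded \<tau>_def] \<tau> z\<tau>] z by blast
    have Lh: "L h \<in> W11" using W.op_in[OF op_transfer h(1)] .
    have zh: "cscale z h \<in> W11" using mean_norm_scale(1)[OF h(1)] .
    have eqv: "W.eqv (cscale z h) (L h)" using h(3) W.eqv_diff_zero[OF zh Lh] by blast
    have "(LINT x|\<mu>. cscale z h x) = (LINT x|\<mu>. L h x)" by (rule W.functional_cong[OF functional_mean eqv])
    then have "z * (LINT x|\<mu>. h x) = (LINT x|\<mu>. h x)"
      using transfer_integral(2)[OF W11D(1)[OF h(1)]] by (simp add: cscale_def)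
    then have mean: "(LINT x|\<mu>. h x) = 0" using z by simp
    have "norm z * mean_norm h = mean_norm (L h)"
      using W.eqv_nrm[OF eqv] mean_norm_scale(2)[OF h(1)] by simp
    also have "\<dots> \<le> \<tau> * mean_norm h"
    proof -
      have "L h - cscale 0 (L (\<lambda>_. 1)) = L h" by (simp add: fun_eq_iff)
      then show ?thesis using transfer_minus_mean[OF h(1)] unfolding mean \<tau>_def by (simp only:)
    qed
    finally have "norm z \<le> \<tau>" using h(2) W.nrm_nonneg[OF h(1)] by simp
    then show False using z\<tau> by simp
  qed
qed

end

theorem theorem3p6:
  fixes f :: "real \<Rightarrow> real" and p :: "nat \<Rightarrow> real" and N r :: nat and lam :: real
  assumes "r \<ge> 2"
    and "full_branch_expanding r N p lam f"
  shows "essential_spectrum W11 W11_norm (transfer_operator N p f)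
           \<subseteq> {z. norm z \<le> inverse lam} \<and>
         spectrum W11 W11_norm (transfer_operator N p f) - {1}
           \<subseteq> {z. norm z \<le> inverse lam +
                (LINT y|lebesgue_on {0..1}. \<bar>deriv (\<lambda>x. 1 / deriv f x) y\<bar>)}"
proof -
  interpret expanding_map r N p lam f by standard (use assms in auto)
  show ?thesis using essential_spectrum_transfer spectrum_transfer by blast
qed

end
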